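(* Let $\Lambda(\Omega)\subset\mathbb{R}^m$ be a simple generic model set with $\Omega$ symmetric around the origin, let $\mathcal{K}$ be a countable index set, and let $g_k,h_k\in W(L^2,\ell^1)$ for every $k\in\mathcal{K}$. Let $\{T_\lambda g_k:k\in\mathcal{K},\lambda\in\Lambda(\Omega)\}$ and $\{T_\lambda h_k:k\in\mathcal{K},\lambda\in\Lambda(\Omega)\}$ be Bessel sequences in $L^2(\mathbb{R}^m)$ with upper frame bounds $B_g$ and $B_h$, respectively. Then $$\sum_{k\in\mathcal{K}}\sum_{\lambda\in\Lambda(\Omega)}\langle f,T_\lambda g_k\rangle\langle T_\lambda h_k,f\rangle=\|f\|_2^2\quad\text{for all } f\in L^2(\mathbb{R}^m)$$ if and only if, for each $\eta\in\Gamma^*$, $$D(\Lambda(\Omega))\,\Phi(-p_2^*(\eta))\sum_{k\in\mathcal{K}}\overline{\widehat{g_k}(t)}\,\widehat{h_k}(t-p_1^*(\eta))=\delta_{\eta,0}\quad\text{for a.e. } t\in\mathbb{R}^m,$$ where $\delta$ is the Kronecker delta.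
   Context: Notation: $T_\lambda f(t)=f(t-\lambda)$; $\widehat f(\omega)=\int_{\mathbb{R}^m} f(t)e^{-2\pi i t\cdot\omega}\,dt$. $W(L^p,\ell^q)$ is the space of measurable functions $f$ on $\mathbb{R}^m$ with $\|f\|_{p,q}=\big(\sum_{k\in\mathbb{Z}^m}\|f\mathbf{1}_{k+[0,1]^m}\|_p^q\big)^{1/q}<\infty$. A family $\{e_j\}$ is a Bessel sequence with upper frame bound $B$ if $\sum_j|\langle f,e_j\rangle|^2\le B\|f\|_2^2$ for all $f\in L^2(\mathbb{R}^m)$. Model sets: let $\Gamma\subset\mathbb{R}^m\times\mathbb{R}$ be a lattice and $p_1:\mathbb{R}^m\times\mathbb{R}\to\mathbb{R}^m$, $p_2:\mathbb{R}^m\times\mathbb{R}\to\mathbb{R}$ the orthogonal projections; assume $p_1|_\Gamma$ and $p_2|_\Gamma$ are injective with dense images. $\Gamma^*=\{y:\gamma\cdot y\in\mathbb{Z}\ \forall\gamma\in\Gamma\}$ is the dual lattice and $p_1^*,p_2^*$ are the same projections used on $\Gamma^*$ (also injective on $\Gamma^*$ with dense images). For a compact interval $\Omega\subset\mathbb{R}$ with non-empty interior, $\Lambda(\Omega)=\{p_1(\gamma):\gamma\in\Gamma,\ p_2(\gamma)\in\Omega\}$ is a simple model set; it is generic if $p_2(\Gamma)\cap\partial\Omega=\emptyset$. Standing assumption: also $p_2^*(\Gamma^* )\cap\partial\Omega=\emptyset$. Its density is $D(\Lambda(\Omega))=\lim_{R\to\infty}\#(\Lambda(\Omega)\cap(x+R[0,1]^m))/R^m=|\Omega|/\mathrm{vol}(\Gamma)$.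 The function $\Phi$: fix $0<\epsilon<1$, put $\Omega_n=(1-\epsilon^n)\Omega$ and let $\psi_n$ be the infinite convolution product over $s=0,1,2,\dots$ of the functions $\mathbf{1}_{\epsilon^{ns}\Omega_n}/|\epsilon^{ns}\Omega_n|$ (convergent in $L^1(\mathbb{R})$), so that $\widehat{\psi_n}(t)=\prod_{s=0}^\infty\mathrm{sinc}(t|\epsilon^{ns}\Omega_n|)$ with $\mathrm{sinc}(t)=\sin(\pi t)/(\pi t)$. Let $\Psi$ be the uniform limit of $\widehat{\psi_n}$ as $n\to\infty$ (namely $\Psi(t)=\mathrm{sinc}(|\Omega|t)$, the Fourier transform of $\mathbf{1}_\Omega/|\Omega|$), and set $\Phi=|\Omega|\cdot(\Psi*\Psi)$. Then $\Phi(0)=1$. *)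

theory Defs
  imports "HOL-Analysis.Analysis"
begin

definition L2_space :: "('a::euclidean_space \<Rightarrow> complex) set" where
  "L2_space = {f. f \<in> borel_measurable lebesgue \<and> integrable lebesgue (\<lambda>t. (cmod (f t))\<^sup>2)}"

definition L2_inner :: "('a::euclidean_space \<Rightarrow> complex) \<Rightarrow> ('a \<Rightarrow> complex) \<Rightarrow> complex" where
  "L2_inner f g = (LINT t|lebesgue. f t * cnj (g t))"

definition L2_norm :: "('a::euclidean_space \<Rightarrow> complex) \<Rightarrow> real" where
  "L2_norm f = sqrt (LINT t|lebesgue. (cmod (f t))\<^sup>2)"

definition translate :: "'a::euclidean_space \<Rightarrow> ('a \<Rightarrow> complex) \<Rightarrow> 'a \<Rightarrow> complex" where
  "translate l f = (\<lambda>t. f (t - l))"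

definition fourier :: "('a::euclidean_space \<Rightarrow> complex) \<Rightarrow> 'a \<Rightarrow> complex" where
  "fourier f \<omega> = (LINT t|lebesgue. f t * exp (- 2 * of_real pi * \<i> * of_real (t \<bullet> \<omega>)))"

definition convolve :: "('a::euclidean_space \<Rightarrow> complex) \<Rightarrow> ('a \<Rightarrow> complex) \<Rightarrow> 'a \<Rightarrow> complex" where
  "convolve f g x = (LINT y|lebesgue. f y * g (x - y))"

definition unit_cube_at :: "int^'m \<Rightarrow> (real^'m) set" where
  "unit_cube_at k = {x. \<forall>i. of_int (k $ i) \<le> x $ i \<and> x $ i \<le> of_int (k $ i) + 1}"

text \<open>For finite exponents \<open>p, q\<close> only. Finiteness of the norm is spelled out
  as integrability on every cube together with summability over the cubes.\<close>

definition wiener_amalgam :: "real \<Rightarrow> real \<Rightarrow> (real^'m \<Rightarrow> complex) set" where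
  "wiener_amalgam p q = {f. f \<in> borel_measurable lebesgue
     \<and> (\<forall>k. set_integrable lebesgue (unit_cube_at k) (\<lambda>x. cmod (f x) powr p))
     \<and> (\<lambda>k. ((LINT x:unit_cube_at k|lebesgue. cmod (f x) powr p) powr (1 / p)) powr q)
           summable_on UNIV}"

definition bessel_sequence ::
    "'i set \<Rightarrow> ('i \<Rightarrow> 'a::euclidean_space \<Rightarrow> complex) \<Rightarrow> real \<Rightarrow> bool" where
  "bessel_sequence I e B \<longleftrightarrow>
     (\<forall>j\<in>I. e j \<in> L2_space) \<and>
     (\<forall>f\<in>L2_space. (\<lambda>j. (cmod (L2_inner f (e j)))\<^sup>2) summable_on I \<and>
        (\<Sum>\<^sub>\<infinity>j\<in>I. (cmod (L2_inner f (e j)))\<^sup>2) \<le> B * (L2_norm f)\<^sup>2)"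

definition is_lattice :: "'a::euclidean_space set \<Rightarrow> bool" where
  "is_lattice G \<longleftrightarrow> (\<exists>B. independent B \<and> span B = UNIV \<and>
     G = {\<Sum>b\<in>B. of_int (c b) *\<^sub>R b | c :: 'a \<Rightarrow> int. True})"

definition dual_lattice :: "'a::euclidean_space set \<Rightarrow> 'a set" where
  "dual_lattice G = {y. \<forall>x\<in>G. x \<bullet> y \<in> \<int>}"

text \<open>By duality, the projections restricted to the dual lattice are then also injective
  with dense images, so this is not required separately.\<close>

definition model_lattice :: "((real^'m) \<times> real) set \<Rightarrow> bool" where
  "model_lattice G \<longleftrightarrow> is_lattice G
     \<and> inj_on fst G \<and> closure (fst ` G) = UNIV
     \<and> inj_on snd G \<and> closure (snd ` G) = UNIV"

definition window :: "real set \<Rightarrow> bool" where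
  "window W \<longleftrightarrow> compact W \<and> is_interval W \<and> interior W \<noteq> {}"

definition model_set :: "((real^'m) \<times> real) set \<Rightarrow> real set \<Rightarrow> (real^'m) set" where
  "model_set G W = fst ` {x \<in> G. snd x \<in> W}"

definition generic :: "((real^'m) \<times> real) set \<Rightarrow> real set \<Rightarrow> bool" where
  "generic G W \<longleftrightarrow> snd ` G \<inter> frontier W = {}"

definition point_density :: "(real^'m) set \<Rightarrow> real" where
  "point_density L = (THE D. \<forall>x.
     ((\<lambda>R. real (card (L \<inter> (\<lambda>y. x + R *\<^sub>R y) ` cbox 0 1)) / R ^ CARD('m)) \<longlongrightarrow> D) at_top)"

definition normalized_indicator :: "real set \<Rightarrow> real \<Rightarrow> complex" where
  "normalized_indicator A x = of_real (indicator A x / measure lebesgue A)"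

definition shrunk_window :: "real set \<Rightarrow> real \<Rightarrow> nat \<Rightarrow> real set" where
  "shrunk_window W \<epsilon> n = (\<lambda>x. (1 - \<epsilon> ^ n) * x) ` W"

definition psi_factor :: "real set \<Rightarrow> real \<Rightarrow> nat \<Rightarrow> nat \<Rightarrow> real \<Rightarrow> complex" where
  "psi_factor W \<epsilon> n s = normalized_indicator ((\<lambda>x. \<epsilon> ^ (n * s) * x) ` shrunk_window W \<epsilon> n)"

fun psi_partial :: "real set \<Rightarrow> real \<Rightarrow> nat \<Rightarrow> nat \<Rightarrow> real \<Rightarrow> complex" where
  "psi_partial W \<epsilon> n 0 = psi_factor W \<epsilon> n 0"
| "psi_partial W \<epsilon> n (Suc N) = convolve (psi_partial W \<epsilon> n N) (psi_factor W \<epsilon> n (Suc N))"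

text \<open>A representative of the \<open>L\<^sup>1\<close> limit of the partial convolution products; it is unique
  up to null sets, so its Fourier transform does not depend on the choice. For \<open>n = 0\<close>
  the shrunk window degenerates to a point and the value is irrelevant, since only the limit
  \<open>n \<rightarrow> \<infinity>\<close> is used.\<close>

definition psi :: "real set \<Rightarrow> real \<Rightarrow> nat \<Rightarrow> real \<Rightarrow> complex" where
  "psi W \<epsilon> n = (SOME \<psi>. integrable lebesgue \<psi> \<and>
     (\<lambda>N. LINT x|lebesgue. cmod (psi_partial W \<epsilon> n N x - \<psi> x)) \<longlonglongrightarrow> 0)"

definition Psi :: "real set \<Rightarrow> real \<Rightarrow> real \<Rightarrow> complex" where
  "Psi W \<epsilon> = (THE F. uniform_limit UNIV (\<lambda>n. fourier (psi W \<epsilon> n)) F sequentially)"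

definition Phi :: "real set \<Rightarrow> real \<Rightarrow> real \<Rightarrow> complex" where
  "Phi W \<epsilon> t = of_real (measure lebesgue W) * convolve (Psi W \<epsilon>) (Psi W \<epsilon>) t"

end

theory Submission
  imports Defs "HOL-Probability.Characteristic_Functions" "HOL-Real_Asymp.Real_Asymp"
begin

text \<open>
  The points \<open>(x, y)\<close> of the torus \<open>(\<real>\<^sup>m \<times> \<real>) / \<Gamma>\<close> parametrise the hull of the model set: the fibre over
  \<open>(x, y)\<close> consists of the points \<open>p\<^sub>1 \<gamma> - x\<close> with \<open>p\<^sub>2 \<gamma> - y \<in> \<Omega>\<close>. Summing
  \<open>\<langle>f, T g\<^sub>k\<rangle> \<langle>T h\<^sub>k, f\<rangle>\<close> over such a fibre and over \<open>k\<close> gives a \<open>\<Gamma>\<close>-periodic function \<open>W\<close>, and unfolding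
  the integral over a fundamental cell with the Plancherel formula gives its Fourier coefficient at
  \<open>\<eta>\<close>: the product of the Fourier transform of the window at \<open>p\<^sub>2 \<eta>\<close> and the integral of
  \<open>f^(t) cnj (f^(t - p\<^sub>1 \<eta>)) \<Sum>\<^sub>k cnj (g\<^sub>k^(t)) h\<^sub>k^(t - p\<^sub>1 \<eta>)\<close>.
  For \<open>f\<close> obtained by averaging over small balls, \<open>W\<close> is bounded, and continuous at all points whose
  level \<open>y\<close> is generic. If the reproducing formula holds, \<open>W\<close> is constant on the dense leaf through
  the origin, hence almost everywhere, and its coefficients determine the symbols. Conversely, if all
  coefficients of \<open>W - \<parallel>f\<parallel>\<^sup>2\<close> vanish, this function vanishes at the origin, a point of continuity because
  the model set is generic; density of the averaged functions in \<open>L\<^sup>2\<close> finishes the proof.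
\<close>

subsection \<open>Lebesgue integration\<close>

text \<open>Averaging over balls is forced by the sum over \<open>K\<close>. A frame coefficient is
  a point value of a correlation, and the Bessel bound controls such values for each translate of
  \<open>f\<close> separately; it does not make the tails over \<open>K\<close> small uniformly near
  a point of the torus. Averaging replaces a point value by an integral over a ball, and the
  integrals over all of space are summable over \<open>K\<close> because the model set is relatively
  dense. The jumps of the sharp window remain, at countably many levels. Hence uniqueness of Fourier
  coefficients is proved at one point of continuity: an almost everywhere statement would say
  nothing about the origin. In the other direction, one pair of functions yields one integral
  identity for each \<eta>; replacing \<open>f\<close> by its translates in one slot turns it into
  the vanishing of a whole Fourier transform. Constants: the density is \<open>2 * a / covol\<close>
  and \<Phi> is the window transform divided by \<open>2 * a\<close>, so their product is the window
  transform over \<open>covol\<close>; and \<open>covol\<close> is the integral of the trivial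
  character over the cell.\<close>

lemma integrable_lborel_affine:
  fixes f :: "'a::euclidean_space \<Rightarrow> 'b::{banach, second_countable_topology}"
  assumes "integrable lborel f" "c \<noteq> 0"
  shows "integrable lborel (\<lambda>x. f (t + c *\<^sub>R x))"
proof -
  have [measurable]: "f \<in> borel_measurable borel" using assms by auto
  have "integrable (density (distr lborel borel (\<lambda>x. t + c *\<^sub>R x)) (\<lambda>_. ennreal (\<bar>c\<bar>^DIM('a)))) f"
    using assms lborel_affine[of c t] by simp
  then have "integrable (distr lborel borel (\<lambda>x. t + c *\<^sub>R x)) (\<lambda>x. \<bar>c\<bar>^DIM('a) *\<^sub>R f x)"
    by (subst (asm) integrable_density) auto
  then have "integrable (distr lborel borel (\<lambda>x. t + c *\<^sub>R x)) f"
    using assms(2) integrable_scaleR_right[of "inverse (\<bar>c\<bar>^DIM('a))" _ "\<lambda>x. \<bar>c\<bar>^DIM('a) *\<^sub>R f x"] by simp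
  then show ?thesis
    by (subst (asm) integrable_distr_eq) auto
qed

lemma integral_lborel_affine:
  fixes f :: "'a::euclidean_space \<Rightarrow> 'b::{banach, second_countable_topology}"
  assumes "integrable lborel f" "c \<noteq> 0"
  shows "(LBINT x. f (t + c *\<^sub>R x)) = (1 / \<bar>c\<bar>^DIM('a)) *\<^sub>R (LBINT x. f x)"
proof -
  have [measurable]: "f \<in> borel_measurable borel" using assms by auto
  have "(LBINT x. f x) = (\<integral>x. f x \<partial>(density (distr lborel borel (\<lambda>x. t + c *\<^sub>R x)) (\<lambda>_. ennreal (\<bar>c\<bar>^DIM('a)))))"
    using assms lborel_affine[of c t] by simp
  also have "\<dots> = (\<integral>x. \<bar>c\<bar>^DIM('a) *\<^sub>R f x \<partial>(distr lborel borel (\<lambda>x. t + c *\<^sub>R x)))"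
    by (subst integral_density) auto
  also have "\<dots> = \<bar>c\<bar>^DIM('a) *\<^sub>R (LBINT x. f (t + c *\<^sub>R x))"
    by (subst integral_distr) auto
  finally show ?thesis using assms by simp
qed

lemma integrable_lborel_shift:
  fixes f :: "'a::euclidean_space \<Rightarrow> 'b::{banach, second_countable_topology}"
  shows "integrable lborel (\<lambda>x. f (x + c)) \<longleftrightarrow> integrable lborel f"
    and "integrable lborel (\<lambda>x. f (x - c)) \<longleftrightarrow> integrable lborel f"
    and "integrable lborel (\<lambda>x. f (c + x)) \<longleftrightarrow> integrable lborel f"
    and "integrable lborel (\<lambda>x. f (c - x)) \<longleftrightarrow> integrable lborel f"
proof -
  have *: "integrable lborel (\<lambda>x. g (c + d *\<^sub>R x))" if "integrable lborel g" "d \<noteq> 0"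
    for g :: "'a \<Rightarrow> 'b" and c d
    using that by (rule integrable_lborel_affine)
  show 3: "integrable lborel (\<lambda>x. f (c + x)) \<longleftrightarrow> integrable lborel f" for c
    using *[of f 1 c] *[of "\<lambda>x. f (c + x)" 1 "-c"] by auto
  show "integrable lborel (\<lambda>x. f (x + c)) \<longleftrightarrow> integrable lborel f"
    using 3[of c] by (simp add: add.commute)
  show "integrable lborel (\<lambda>x. f (x - c)) \<longleftrightarrow> integrable lborel f"
    using 3[of "-c"] by (simp add: add.commute)
  show "integrable lborel (\<lambda>x. f (c - x)) \<longleftrightarrow> integrable lborel f"
    using *[of f "-1" c] *[of "\<lambda>x. f (c - x)" "-1" "c"] by auto
qed

lemma integral_lborel_shift:
  fixes f :: "'a::euclidean_space \<Rightarrow> 'b::{banach, second_countable_topology}"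
  shows "(LBINT x. f (x + c)) = (LBINT x. f x)"
    and "(LBINT x. f (x - c)) = (LBINT x. f x)"
    and "(LBINT x. f (c + x)) = (LBINT x. f x)"
    and "(LBINT x. f (c - x)) = (LBINT x. f x)"
proof -
  show 3: "(LBINT x. f (c + x)) = (LBINT x. f x)" for c
    using integral_lborel_affine[of f 1 c]
    by (cases "integrable lborel f") (auto simp: not_integrable_integral_eq integrable_lborel_shift)
  show "(LBINT x. f (x + c)) = (LBINT x. f x)"
    using 3[of c] by (simp add: add.commute)
  show "(LBINT x. f (x - c)) = (LBINT x. f x)"
    using 3[of "-c"] by (simp add: add.commute)
  show "(LBINT x. f (c - x)) = (LBINT x. f x)"
    using integral_lborel_affine[of f "-1" c]
    by (cases "integrable lborel f") (auto simp: not_integrable_integral_eq integrable_lborel_shift)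
qed

text \<open>An indicator of an open set is lower semicontinuous, so dominated convergence controls the
  positive part of the difference; its integral is half of the whole since the difference integrates to 0.\<close>

lemma L1_translation_open:
  fixes U :: "'a::euclidean_space set"
  assumes U: "open U" "emeasure lborel U < \<infinity>" and s: "s \<longlonglongrightarrow> 0"
  shows "(\<lambda>n. \<integral>t. \<bar>indicator U (t - s n) - indicator U t\<bar> \<partial>lborel) \<longlonglongrightarrow> (0::real)"
proof -
  have [measurable]: "U \<in> sets borel" using U by auto
  have iU: "integrable lborel (indicator U :: 'a \<Rightarrow> real)"
    using U by simp
  have iUs: "integrable lborel (\<lambda>t. indicator U (t - c) :: real)" for c
    by (subst integrable_lborel_shift) (fact iU)
  have lim: "(\<lambda>n. \<integral>t. max 0 (indicator U t - indicator U (t - s n)) \<partial>lborel) \<longlonglongrightarrow> (\<integral>t. (0::real) \<partial>(lborel::'a measure))"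
  proof (rule integral_dominated_convergence[where w="indicator U"])
    show "AE t in lborel. (\<lambda>n. max 0 (indicator U t - indicator U (t - s n))) \<longlonglongrightarrow> (0::real)"
    proof (rule AE_I2)
      fix t :: 'a
      show "(\<lambda>n. max 0 (indicator U t - indicator U (t - s n))) \<longlonglongrightarrow> (0::real)"
      proof (cases "t \<in> U")
        case True
        have "(\<lambda>n. t - s n) \<longlonglongrightarrow> t - 0" by (intro tendsto_intros s)
        then have "\<forall>\<^sub>F n in sequentially. t - s n \<in> U"
          using U True by (auto simp: tendsto_def)
        then have "\<forall>\<^sub>F n in sequentially. max 0 (indicator U t - indicator U (t - s n)) = (0::real)"
          by eventually_elim (use True in auto)
        then show ?thesis by (rule tendsto_eventually)
      next
        case False
        then have "max 0 (indicator U t - indicator U (t - s n)) = (0::real)" for n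
          by (auto simp: indicator_def)
        then show ?thesis by simp
      qed
    qed
  qed (use iU in \<open>auto simp: indicator_def\<close>)
  have "(LBINT t. \<bar>indicator U (t - c) - indicator U t\<bar>) = (2::real) * (LBINT t. max 0 (indicator U t - indicator U (t - c)))" for c
  proof -
    have "(LBINT t. \<bar>indicator U (t - c) - indicator U t\<bar>)
       = (LBINT t. (indicator U (t - c) - indicator U t) + (2::real) * max 0 (indicator U t - indicator U (t - c)))"
      by (intro Bochner_Integration.integral_cong) (auto simp: indicator_def)
    also have "\<dots> = ((LBINT t. indicator U (t - c)) - (LBINT t. indicator U t))
         + (LBINT t. 2 * max 0 (indicator U t - indicator U (t - c)))"
      using iU iUs by (subst Bochner_Integration.integral_add) auto
    also have "(LBINT t. indicator U (t - c)) = (\<integral>t. indicator U t \<partial>(lborel::'a measure) :: real)"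
      by (rule integral_lborel_shift)
    finally show ?thesis by simp
  qed
  with tendsto_mult[OF tendsto_const[of 2] lim] show ?thesis by simp
qed

lemma L1_dist_triangle:
  fixes u v w :: "'a \<Rightarrow> 'b::{banach, second_countable_topology}"
  assumes "integrable M u" "integrable M v" "integrable M w"
  shows "(\<integral>t. norm (u t - w t) \<partial>M) \<le> (\<integral>t. norm (u t - v t) \<partial>M) + (\<integral>t. norm (v t - w t) \<partial>M)"
proof -
  have "(\<integral>t. norm (u t - w t) \<partial>M) \<le> (\<integral>t. norm (u t - v t) + norm (v t - w t) \<partial>M)"
    using assms by (intro integral_mono) (auto intro: norm_diff_triangle_le)
  also have "\<dots> = (\<integral>t. norm (u t - v t) \<partial>M) + (\<integral>t. norm (v t - w t) \<partial>M)"
    using assms by (intro Bochner_Integration.integral_add) auto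
  finally show ?thesis .
qed

text \<open>Translation is an isometry of L1, so replacing \<open>u\<close> by \<open>v\<close>
  costs their distance twice, whatever the shift. This carries continuity of translation from open
  sets to measurable sets, and from simple functions to all integrable ones.\<close>

lemma L1_translation_approx:
  fixes u v :: "'a::euclidean_space \<Rightarrow> 'b::{banach, second_countable_topology}"
  assumes [simp]: "integrable lborel u" "integrable lborel v"
  shows "(LBINT t. norm (u (t - c) - u t))
     \<le> 2 * (LBINT t. norm (u t - v t)) + (LBINT t. norm (v (t - c) - v t))"
proof -
  have [simp]: "integrable lborel (\<lambda>t. u (t - c))" "integrable lborel (\<lambda>t. v (t - c))"
    by (simp_all add: integrable_lborel_shift)
  have "(LBINT t. norm (u (t - c) - u t)) \<le> (LBINT t. norm (u (t - c) - v (t - c))) + (LBINT t. norm (v (t - c) - u t))"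
    by (rule L1_dist_triangle) auto
  also have "(LBINT t. norm (u (t - c) - v (t - c))) = (LBINT t. norm (u t - v t))"
    by (rule integral_lborel_shift(2)[where f="\<lambda>t. norm (u t - v t)"])
  also have "(LBINT t. norm (v (t - c) - u t)) \<le> (LBINT t. norm (v (t - c) - v t)) + (LBINT t. norm (v t - u t))"
    by (rule L1_dist_triangle) auto
  finally show ?thesis by (simp add: norm_minus_commute)
qed

lemma L1_translation:
  fixes u :: "'a::euclidean_space \<Rightarrow> 'b::{banach, second_countable_topology}"
  assumes "integrable lborel u" "s \<longlonglongrightarrow> 0"
  shows "(\<lambda>n. \<integral>t. norm (u (t - s n) - u t) \<partial>lborel) \<longlonglongrightarrow> 0"
  using assms(1)
proof (induction rule: integrable_induct)
  case (base A c)
  then have A [measurable]: "A \<in> sets borel" by simp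
  have iA: "integrable lborel (indicator A :: 'a \<Rightarrow> real)" using base by simp
  have main: "(\<lambda>n. \<integral>t. \<bar>indicator A (t - s n) - indicator A t\<bar> \<partial>lborel) \<longlonglongrightarrow> (0::real)"
  proof (rule metric_LIMSEQ_I)
    fix e :: real assume "0 < e"
    \<comment> \<open>A quarter of \<open>e\<close> suffices for the difference of \<open>U\<close>
      and \<open>A\<close>: it is counted twice, and the translation of \<open>U\<close> takes the
      other half.\<close>
    obtain U where U: "open U" "A \<subseteq> U" "emeasure lborel (U - A) < e / 4"
      using outer_regular_lborel[of A "e/4"] A \<open>0 < e\<close> by auto
    have [measurable]: "U \<in> sets borel" using U by auto
    have "emeasure lborel U \<le> emeasure lborel A + emeasure lborel (U - A)"
      by (metis A Diff_partition U(2) \<open>U \<in> sets borel\<close> emeasure_subadditive sets.Diff sets_lborel)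
    also have "\<dots> < \<infinity>" using base U
      by (metis ennreal_add_eq_top ennreal_less_top infinity_ennreal_def order.strict_trans top.not_eq_extremum)
    finally have fU: "emeasure lborel U < \<infinity>" .
    have iU: "integrable lborel (indicator U :: 'a \<Rightarrow> real)" using fU by simp
    have "(LBINT t. norm (indicator A t - indicator U t :: real)) = (LBINT t. indicator (U - A) t)"
      using U by (intro Bochner_Integration.integral_cong) (auto simp: indicator_def)
    also have "\<dots> = measure lborel (U - A)" by simp
    also have "\<dots> < e / 4"
      using U \<open>0<e\<close> unfolding measure_def
      by (metis divide_pos_pos enn2real_less_iff ennreal_less_top less_le_trans less_numeral_extra(1) nat_less_le order.strict_trans zero_less_numeral ennreal_lessI infinity_ennreal_def less_ennreal.rep_eq top_neq_ennreal top.not_eq_extremum zero_less_divide_iff enn2real_ennreal)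
    finally have d: "(LBINT t. norm (indicator A t - indicator U t :: real)) < e / 4" .
    obtain N where N: "\<And>n. n \<ge> N \<Longrightarrow> norm ((LBINT t. \<bar>indicator U (t - s n) - indicator U t\<bar>) :: real) < e / 2"
      using LIMSEQ_D[OF L1_translation_open[OF U(1) fU assms(2)], of "e/2"] \<open>0<e\<close> by auto
    have "dist (LBINT t. \<bar>indicator A (t - s n) - indicator A t\<bar>) (0::real) < e" if "n \<ge> N" for n
      using L1_translation_approx[OF iA iU, of "s n"] d N[OF that] by (simp add: dist_real_def)
    then show "\<exists>no. \<forall>n\<ge>no. dist (LBINT t. \<bar>indicator A (t - s n) - indicator A t\<bar>) (0::real) < e" by blast
  qed
  have "(LBINT t. norm (indicator A (t - s n) *\<^sub>R c - indicator A t *\<^sub>R c))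
     = (LBINT t. \<bar>indicator A (t - s n) - indicator A t\<bar>) * norm c" for n
    by (simp flip: scaleR_diff_left)
  then show ?case using tendsto_mult[OF main tendsto_const[of "norm c"]] by simp
next
  case (add f g)
  have *: "integrable lborel (\<lambda>t. f (t - c))" "integrable lborel (\<lambda>t. g (t - c))" for c
    using add by (simp_all add: integrable_lborel_shift)
  show ?case
  proof (rule tendsto_sandwich[OF _ _ tendsto_const])
    have "(LBINT t. norm (f (t - c) + g (t - c) - (f t + g t)))
      \<le> (LBINT t. norm (f (t - c) - f t)) + (LBINT t. norm (g (t - c) - g t))" for c
    proof -
      have "(LBINT t. norm (f (t - c) + g (t - c) - (f t + g t)))
        \<le> (LBINT t. norm (f (t - c) - f t) + norm (g (t - c) - g t))"
        using add *[of c] by (intro integral_mono) (auto intro!: norm_diff_triangle_ineq)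
      also have "\<dots> = (LBINT t. norm (f (t - c) - f t)) + (LBINT t. norm (g (t - c) - g t))"
        using add *[of c] by (intro Bochner_Integration.integral_add) auto
      finally show ?thesis .
    qed
    then show "\<forall>\<^sub>F n in sequentially. (LBINT t. norm (f (t - s n) + g (t - s n) - (f t + g t)))
      \<le> (LBINT t. norm (f (t - s n) - f t)) + (LBINT t. norm (g (t - s n) - g t))"
      by simp
    show "(\<lambda>n. (LBINT t. norm (f (t - s n) - f t)) + (LBINT t. norm (g (t - s n) - g t))) \<longlonglongrightarrow> 0"
      using tendsto_add[OF add(3,4)] by simp
  qed auto
next
  case (lim f F)
  have conv: "(\<lambda>i. \<integral>t. norm (f t - F i t) \<partial>lborel) \<longlonglongrightarrow> 0"
  proof -
    have "(\<lambda>i. \<integral>t. norm (f t - F i t) \<partial>lborel) \<longlonglongrightarrow> (\<integral>t. 0 \<partial>(lborel :: 'a measure))"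
    \<comment> \<open>The approximants supplied by the induction rule satisfy
      \<open>norm (F i t) \<le> 2 * norm (f t)\<close>, hence the factor 3.\<close>
    proof (rule integral_dominated_convergence[where w="\<lambda>t. 3 * norm (f t)"])
      show "AE t in lborel. (\<lambda>i. norm (f t - F i t)) \<longlonglongrightarrow> 0"
      proof (rule AE_I2)
        fix t :: 'a
        have "(\<lambda>i. norm (f t - F i t)) \<longlonglongrightarrow> norm (f t - f t)"
          by (intro tendsto_intros lim) auto
        then show "(\<lambda>i. norm (f t - F i t)) \<longlonglongrightarrow> 0" by simp
      qed
      show "AE t in lborel. norm (norm (f t - F i t)) \<le> 3 * norm (f t)" for i
        using lim(3)[of _ i] by (auto intro!: AE_I2 norm_triangle_ineq4[THEN order_trans]) 
    qed (use lim in auto)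
    then show ?thesis by simp
  qed
  show ?case
  proof (rule metric_LIMSEQ_I)
    fix e :: real assume "0 < e"
    obtain i where i: "(LBINT t. norm (f t - F i t)) < e / 4"
      using LIMSEQ_D[OF conv, of "e/4"] \<open>0<e\<close> by fastforce
    obtain N where N: "\<And>n. n \<ge> N \<Longrightarrow> norm (LBINT t. norm (F i (t - s n) - F i t)) < e / 2"
      using LIMSEQ_D[OF lim(5), of "e/2" i] \<open>0<e\<close> by auto
    have "dist (LBINT t. norm (f (t - s n) - f t)) 0 < e" if "n \<ge> N" for n
      using L1_translation_approx[OF lim(4) lim(1)[of i], of "s n"] i N[OF that] by (simp add: dist_real_def)
    then show "\<exists>no. \<forall>n\<ge>no. dist (LBINT t. norm (f (t - s n) - f t)) 0 < e" by blast
  qed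
qed


lemma L1_translation_small:
  fixes u :: "'a::euclidean_space \<Rightarrow> 'b::{banach, second_countable_topology}"
  assumes "integrable lborel u" "0 < e"
  obtains d where "0 < d" "\<And>s. norm s < d \<Longrightarrow> (LBINT t. norm (u (t - s) - u t)) < e"
proof -
  have "((\<lambda>s. \<integral>t. norm (u (t - s) - u t) \<partial>lborel) \<longlongrightarrow> 0) (at 0)"
    by (rule tendsto_at_iff_sequentially[THEN iffD2])
       (auto simp: comp_def intro!: L1_translation[OF assms(1)])
  from tendstoD[OF this assms(2)]
  obtain d where d: "d > 0" "\<And>s. s \<noteq> 0 \<Longrightarrow> dist s 0 < d \<Longrightarrow> dist (LBINT t. norm (u (t - s) - u t)) 0 < e"
    unfolding eventually_at by blast
  show thesis
  proof (rule that[OF d(1)])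
    fix s :: 'a assume "norm s < d"
    then show "(LBINT t. norm (u (t - s) - u t)) < e"
      using d(2)[of s] assms(2) by (cases "s = 0") (auto simp: dist_real_def)
  qed
qed

lemma convolution_pair_integrable:
  fixes u v :: "'a::euclidean_space \<Rightarrow> complex"
  assumes "integrable lborel u" "integrable lborel v"
  shows "integrable (lborel \<Otimes>\<^sub>M lborel) (\<lambda>(x, t). u t * v (x - t))"
proof -
  have [measurable]: "u \<in> borel_measurable borel" "v \<in> borel_measurable borel"
    using assms by auto
  have "integrable (lborel \<Otimes>\<^sub>M lborel) (\<lambda>(t, x). u t * v (x - t))"
  proof (rule lborel_pair.Fubini_integrable)
    have "(LBINT x. norm (u t * v (x - t))) = norm (u t) * (LBINT x. norm (v x))" for t
      using integral_lborel_shift(2)[of "\<lambda>x. norm (v x)" t] by (simp add: norm_mult)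
    then show "integrable lborel (\<lambda>t. \<integral>x. norm (case (t, x) of (t, x) \<Rightarrow> u t * v (x - t)) \<partial>lborel)"
      using assms by simp
    show "AE t in lborel. integrable lborel (\<lambda>x. case (t, x) of (t, x) \<Rightarrow> u t * v (x - t))"
      using assms by (simp add: integrable_lborel_shift)
  qed measurable
  from lborel_pair.integrable_product_swap[OF this] show ?thesis
    by (simp add: case_prod_unfold)
qed

text \<open>Minkowski's integral inequality, by Fubini: an average of translates is no farther from
  \<open>u\<close> than the worst translate that the weight charges. It serves both the box averages
  in the products defining \<open>psi\<close> and the ball averages of the mollifier.\<close>

lemma L1_dist_average_le:
  fixes u :: "'a::euclidean_space \<Rightarrow> complex" and a :: "'a \<Rightarrow> real"
  assumes u: "integrable lborel u" and a: "integrable lborel a" "\<And>s. 0 \<le> a s" "(LBINT s. a s) = 1"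
    and e: "\<And>s. a s \<noteq> 0 \<Longrightarrow> (LBINT x. norm (u (x - s) - u x)) \<le> e"
  shows "integrable lborel (\<lambda>x. \<integral>s. a s * u (x - s) \<partial>lborel)"
    and "(LBINT x. norm ((LBINT s. a s * u (x - s)) - u x)) \<le> e"
proof -
  have i1: "integrable (lborel \<Otimes>\<^sub>M lborel) (\<lambda>(x, s). of_real (a s) * u (x - s))"
    by (rule convolution_pair_integrable) (use u a in auto)
  show int: "integrable lborel (\<lambda>x. \<integral>s. a s * u (x - s) \<partial>lborel)"
    using lborel_pair.integrable_fst'[OF i1] by simp
  have [measurable]: "u \<in> borel_measurable borel" "a \<in> borel_measurable borel" using u a by auto
  have i2: "integrable (lborel \<Otimes>\<^sub>M lborel) (\<lambda>(x, s). of_real (a s) * u x)"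
  proof (rule lborel_pair.Fubini_integrable)
    show "integrable lborel (\<lambda>x. \<integral>s. norm (case (x, s) of (x, s) \<Rightarrow> complex_of_real (a s) * u x) \<partial>lborel)"
      using u a by (simp add: norm_mult)
  qed (use u a in auto)
  have i3: "integrable (lborel \<Otimes>\<^sub>M lborel) (\<lambda>(x, s). of_real (a s) * (u (x - s) - u x))"
    using Bochner_Integration.integrable_diff[OF i1 i2] by (simp add: case_prod_unfold right_diff_distrib)
  then have i4: "integrable (lborel \<Otimes>\<^sub>M lborel) (\<lambda>(x, s). a s * norm (u (x - s) - u x))"
    using integrable_norm[OF i3] a(2) by (simp add: case_prod_unfold norm_mult)
  have AE: "AE x in lborel. norm ((LBINT s. a s * u (x - s)) - u x)
          \<le> (LBINT s. a s * norm (u (x - s) - u x))"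
    using lborel_pair.AE_integrable_fst'[OF i1] 
  proof eventually_elim
    case (elim x)
    have "(LBINT s. a s * u (x - s)) - u x = (LBINT s. a s * u (x - s)) - (LBINT s. of_real (a s) * u x)"
      using a by simp
    also have "\<dots> = (LBINT s. of_real (a s) * (u (x - s) - u x))"
      using elim a by (subst Bochner_Integration.integral_diff[symmetric]) (auto simp: right_diff_distrib)
    also have "norm \<dots> \<le> (LBINT s. norm (of_real (a s) * (u (x - s) - u x)))"
      by (rule integral_norm_bound)
    finally show ?case using a(2) by (simp add: norm_mult)
  qed
  have i5: "integrable lborel (\<lambda>x. \<integral>s. a s * norm (u (x - s) - u x) \<partial>lborel)"
    using lborel_pair.integrable_fst'[OF i4] by simp
  have i6: "integrable lborel (\<lambda>s. \<integral>x. a s * norm (u (x - s) - u x) \<partial>lborel)"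
    using lborel_pair.integrable_snd[OF i4] by simp
  have "(LBINT x. norm ((LBINT s. a s * u (x - s)) - u x))
     \<le> (LBINT x. (LBINT s. a s * norm (u (x - s) - u x)))"
    by (rule integral_mono_AE[OF _ i5 AE]) (use int u in auto)
  also have "\<dots> = (LBINT s. (LBINT x. a s * norm (u (x - s) - u x)))"
    using lborel_pair.Fubini_integral[of "\<lambda>x s. a s * norm (u (x - s) - u x)"] i4 by simp
  also have "\<dots> \<le> (LBINT s. a s * e)"
  proof (rule integral_mono[OF i6])
    fix s show "(LBINT x. a s * norm (u (x - s) - u x)) \<le> a s * e"
      using e[of s] a(2)[of s] by (cases "a s = 0") (auto intro: mult_left_mono)
  qed (use a in auto)
  finally show "(LBINT x. norm ((LBINT s. a s * u (x - s)) - u x)) \<le> e"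
    using a by simp
qed

lemma suminf_integral:
  fixes f :: "nat \<Rightarrow> 'a \<Rightarrow> complex"
  assumes int: "\<And>i. integrable M (f i)" and sum: "summable (\<lambda>i. \<integral>x. norm (f i x) \<partial>M)"
  shows "AE x in M. summable (\<lambda>i. norm (f i x))"
    and "integrable M (\<lambda>x. \<Sum>\<^sub>\<infinity>i. f i x)"
    and "(\<lambda>i. \<integral>x. f i x \<partial>M) sums (\<integral>x. (\<Sum>\<^sub>\<infinity>i. f i x) \<partial>M)"
proof -
  have [measurable]: "f i \<in> borel_measurable M" for i using int by auto
  have "(\<integral>\<^sup>+x. (\<Sum>i. ennreal (norm (f i x))) \<partial>M) = (\<Sum>i. \<integral>\<^sup>+x. norm (f i x) \<partial>M)"
    by (rule nn_integral_suminf) auto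
  also have "\<dots> = (\<Sum>i. ennreal (\<integral>x. norm (f i x) \<partial>M))"
    using int by (intro arg_cong[where f=suminf] ext nn_integral_eq_integral) auto
  also have "\<dots> < \<infinity>"
    using sum by (simp add: ennreal_suminf_neq_top top.not_eq_extremum[symmetric])
  finally have fin: "(\<integral>\<^sup>+x. (\<Sum>i. ennreal (norm (f i x))) \<partial>M) \<noteq> \<infinity>" by simp
  show AE: "AE x in M. summable (\<lambda>i. norm (f i x))"
  proof -
    have "AE x in M. (\<Sum>i. ennreal (norm (f i x))) \<noteq> \<infinity>"
      by (rule nn_integral_noteq_infinite[OF _ fin]) measurable
    then show ?thesis
      by eventually_elim (rule summable_suminf_not_top, auto)
  qed
  have eq: "summable (\<lambda>i. norm (f i x)) \<Longrightarrow> (\<Sum>\<^sub>\<infinity>i. f i x) = (\<Sum>i. f i x)" for x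
    using norm_summable_imp_has_sum[of "\<lambda>i. f i x"] by (metis infsumI summable_norm_cancel summable_sums)
  \<comment> \<open>Over the complex numbers unordered summability is absolute, so off the set of
    absolute convergence the infinite sum has its default value 0. The sum is thus given everywhere
    by a case distinction on a measurable set.\<close>
  have eq0: "\<not> summable (\<lambda>i. norm (f i x)) \<Longrightarrow> (\<Sum>\<^sub>\<infinity>i. f i x) = 0" for x
    by (rule infsum_not_exists) (simp add: summable_on_UNIV_nonneg_real_iff summable_on_iff_abs_summable_on_complex)
  have pred: "summable (\<lambda>i. norm (f i x)) \<longleftrightarrow> (\<Sum>i. ennreal (norm (f i x))) \<noteq> \<infinity>" for x
    using summable_suminf_not_top[of "\<lambda>i. norm (f i x)"] ennreal_suminf_neq_top[of "\<lambda>i. norm (f i x)"]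
    by (metis infinity_ennreal_def norm_ge_zero)
  have "(\<lambda>x. if (\<Sum>i. ennreal (norm (f i x))) \<noteq> \<infinity> then (\<Sum>i. f i x) else 0) \<in> borel_measurable M"
    by measurable
  also have "(\<lambda>x. if (\<Sum>i. ennreal (norm (f i x))) \<noteq> \<infinity> then (\<Sum>i. f i x) else 0) = (\<lambda>x. \<Sum>\<^sub>\<infinity>i. f i x)"
    unfolding pred[symmetric] using eq eq0 by (auto simp: fun_eq_iff)
  finally have [measurable]: "(\<lambda>x. \<Sum>\<^sub>\<infinity>i. f i x) \<in> borel_measurable M" .
  have AEeq: "AE x in M. (\<Sum>i. f i x) = (\<Sum>\<^sub>\<infinity>i. f i x)"
    using AE by eventually_elim (simp add: eq)
  show "integrable M (\<lambda>x. \<Sum>\<^sub>\<infinity>i. f i x)"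
    using integrable_suminf[OF int AE sum] AEeq
    by (subst integrable_cong_AE[where g="\<lambda>x. \<Sum>i. f i x"]) (auto elim: eventually_mono)
  have "(\<integral>x. (\<Sum>\<^sub>\<infinity>i. f i x) \<partial>M) = (\<integral>x. (\<Sum>i. f i x) \<partial>M)"
    using AEeq by (intro integral_cong_AE) (auto elim: eventually_mono)
  then show "(\<lambda>i. \<integral>x. f i x \<partial>M) sums (\<integral>x. (\<Sum>\<^sub>\<infinity>i. f i x) \<partial>M)"
    using sums_integral[OF int AE sum] by simp
qed

text \<open>Exchange of sum and integral under absolute convergence, carried to any countable index
  set by an enumeration. The index sets that occur are the lattice, \<open>K\<close>, pairs of both,
  and the unit cubes.\<close>

lemma infsum_integral:
  fixes f :: "'i \<Rightarrow> 'a \<Rightarrow> complex"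
  assumes I: "countable I" and int: "\<And>i. i \<in> I \<Longrightarrow> integrable M (f i)"
    and sum: "(\<lambda>i. \<integral>x. norm (f i x) \<partial>M) summable_on I"
  shows "AE x in M. (\<lambda>i. norm (f i x)) summable_on I"
    and "integrable M (\<lambda>x. \<Sum>\<^sub>\<infinity>i\<in>I. f i x)"
    and "((\<lambda>i. \<integral>x. f i x \<partial>M) has_sum (\<integral>x. (\<Sum>\<^sub>\<infinity>i\<in>I. f i x) \<partial>M)) I"
proof -
  have "(AE x in M. (\<lambda>i. norm (f i x)) summable_on I) \<and> integrable M (\<lambda>x. \<Sum>\<^sub>\<infinity>i\<in>I. f i x)
     \<and> ((\<lambda>i. \<integral>x. f i x \<partial>M) has_sum (\<integral>x. (\<Sum>\<^sub>\<infinity>i\<in>I. f i x) \<partial>M)) I"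
  proof (cases "finite I")
    case True
    then show ?thesis using int by (auto intro!: has_sum_finiteI simp: Bochner_Integration.integral_sum)
  next
    case False
    define b where "b = from_nat_into I"
    have b: "bij_betw b UNIV I" unfolding b_def using I False by (rule bij_betw_from_nat_into)
    then have bI: "b n \<in> I" for n by (auto simp: bij_betw_def)
    have 1: "(\<Sum>\<^sub>\<infinity>i\<in>I. h i) = (\<Sum>\<^sub>\<infinity>n. h (b n))" for h :: "'i \<Rightarrow> complex"
      using infsum_reindex_bij_betw[OF b, of h] by simp
    have 2: "h summable_on I \<longleftrightarrow> (\<lambda>n. h (b n)) summable_on UNIV" for h :: "'i \<Rightarrow> real"
      using summable_on_reindex_bij_betw[OF b, of h] by simp
    have 3: "(h has_sum s) I \<longleftrightarrow> ((\<lambda>n. h (b n)) has_sum s) UNIV" for h :: "'i \<Rightarrow> complex" and s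
      using has_sum_reindex_bij_betw[OF b, of h] by simp
    have s: "summable (\<lambda>n. \<integral>x. norm (f (b n) x) \<partial>M)"
      using sum unfolding 2 by (rule summable_on_imp_summable)
    note aux = suminf_integral[of M "\<lambda>n. f (b n)", OF int[OF bI] s]
    have "summable (\<lambda>n. norm (\<integral>x. f (b n) x \<partial>M))"
      by (rule summable_comparison_test'[OF s]) (simp add: integral_norm_bound)
    then have "((\<lambda>i. \<integral>x. f (b i) x \<partial>M) has_sum (\<integral>x. (\<Sum>\<^sub>\<infinity>i. f (b i) x) \<partial>M)) UNIV"
      using aux(3) by (rule norm_summable_imp_has_sum)
    then show ?thesis using aux unfolding 1 2 3
      by (auto simp: summable_on_UNIV_nonneg_real_iff)
  qed
  then show "AE x in M. (\<lambda>i. norm (f i x)) summable_on I"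
    "integrable M (\<lambda>x. \<Sum>\<^sub>\<infinity>i\<in>I. f i x)"
    "((\<lambda>i. \<integral>x. f i x \<partial>M) has_sum (\<integral>x. (\<Sum>\<^sub>\<infinity>i\<in>I. f i x) \<partial>M)) I" by auto
qed

subsection \<open>The Fourier transform\<close>

definition ee :: "real \<Rightarrow> complex" where "ee x = cis (2 * pi * x)"

lemma ee_add: "ee (x + y) = ee x * ee y"
  by (simp add: ee_def cis_mult ring_distribs)
lemma ee_minus: "ee (- x) = cnj (ee x)"
  by (simp add: ee_def cis_cnj)
lemma ee_diff: "ee (x - y) = ee x * cnj (ee y)"
  using ee_add[of x "-y"] by (simp add: ee_minus)
lemma norm_ee [simp]: "norm (ee x) = 1"
  by (simp add: ee_def)
lemma ee_0 [simp]: "ee 0 = 1"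
  by (simp add: ee_def)
lemma ee_Ints: "x \<in> \<int> \<Longrightarrow> ee x = 1"
  by (simp add: ee_def cis_multiple_2pi)
lemma continuous_ee: "continuous_on UNIV ee"
  unfolding ee_def by (intro continuous_intros)
lemma borel_measurable_cnj [measurable (raw)]:
  "f \<in> borel_measurable M \<Longrightarrow> (\<lambda>x. cnj (f x)) \<in> borel_measurable M"
  by (rule borel_measurable_continuous_on[of cnj]) (auto intro!: continuous_intros)
lemma borel_measurable_cis [measurable (raw)]:
  "f \<in> borel_measurable M \<Longrightarrow> (\<lambda>x. cis (f x)) \<in> borel_measurable M"
  by (rule borel_measurable_continuous_on[of cis]) (auto intro!: continuous_intros)
lemma borel_measurable_ee [measurable]: "ee \<in> borel_measurable borel"
  using continuous_ee by (rule borel_measurable_continuous_onI)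
lemma ee_compose_measurable [measurable (raw)]:
  "f \<in> borel_measurable M \<Longrightarrow> (\<lambda>x. ee (f x)) \<in> borel_measurable M"
  by (rule measurable_compose[OF _ borel_measurable_ee])

lemma fourier_lborel:
  assumes [measurable]: "f \<in> borel_measurable borel"
  shows "fourier f \<omega> = (LBINT t. f t * ee (- (t \<bullet> \<omega>)))"
proof -
  have "exp (- 2 * of_real pi * \<i> * of_real (t \<bullet> \<omega>)) = ee (- (t \<bullet> \<omega>))" for t
    unfolding ee_def cis_conv_exp by (simp add: mult_ac)
  then show ?thesis
    unfolding fourier_def by (simp add: integral_completion)
qed

lemma integrable_mult_ee:
  assumes "integrable M f" "h \<in> borel_measurable M"
  shows "integrable M (\<lambda>x. f x * ee (h x))"
  by (rule Bochner_Integration.integrable_bound[OF assms(1)]) (use assms in \<open>auto simp: norm_mult\<close>)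

lemma fourier_measurable [measurable]:
  assumes [measurable]: "f \<in> borel_measurable borel"
  shows "fourier f \<in> borel_measurable borel"
proof -
  have "fourier f = (\<lambda>\<omega>. \<integral>t. f t * ee (- (t \<bullet> \<omega>)) \<partial>lborel)"
    by (auto simp: fourier_lborel)
  then show ?thesis by simp
qed

lemma fourier_bounded:
  assumes "integrable lborel f"
  shows "norm (fourier f \<omega>) \<le> (LBINT t. norm (f t))"
proof -
  have [measurable]: "f \<in> borel_measurable borel" using assms by auto
  have "norm (fourier f \<omega>) \<le> (LBINT t. norm (f t * ee (- (t \<bullet> \<omega>))))"
    unfolding fourier_lborel[OF \<open>f \<in> _\<close>] by (rule integral_norm_bound)
  then show ?thesis by (simp add: norm_mult)
qed

section \<open>Gaussian summation, correlations and the Plancherel formula\<close>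

definition gauss :: "'a::euclidean_space \<Rightarrow> real" where
  "gauss x = (\<Prod>b\<in>Basis. std_normal_density (x \<bullet> b))"

lemma integral_prod_Basis:
  fixes F :: "'a::euclidean_space \<Rightarrow> real \<Rightarrow> complex"
  assumes "\<And>b. b \<in> Basis \<Longrightarrow> integrable lborel (F b)"
  shows "(LBINT x. (\<Prod>b\<in>Basis. F b (x \<bullet> b))) = (\<Prod>b\<in>Basis. \<integral>x. F b x \<partial>lborel)"
    and "integrable lborel (\<lambda>x::'a. \<Prod>b\<in>Basis. F b (x \<bullet> b))"
proof -
  interpret product_sigma_finite "\<lambda>b::'a. lborel :: real measure" by standard
  have [measurable]: "b \<in> Basis \<Longrightarrow> F b \<in> borel_measurable borel" for b using assms[of b] by auto
  have eq: "(\<Prod>b\<in>Basis. F b ((\<Sum>b\<in>Basis. f b *\<^sub>R b) \<bullet> b)) = (\<Prod>b\<in>Basis. F b (f b))" for f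
    by (intro prod.cong) auto
  show "(LBINT x. (\<Prod>b\<in>Basis. F b (x \<bullet> b))) = (\<Prod>b\<in>Basis. \<integral>x. F b x \<partial>lborel)"
    unfolding lborel_eq[where 'a='a]
    by (subst integral_distr) (auto simp: eq intro!: product_integral_prod assms)
  show "integrable lborel (\<lambda>x::'a. \<Prod>b\<in>Basis. F b (x \<bullet> b))"
    unfolding lborel_eq[where 'a='a]
    by (subst integrable_distr_eq) (auto simp: eq intro!: product_integrable_prod assms)
qed

lemma gauss_nonneg: "0 \<le> gauss x"
  unfolding gauss_def by (intro prod_nonneg) auto

lemma gauss_measurable [measurable]: "gauss \<in> borel_measurable borel"
  unfolding gauss_def by measurable

lemma std_normal_density_integrable: "integrable lborel std_normal_density"
  by simp

text \<open>Both factors split over the coordinates, which leaves the characteristic function of the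
  standard normal distribution. The power of \<open>sqrt (2*pi)\<close> appears because
  \<open>gauss\<close> is normalised to integral 1 and not to value 1 at the origin.\<close>

lemma gauss_fourier:
  fixes t :: "'a::euclidean_space"
  shows "(LBINT x. of_real (gauss x) * cis (- (x \<bullet> t))) = of_real (sqrt (2*pi) ^ DIM('a) * gauss t)"
proof -
  have int: "integrable lborel (\<lambda>s. complex_of_real (std_normal_density s) * cis (- (s * a)))" for a
    by (rule Bochner_Integration.integrable_bound[OF std_normal_density_integrable])
      (auto simp: norm_mult)
  have "cis (- (x \<bullet> t)) = (\<Prod>b\<in>Basis. cis (- ((x \<bullet> b) * (t \<bullet> b))))" for x
  proof -
    have "(\<Prod>b\<in>B. cis (g b)) = cis (\<Sum>b\<in>B. g b)" if "finite B" for g :: "'a \<Rightarrow> real" and B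
      using that by (induction B) (auto simp: cis_mult)
    then show ?thesis
      by (simp add: euclidean_inner[of x t] sum_negf)
  qed
  then have "(LBINT x. of_real (gauss x) * cis (- (x \<bullet> t)))
     = (LBINT x. (\<Prod>b\<in>Basis. of_real (std_normal_density (x \<bullet> b)) * cis (- ((x \<bullet> b) * (t \<bullet> b)))))"
    by (simp add: gauss_def prod.distrib)
  also have "\<dots> = (\<Prod>b\<in>Basis. \<integral>s. complex_of_real (std_normal_density s) * cis (- (s * (t \<bullet> b))) \<partial>lborel)"
    by (rule integral_prod_Basis(1)) (rule int)
  also have "\<dots> = (\<Prod>b\<in>Basis. complex_of_real (sqrt (2*pi) * std_normal_density (t \<bullet> b)))"
  proof (rule prod.cong)
    fix b :: 'a
    have "(LBINT s. complex_of_real (std_normal_density s) * cis (- (s * (t \<bullet> b)))) = char std_normal_distribution (- (t \<bullet> b))"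
      unfolding char_def by (subst integral_density) (auto simp: scaleR_conv_of_real cis_conv_exp mult_ac)
    also have "\<dots> = complex_of_real (exp (- ((t \<bullet> b)^2) / 2))"
      by (simp add: char_std_normal_distribution)
    also have "\<dots> = complex_of_real (sqrt (2*pi) * std_normal_density (t \<bullet> b))"
      by (simp add: std_normal_density_def)
    finally show "(LBINT s. complex_of_real (std_normal_density s) * cis (- (s * (t \<bullet> b)))) 
      = complex_of_real (sqrt (2*pi) * std_normal_density (t \<bullet> b))" .
  qed simp
  also have "\<dots> = of_real (sqrt (2*pi) ^ DIM('a) * gauss t)"
    by (simp add: gauss_def prod.distrib)
  finally show ?thesis .
qed

lemma gauss_0: "sqrt (2*pi) ^ DIM('a) * gauss (0::'a::euclidean_space) = 1"
  by (simp add: gauss_def std_normal_density_def power_mult_distrib[symmetric])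

lemma gauss_le: "sqrt (2*pi) ^ DIM('a) * gauss (x::'a::euclidean_space) \<le> 1"
proof -
  have "sqrt (2*pi) ^ DIM('a) * gauss x = (\<Prod>b\<in>Basis. sqrt (2*pi) * std_normal_density (x \<bullet> b))"
    by (simp add: gauss_def prod.distrib)
  also have "\<dots> \<le> 1" by (rule prod_le_1) (auto simp: std_normal_density_def)
  finally show ?thesis .
qed

lemma gauss_continuous: "continuous_on UNIV gauss"
  unfolding gauss_def std_normal_density_def by (intro continuous_intros) auto

lemma gauss_integrable: "integrable lborel (gauss :: 'a::euclidean_space \<Rightarrow> real)"
  and gauss_integral: "(LBINT x. gauss (x::'a)) = 1"
proof -
  have "integrable lborel (\<lambda>x::'a. \<Prod>b\<in>Basis. complex_of_real (std_normal_density (x \<bullet> b)))"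
    by (rule integral_prod_Basis(2)) auto
  then have "integrable lborel (\<lambda>x::'a. complex_of_real (gauss x))"
    by (simp add: gauss_def)
  then show "integrable lborel (gauss :: 'a \<Rightarrow> real)"
    using integrable_Re by fastforce
  have "complex_of_real (LBINT x. gauss (x::'a)) = 1"
    using gauss_fourier[of "0::'a"] gauss_0[where 'a='a] by simp
  then show "(LBINT x. gauss (x::'a)) = 1" by (simp only: of_real_eq_1_iff)
qed

text \<open>Fubini moves the Fourier transform from \<open>A\<close> to the Gaussian: a wide
  Gaussian cutoff in frequency becomes an average of \<open>A\<close> at scale \<open>d\<close>
  around the origin. The cutoff makes the left integral converge for every integrable
  \<open>A\<close>.\<close>

lemma fourier_gauss_multiplication:
  fixes A :: "'a::euclidean_space \<Rightarrow> complex"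
  assumes A: "integrable lborel A" and d: "0 < d"
  shows "(LBINT \<omega>. fourier A \<omega> * of_real (sqrt (2*pi) ^ DIM('a) * gauss ((2*pi*d) *\<^sub>R \<omega>)))
     = (LBINT s. A (d *\<^sub>R s) * of_real (gauss s))"
proof -
  let ?c = "sqrt (2*pi) ^ DIM('a)"
  have [measurable]: "A \<in> borel_measurable borel" using A by auto
  have gi: "integrable lborel (\<lambda>\<omega>::'a. gauss ((2*pi*d) *\<^sub>R \<omega>))"
    using integrable_lborel_affine[OF gauss_integrable, of "2*pi*d" 0] d by simp
  have i: "integrable (lborel \<Otimes>\<^sub>M lborel) (\<lambda>(t, \<omega>). A t * ee (- (t \<bullet> \<omega>)) * of_real (gauss ((2*pi*d) *\<^sub>R \<omega>)))"
  proof (rule lborel_pair.Fubini_integrable)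
    show "integrable lborel (\<lambda>t. \<integral>\<omega>. norm (case (t, \<omega>) of (t, \<omega>) \<Rightarrow> A t * ee (- (t \<bullet> \<omega>)) * of_real (gauss ((2*pi*d) *\<^sub>R \<omega>))) \<partial>lborel)"
      using A by (simp add: norm_mult)
    show "AE t in lborel. integrable lborel (\<lambda>\<omega>. case (t, \<omega>) of (t, \<omega>) \<Rightarrow> A t * ee (- (t \<bullet> \<omega>)) * of_real (gauss ((2*pi*d) *\<^sub>R \<omega>)))"
      by (rule AE_I2, rule Bochner_Integration.integrable_bound[OF integrable_mult_right[OF gi, of "norm (A _)"]])
         (auto simp: norm_mult gauss_nonneg)
  qed measurable
  have inner: "(LBINT \<omega>. A t * ee (- (t \<bullet> \<omega>)) * of_real (gauss ((2*pi*d) *\<^sub>R \<omega>)))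
      = (1 / (2*pi*d)^DIM('a)) *\<^sub>R (A t * of_real (?c * gauss ((1/d) *\<^sub>R t)))" for t
  proof -
    have gi': "integrable lborel (\<lambda>s::'a. complex_of_real (gauss s) * cis (- (s \<bullet> ((1/d) *\<^sub>R t))))"
      by (rule Bochner_Integration.integrable_bound[OF gauss_integrable]) (auto simp: norm_mult)
    have "(LBINT \<omega>. A t * ee (- (t \<bullet> \<omega>)) * of_real (gauss ((2*pi*d) *\<^sub>R \<omega>)))
      = A t * (LBINT \<omega>. (\<lambda>s. of_real (gauss s) * cis (- (s \<bullet> ((1/d) *\<^sub>R t)))) (0 + (2*pi*d) *\<^sub>R \<omega>))"
      using d by (simp add: mult_ac ee_def inner_commute)
    also have "\<dots> = A t * ((1 / \<bar>2*pi*d\<bar>^DIM('a)) *\<^sub>R of_real (?c * gauss ((1/d) *\<^sub>R t)))"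
      by (subst integral_lborel_affine[OF gi']) (use d in \<open>auto simp: gauss_fourier simp del: inner_scaleR_right\<close>)
    finally show ?thesis using d by simp
  qed
  \<comment> \<open>One factor normalises the cutoff to 1 at the origin, the other comes from
    \<open>gauss_fourier\<close>; together they cancel the power of \<open>2*pi\<close> produced by
    the change of variable.\<close>
  have c2: "?c * ?c = (2*pi)^DIM('a)"
    unfolding power_mult_distrib[symmetric] by simp
  have "(LBINT \<omega>. fourier A \<omega> * of_real (?c * gauss ((2*pi*d) *\<^sub>R \<omega>)))
      = ?c * (LBINT \<omega>. (LBINT t. A t * ee (- (t \<bullet> \<omega>)) * of_real (gauss ((2*pi*d) *\<^sub>R \<omega>))))"
    unfolding fourier_lborel[OF \<open>A \<in> _\<close>] integral_mult_left_zero[symmetric] integral_mult_right_zero[symmetric]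
    by (simp add: mult_ac)
  also have "\<dots> = ?c * (LBINT t. (LBINT \<omega>. A t * ee (- (t \<bullet> \<omega>)) * of_real (gauss ((2*pi*d) *\<^sub>R \<omega>))))"
    by (subst lborel_pair.Fubini_integral[OF i]) simp
  also have "\<dots> = (LBINT t. (1 / d^DIM('a)) *\<^sub>R (A t * of_real (gauss ((1/d) *\<^sub>R t))))"
    unfolding inner using d c2
    by (subst integral_mult_right_zero[symmetric], intro Bochner_Integration.integral_cong)
      (auto simp: scaleR_conv_of_real power_mult_distrib field_simps simp flip: of_real_mult of_real_power)
  also have "\<dots> = (LBINT s. A (d *\<^sub>R s) * of_real (gauss s))"
  proof -
    have gb: "gauss x \<le> 1 / ?c" for x :: 'a
      using gauss_le[of x] by (simp add: field_simps)
    have "integrable lborel (\<lambda>t. A t * of_real (gauss ((1/d) *\<^sub>R t)))"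
    proof (rule Bochner_Integration.integrable_bound)
      show "integrable lborel (\<lambda>t. (1 / ?c) * norm (A t))" using A by auto
      show "AE t in lborel. norm (A t * of_real (gauss ((1/d) *\<^sub>R t))) \<le> norm ((1 / ?c) * norm (A t))"
      proof (rule AE_I2)
        fix t
        have "norm (A t) * gauss ((1/d) *\<^sub>R t) \<le> norm (A t) * (1 / ?c)" by (intro mult_left_mono gb norm_ge_zero)
        then show "norm (A t * of_real (gauss ((1/d) *\<^sub>R t))) \<le> norm ((1 / ?c) * norm (A t))"
          by (simp add: norm_mult gauss_nonneg mult.commute)
      qed
    qed measurable
    from integral_lborel_affine[OF this, of d 0] show ?thesis using d by simp
  qed
  finally show ?thesis .
qed

text \<open>The cross-correlation; its value at \<open>l\<close> is the inner product of
  \<open>f\<close> with the translate of \<open>g\<close> by \<open>l\<close>. Frame coefficients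
  are therefore samples of one function, whose Fourier transform is \<open>fourier f\<close> times
  the conjugate of \<open>fourier g\<close>.\<close>

definition corr :: "('a::euclidean_space \<Rightarrow> complex) \<Rightarrow> ('a \<Rightarrow> complex) \<Rightarrow> 'a \<Rightarrow> complex" where
  "corr f g x = (LBINT t. f t * cnj (g (t - x)))"

lemma corr_measurable [measurable]:
  assumes [measurable]: "f \<in> borel_measurable borel" "g \<in> borel_measurable borel"
  shows "corr f g \<in> borel_measurable borel"
  unfolding corr_def by measurable

lemma corr_flip: "corr f g x = cnj (corr g f (- x))"
proof -
  have "cnj (corr g f (- x)) = (LBINT t. cnj (g t) * f (t + x))"
    unfolding corr_def by (simp add: Bochner_Integration.integral_cnj[symmetric] del: Bochner_Integration.integral_cnj)
  also have "\<dots> = corr f g x"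
    unfolding corr_def using integral_lborel_shift(2)[of "\<lambda>t. cnj (g t) * f (t + x)" x] by (simp add: mult.commute)
  finally show ?thesis by simp
qed

lemma corr_pair_integrable:
  assumes "integrable lborel f" "integrable lborel g"
  shows "integrable (lborel \<Otimes>\<^sub>M lborel) (\<lambda>(x, t). f t * cnj (g (t - x)))"
proof -
  have "integrable lborel (\<lambda>z. cnj (g (0 - z)))"
    using assms integrable_lborel_shift(4)[of "\<lambda>z. cnj (g z)" 0] by simp
  from convolution_pair_integrable[OF assms(1) this] show ?thesis by simp
qed

lemma corr_integrable:
  assumes "integrable lborel f" "integrable lborel g"
  shows "integrable lborel (corr f g)"
  unfolding corr_def using lborel_pair.integrable_fst'[OF corr_pair_integrable[OF assms]] by simp

lemma fourier_corr:
  assumes f: "integrable lborel f" and g: "integrable lborel g"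
  shows "fourier (corr f g) \<omega> = fourier f \<omega> * cnj (fourier g \<omega>)"
proof -
  have [measurable]: "f \<in> borel_measurable borel" "g \<in> borel_measurable borel" using f g by auto
  have i: "integrable (lborel \<Otimes>\<^sub>M lborel) (\<lambda>(x, t). f t * cnj (g (t - x)) * ee (- (x \<bullet> \<omega>)))"
    using integrable_mult_ee[OF corr_pair_integrable[OF f g], of "\<lambda>(x, t). - (x \<bullet> \<omega>)"]
    by (simp add: case_prod_unfold)
  have "fourier (corr f g) \<omega> = (LBINT x. (LBINT t. f t * cnj (g (t - x)) * ee (- (x \<bullet> \<omega>))))"
    unfolding fourier_lborel[OF corr_measurable[OF \<open>f \<in> _\<close> \<open>g \<in> _\<close>]] corr_def by simp
  also have "\<dots> = (LBINT t. (LBINT x. f t * cnj (g (t - x)) * ee (- (x \<bullet> \<omega>))))"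
    by (rule lborel_pair.Fubini_integral[OF i, symmetric])
  also have "\<dots> = (LBINT t. f t * ee (- (t \<bullet> \<omega>)) * cnj (fourier g \<omega>))"
  proof (rule Bochner_Integration.integral_cong[OF refl])
    fix t
    have "(LBINT x. f t * cnj (g (t - x)) * ee (- (x \<bullet> \<omega>)))
       = (LBINT x. f t * cnj (g x) * ee (- ((t - x) \<bullet> \<omega>)))"
      using integral_lborel_shift(4)[of "\<lambda>x. f t * cnj (g x) * ee (- ((t - x) \<bullet> \<omega>))" t] by simp
    also have "\<dots> = (LBINT x. f t * ee (- (t \<bullet> \<omega>)) * cnj (g x * ee (- (x \<bullet> \<omega>))))"
      by (intro Bochner_Integration.integral_cong) (auto simp: inner_diff_left ee_diff ee_minus)
    also have "\<dots> = f t * ee (- (t \<bullet> \<omega>)) * cnj (fourier g \<omega>)"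
      unfolding fourier_lborel[OF \<open>g \<in> _\<close>]
      by (simp only: integral_mult_right_zero Bochner_Integration.integral_cnj)
    finally show "(LBINT x. f t * cnj (g (t - x)) * ee (- (x \<bullet> \<omega>))) = f t * ee (- (t \<bullet> \<omega>)) * cnj (fourier g \<omega>)" .
  qed
  also have "\<dots> = fourier f \<omega> * cnj (fourier g \<omega>)" by (simp add: fourier_lborel)
  finally show ?thesis .
qed

text \<open>A change of variable keeps the bounded factor \<open>g\<close> fixed and puts the whole
  displacement on \<open>f\<close>, so the modulus of continuity is the L1 modulus of translation of
  \<open>f\<close>.\<close>

lemma corr_diff_le:
  assumes f: "integrable lborel f" and g: "g \<in> borel_measurable borel" "\<And>t. norm (g t) \<le> M"
  shows "norm (corr f g x - corr f g y) \<le> M * (LBINT t. norm (f (t - (y - x)) - f t))"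
proof -
  have [measurable]: "f \<in> borel_measurable borel" "g \<in> borel_measurable borel" using f g by auto
  have fs: "integrable lborel (\<lambda>t. f (t + c))" for c using f by (simp add: integrable_lborel_shift)
  have gb: "integrable lborel (\<lambda>t. f (t + c) * cnj (g t))" for c
    by (rule Bochner_Integration.integrable_bound[OF integrable_mult_right[OF fs[of c], of "of_real M"]])
      (use order_trans[OF norm_ge_zero g(2)] in \<open>auto simp: norm_mult mult.commute[of M] intro!: mult_left_mono g(2)\<close>)
  have eq: "corr f g z = (LBINT t. f (t + z) * cnj (g t))" for z
    unfolding corr_def using integral_lborel_shift(2)[of "\<lambda>t. f (t + z) * cnj (g t)" z] by simp
  have fs2: "integrable lborel (\<lambda>t. f (t + x) - f (t + y))" using fs by auto
  have "norm (corr f g x - corr f g y) = norm (LBINT t. (f (t + x) - f (t + y)) * cnj (g t))"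
    unfolding eq by (subst Bochner_Integration.integral_diff[symmetric, OF gb gb]) (simp add: left_diff_distrib)
  also have "\<dots> \<le> (LBINT t. norm ((f (t + x) - f (t + y)) * cnj (g t)))" by (rule integral_norm_bound)
  also have "\<dots> \<le> (LBINT t. M * norm (f (t + x) - f (t + y)))"
    by (rule integral_mono')
      (use fs2 order_trans[OF norm_ge_zero g(2)] in \<open>auto simp: norm_mult mult.commute[of M] intro!: mult_left_mono g(2)\<close>)
  also have "\<dots> = M * (LBINT t. norm (f (t - (y - x)) - f t))"
    using integral_lborel_shift(2)[of "\<lambda>t. norm (f (t + x) - f (t + y))" y] by (simp add: algebra_simps)
  finally show ?thesis .
qed

lemma corr_continuous:
  assumes f: "integrable lborel f" and g: "g \<in> borel_measurable borel" "\<And>t. norm (g t) \<le> M"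
  shows "continuous_on UNIV (corr f g)"
proof (rule continuous_at_imp_continuous_on, intro ballI)
  fix y
  have "((\<lambda>x. norm (corr f g x - corr f g y)) \<longlongrightarrow> 0) (at y)"
    unfolding tendsto_at_iff_sequentially comp_def
  proof (intro allI impI)
    fix s assume s: "s \<longlonglongrightarrow> y"
    have "(\<lambda>n. y - s n) \<longlonglongrightarrow> y - y" by (intro tendsto_intros s)
    then have "(\<lambda>n. y - s n) \<longlonglongrightarrow> 0" by simp
    from tendsto_mult[OF tendsto_const[of M] L1_translation[OF f this]]
    have l: "(\<lambda>n. M * (LBINT t. norm (f (t - (y - s n)) - f t))) \<longlonglongrightarrow> 0" by simp
    show "(\<lambda>n. norm (corr f g (s n) - corr f g y)) \<longlonglongrightarrow> 0"
      by (rule tendsto_sandwich[OF _ _ tendsto_const l]) (auto intro!: always_eventually corr_diff_le[OF f g])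
  qed
  then show "isCont (corr f g) y"
    unfolding isCont_def by (rule Lim_null[THEN iffD2, OF tendsto_norm_zero_cancel])
qed

text \<open>The version with the roles exchanged, by \<open>corr_flip\<close>: the test functions
  will be bounded, while the generators are known to be integrable but not bounded.\<close>

lemma corr_continuous_left:
  assumes "integrable lborel g" and "f \<in> borel_measurable borel" "\<And>t. norm (f t) \<le> M"
  shows "continuous_on UNIV (corr f g)"
proof -
  have "corr f g = (\<lambda>x. cnj (corr g f (- x)))" by (rule ext) (rule corr_flip)
  moreover have "continuous_on UNIV (\<lambda>x. cnj (corr g f (- x)))"
    by (intro continuous_on_cnj continuous_on_compose2[OF corr_continuous[OF assms]] continuous_intros) auto
  ultimately show ?thesis by simp
qed

lemma corr_bounded:
  assumes f: "integrable lborel f" and g: "g \<in> borel_measurable borel" "\<And>t. norm (g t) \<le> M"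
  shows "norm (corr f g x) \<le> M * (LBINT t. norm (f t))"
proof -
  have "norm (corr f g x) \<le> (LBINT t. norm (f t * cnj (g (t - x))))"
    unfolding corr_def by (rule integral_norm_bound)
  also have "\<dots> \<le> (LBINT t. M * norm (f t))"
    by (rule integral_mono')
      (use f order_trans[OF norm_ge_zero g(2)] in \<open>auto simp: norm_mult mult.commute[of M] intro!: mult_left_mono g(2)\<close>)
  finally show ?thesis by simp
qed

text \<open>Inversion at a single point is all that Plancherel requires, because an inner product is
  a correlation evaluated at 0.\<close>

lemma fourier_inversion_at_0:
  fixes A :: "'a::euclidean_space \<Rightarrow> complex"
  assumes A: "integrable lborel A" "\<And>x. norm (A x) \<le> M" "isCont A 0"
  shows "(\<lambda>n. \<integral>\<omega>. fourier A \<omega> * of_real (sqrt (2*pi) ^ DIM('a) * gauss ((2*pi*(1 / Suc n)) *\<^sub>R \<omega>)) \<partial>lborel) \<longlonglongrightarrow> A 0"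
proof -
  have [measurable]: "A \<in> borel_measurable borel" using A by auto
  have "(\<lambda>n. \<integral>s. A ((1 / Suc n) *\<^sub>R s) * of_real (gauss s) \<partial>lborel) \<longlonglongrightarrow> (LBINT s. A 0 * complex_of_real (gauss (s::'a)))"
  proof (rule integral_dominated_convergence[where w="\<lambda>s. M * gauss s"])
    show "AE s in lborel. (\<lambda>n. A ((1 / Suc n) *\<^sub>R s) * of_real (gauss s)) \<longlonglongrightarrow> A 0 * of_real (gauss s)"
    proof (rule AE_I2)
      fix s :: 'a
      have "(\<lambda>n. (1 / Suc n) *\<^sub>R s) \<longlonglongrightarrow> 0 *\<^sub>R s"
        by (intro tendsto_intros LIMSEQ_Suc[OF lim_1_over_n])
      then have "(\<lambda>n. A ((1 / Suc n) *\<^sub>R s)) \<longlonglongrightarrow> A 0"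
        using A(3) by (intro isCont_tendsto_compose[of 0 A]) auto
      then show "(\<lambda>n. A ((1 / Suc n) *\<^sub>R s) * of_real (gauss s)) \<longlonglongrightarrow> A 0 * of_real (gauss s)"
        by (intro tendsto_intros)
    qed
  qed (auto simp: norm_mult gauss_nonneg gauss_integrable intro!: mult_right_mono A(2))
  then show ?thesis
    by (subst fourier_gauss_multiplication[OF A(1)]) (auto simp: gauss_integral)
qed

lemma gauss_cutoff_tendsto:
  "(\<lambda>n. sqrt (2*pi) ^ DIM('a) * gauss ((2*pi*(1 / Suc n)) *\<^sub>R (\<omega>::'a::euclidean_space))) \<longlonglongrightarrow> 1"
proof -
  have "(\<lambda>n. (2*pi*(1 / Suc n)) *\<^sub>R \<omega>) \<longlonglongrightarrow> (2*pi*0) *\<^sub>R \<omega>"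
    by (intro tendsto_intros LIMSEQ_Suc[OF lim_1_over_n])
  then have "(\<lambda>n. gauss ((2*pi*(1 / Suc n)) *\<^sub>R \<omega>)) \<longlonglongrightarrow> gauss (0::'a)"
    using gauss_continuous by (intro isCont_tendsto_compose[of 0 gauss]) (auto simp: continuous_on_eq_continuous_at)
  from tendsto_mult[OF tendsto_const[of "sqrt (2*pi) ^ DIM('a)"] this] show ?thesis by (simp only: gauss_0)
qed

lemma corr_0: "corr u v 0 = (LBINT t. u t * cnj (v t))"
  by (simp add: corr_def)

text \<open>Gaussian summation of the Fourier integral of the correlation: the limit is its value at 0.\<close>

lemma plancherel_corr:
  fixes u v :: "'a::euclidean_space \<Rightarrow> complex"
  assumes u: "integrable lborel u" and v: "integrable lborel v" "\<And>t. norm (v t) \<le> M"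
  shows "(\<lambda>n. \<integral>\<omega>. fourier u \<omega> * cnj (fourier v \<omega>) * of_real (sqrt (2*pi) ^ DIM('a) * gauss ((2*pi*(1 / Suc n)) *\<^sub>R \<omega>)) \<partial>lborel)
      \<longlonglongrightarrow> (LBINT t. u t * cnj (v t))"
proof -
  have vm: "v \<in> borel_measurable borel" using v by auto
  have "isCont (corr u v) 0"
    using corr_continuous[OF u vm v(2)] by (simp add: continuous_on_eq_continuous_at)
  from fourier_inversion_at_0[OF corr_integrable[OF u v(1)] corr_bounded[OF u vm v(2)] this]
  show ?thesis by (simp add: fourier_corr[OF u v(1)] corr_0)
qed

text \<open>With both functions equal, the cutoff integrals in \<open>plancherel_corr\<close> are
  nonnegative and converge to the squared norm of \<open>u\<close>; the cutoff tends to 1 pointwise,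
  so Fatou's lemma bounds the full integral.\<close>

lemma fourier_L2:
  fixes u :: "'a::euclidean_space \<Rightarrow> complex"
  assumes u: "integrable lborel u" "\<And>t. norm (u t) \<le> M"
  shows "integrable lborel (\<lambda>\<omega>. (norm (fourier u \<omega>))\<^sup>2)"
proof -
  have [measurable]: "u \<in> borel_measurable borel" using u by auto
  let ?k = "\<lambda>n \<omega>. sqrt (2*pi) ^ DIM('a) * gauss ((2*pi*(1 / Suc n)) *\<^sub>R (\<omega>::'a))"
  have k0: "0 \<le> ?k n \<omega>" for n \<omega> by (intro mult_nonneg_nonneg zero_le_power gauss_nonneg) auto
  have ki: "integrable lborel (\<lambda>\<omega>. (norm (fourier u \<omega>))\<^sup>2 * ?k n \<omega>)" for n
  proof (rule Bochner_Integration.integrable_bound)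
    show "integrable lborel (\<lambda>\<omega>. (LBINT t. norm (u t))\<^sup>2 * ?k n \<omega>)"
      using integrable_lborel_affine[OF gauss_integrable, of "2*pi*(1 / Suc n)" "0::'a"] by simp
    show "AE x in lborel. norm ((cmod (fourier u x))\<^sup>2 * ?k n x) \<le> norm ((LBINT t. norm (u t))\<^sup>2 * ?k n x)"
      using k0 by (auto simp: abs_mult intro!: AE_I2 mult_right_mono power_mono fourier_bounded[OF u(1)])
  qed measurable
  have *: "fourier u \<omega> * cnj (fourier u \<omega>) * of_real (?k n \<omega>) = of_real ((norm (fourier u \<omega>))\<^sup>2 * ?k n \<omega>)" for n \<omega>
    by (simp only: complex_norm_square of_real_mult)
  have **: "u t * cnj (u t) = of_real ((norm (u t))\<^sup>2)" for t by (simp only: complex_norm_square)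
  have "(\<lambda>n. complex_of_real (LBINT \<omega>. (norm (fourier u \<omega>))\<^sup>2 * ?k n \<omega>)) \<longlonglongrightarrow> of_real (LBINT t. (norm (u t))\<^sup>2)"
    using plancherel_corr[OF u(1) u] unfolding * ** by (simp only: integral_complex_of_real)
  then have lim: "(\<lambda>n. \<integral>\<omega>. (norm (fourier u \<omega>))\<^sup>2 * ?k n \<omega> \<partial>lborel) \<longlonglongrightarrow> (LBINT t. (norm (u t))\<^sup>2)"
    by (simp only: tendsto_of_real_iff)
  have "(\<integral>\<^sup>+\<omega>. ennreal ((norm (fourier u \<omega>))\<^sup>2) \<partial>lborel) = (\<integral>\<^sup>+\<omega>. liminf (\<lambda>n. ennreal ((norm (fourier u \<omega>))\<^sup>2 * ?k n \<omega>)) \<partial>lborel)"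
  proof (rule nn_integral_cong)
    fix \<omega> :: 'a
    have "(\<lambda>n. ennreal ((norm (fourier u \<omega>))\<^sup>2 * ?k n \<omega>)) \<longlonglongrightarrow> ennreal ((norm (fourier u \<omega>))\<^sup>2 * 1)"
      by (intro tendsto_ennrealI tendsto_mult tendsto_const gauss_cutoff_tendsto)
    from lim_imp_Liminf[OF _ this] show "ennreal ((norm (fourier u \<omega>))\<^sup>2) = liminf (\<lambda>n. ennreal ((norm (fourier u \<omega>))\<^sup>2 * ?k n \<omega>))"
      by simp
  qed
  also have "\<dots> \<le> liminf (\<lambda>n. \<integral>\<^sup>+\<omega>. ennreal ((norm (fourier u \<omega>))\<^sup>2 * ?k n \<omega>) \<partial>lborel)"
    by (rule nn_integral_liminf) measurable
  also have "\<dots> = liminf (\<lambda>n. ennreal (LBINT \<omega>. (norm (fourier u \<omega>))\<^sup>2 * ?k n \<omega>))"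
    using k0 by (subst nn_integral_eq_integral[OF ki]) auto
  also have "\<dots> = ennreal (LBINT t. (norm (u t))\<^sup>2)"
    by (rule lim_imp_Liminf[OF sequentially_bot tendsto_ennrealI[OF lim]])
  also have "\<dots> < \<infinity>" by simp
  finally show ?thesis by (intro integrableI_bounded) auto
qed

lemma mult_le_sum_power2: "(a::real) * b \<le> a\<^sup>2 + b\<^sup>2"
  using zero_le_power2[of "a - b"] zero_le_power2[of a] zero_le_power2[of b]
  unfolding power2_diff by linarith

lemma L2_mult_integrable:
  fixes f g :: "'a \<Rightarrow> complex"
  assumes [measurable]: "f \<in> borel_measurable M" "g \<in> borel_measurable M"
    and "integrable M (\<lambda>x. (norm (f x))\<^sup>2)" "integrable M (\<lambda>x. (norm (g x))\<^sup>2)"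
  shows "integrable M (\<lambda>x. f x * g x)"
proof (rule Bochner_Integration.integrable_bound)
  show "integrable M (\<lambda>x. (norm (f x))\<^sup>2 + (norm (g x))\<^sup>2)" using assms by auto
  have "norm (f x) * norm (g x) \<le> (norm (f x))\<^sup>2 + (norm (g x))\<^sup>2" for x
    by (rule mult_le_sum_power2)
  then show "AE x in M. norm (f x * g x) \<le> norm ((norm (f x))\<^sup>2 + (norm (g x))\<^sup>2)"
    by (auto simp: norm_mult)
qed measurable

text \<open>Once both transforms are square integrable, dominated convergence removes the Gaussian
  cutoff. Bounded integrable functions cover all later uses: boxes, mollified functions, and
  correlations of these with integrable generators.\<close>

theorem plancherel:
  fixes u v :: "'a::euclidean_space \<Rightarrow> complex"
  assumes u: "integrable lborel u" "\<And>t. norm (u t) \<le> M" and v: "integrable lborel v" "\<And>t. norm (v t) \<le> N"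
  shows "(LBINT \<omega>. fourier u \<omega> * cnj (fourier v \<omega>)) = (LBINT t. u t * cnj (v t))"
proof -
  have [measurable]: "u \<in> borel_measurable borel" "v \<in> borel_measurable borel" using u v by auto
  let ?k = "\<lambda>n \<omega>. sqrt (2*pi) ^ DIM('a) * gauss ((2*pi*(1 / Suc n)) *\<^sub>R (\<omega>::'a))"
  have k0: "0 \<le> ?k n \<omega>" for n \<omega> by (intro mult_nonneg_nonneg zero_le_power gauss_nonneg) auto
  have i: "integrable lborel (\<lambda>\<omega>. fourier u \<omega> * cnj (fourier v \<omega>))"
    by (rule L2_mult_integrable) (use fourier_L2[OF u] fourier_L2[OF v] in auto)
  have "(\<lambda>n. \<integral>\<omega>. fourier u \<omega> * cnj (fourier v \<omega>) * of_real (?k n \<omega>) \<partial>lborel) \<longlonglongrightarrow> (LBINT \<omega>. fourier u \<omega> * cnj (fourier v \<omega>))"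
  proof (rule integral_dominated_convergence[where w="\<lambda>\<omega>. norm (fourier u \<omega> * cnj (fourier v \<omega>))"])
    show "AE \<omega> in lborel. (\<lambda>n. fourier u \<omega> * cnj (fourier v \<omega>) * of_real (?k n \<omega>)) \<longlonglongrightarrow> fourier u \<omega> * cnj (fourier v \<omega>)"
    proof (rule AE_I2)
      fix \<omega> :: 'a
      have "(\<lambda>n. fourier u \<omega> * cnj (fourier v \<omega>) * of_real (?k n \<omega>)) \<longlonglongrightarrow> fourier u \<omega> * cnj (fourier v \<omega>) * of_real 1"
        by (intro tendsto_mult tendsto_const tendsto_of_real gauss_cutoff_tendsto)
      then show "(\<lambda>n. fourier u \<omega> * cnj (fourier v \<omega>) * of_real (?k n \<omega>)) \<longlonglongrightarrow> fourier u \<omega> * cnj (fourier v \<omega>)" by simp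
    qed
    show "AE \<omega> in lborel. norm (fourier u \<omega> * cnj (fourier v \<omega>) * of_real (?k n \<omega>)) \<le> norm (fourier u \<omega> * cnj (fourier v \<omega>))" for n
    proof (rule AE_I2)
      fix \<omega> :: 'a
      have "norm (fourier u \<omega> * cnj (fourier v \<omega>) * of_real (?k n \<omega>)) = norm (fourier u \<omega> * cnj (fourier v \<omega>)) * ?k n \<omega>"
        using k0[of n \<omega>] by (simp only: norm_mult norm_of_real abs_of_nonneg)
      also have "\<dots> \<le> norm (fourier u \<omega> * cnj (fourier v \<omega>)) * 1"
        by (intro mult_left_mono gauss_le) auto
      finally show "norm (fourier u \<omega> * cnj (fourier v \<omega>) * of_real (?k n \<omega>)) \<le> norm (fourier u \<omega> * cnj (fourier v \<omega>))" by simp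
    qed
  qed (use i in \<open>auto simp del: of_real_mult\<close>)
  from LIMSEQ_unique[OF this plancherel_corr[OF u(1) v]] show ?thesis .
qed

text \<open>\<open>plancherel_corr\<close> asks boundedness of one factor only, so \<open>w\<close>
  can be paired with its own sign cut off to a ball. The pairing is the integral of
  \<open>norm (w x)\<close> over that ball, and it vanishes.\<close>

theorem fourier_unique:
  fixes w :: "'a::euclidean_space \<Rightarrow> complex"
  assumes w: "integrable lborel w" and 0: "\<And>\<omega>. fourier w \<omega> = 0"
  shows "AE x in lborel. w x = 0"
proof -
  have [measurable]: "w \<in> borel_measurable borel" using w by auto
  have "AE x in lborel. x \<in> ball 0 (real n) \<longrightarrow> w x = 0" for n
  proof -
    define v where "v = (\<lambda>x. indicator (ball 0 (real n)) x * sgn (w x))"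
    have [measurable]: "ball 0 (real n) \<in> sets (borel :: 'a measure)" by simp
    have [measurable]: "v \<in> borel_measurable borel" unfolding v_def sgn_eq by measurable
    have vb: "norm (v x) \<le> indicator (ball 0 (real n)) x" for x by (auto simp: v_def norm_mult norm_sgn indicator_def)
    have vi: "integrable lborel v"
    proof (rule Bochner_Integration.integrable_bound)
      show "integrable lborel (indicator (ball 0 (real n)) :: 'a \<Rightarrow> real)"
        by (rule integrable_real_indicator[OF _ emeasure_bounded_finite]) auto
      show "AE x in lborel. norm (v x) \<le> norm (indicator (ball 0 (real n)) x :: real)"
        using vb by simp
    qed measurable
    have vb1: "norm (v x) \<le> 1" for x using vb[of x] by (rule order_trans) (simp add: indicator_def)
    have "(LBINT t. w t * cnj (v t)) = 0"
      using LIMSEQ_unique[OF plancherel_corr[OF w vi vb1]] 0 by simp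
    moreover have "w t * cnj (v t) = of_real (indicator (ball 0 (real n)) t * norm (w t))" for t
    proof -
      have "w t * cnj (sgn (w t)) = of_real (norm (w t))"
        by (cases "w t = 0") (auto simp: sgn_div_norm scaleR_conv_of_real complex_norm_square[symmetric] power2_eq_square field_simps)
      then show ?thesis by (auto simp: v_def indicator_def)
    qed
    ultimately have z: "(LBINT t. indicator (ball 0 (real n)) t * norm (w t)) = 0"
      by (simp only: integral_complex_of_real of_real_eq_0_iff)
    have "AE x in lborel. indicator (ball 0 (real n)) x * norm (w x) = 0"
      by (rule integral_nonneg_eq_0_iff_AE[THEN iffD1, OF _ _ z])
        (auto intro!: integrable_real_mult_indicator simp: w mult.commute[of "indicator _ _"])
    then show ?thesis by eventually_elim (auto simp: indicator_def split: if_splits)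
  qed
  then have "AE x in lborel. \<forall>n. x \<in> ball 0 (real n) \<longrightarrow> w x = 0" unfolding AE_all_countable by blast
  then show ?thesis
    by eventually_elim (metis dist_0_norm mem_ball reals_Archimedean2)
qed

subsection \<open>Lattices and their fundamental cells\<close>

text \<open>\<open>\<beta>\<close> is the dual basis: \<open>z \<bullet> \<beta> b\<close> is the
  coordinate of \<open>z\<close> along \<open>b\<close>, and the vectors \<open>\<beta> b\<close>
  are at the same time frequencies in the dual lattice.\<close>

locale lattice_basis =
  fixes \<Gamma> :: "'a::euclidean_space set" and B :: "'a set" and \<beta> :: "'a \<Rightarrow> 'a"
  assumes finite_B: "finite B"
    and \<beta>: "\<And>b b'. b \<in> B \<Longrightarrow> b' \<in> B \<Longrightarrow> b' \<bullet> \<beta> b = (if b' = b then 1 else 0)"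
    and expand: "\<And>z. (\<Sum>b\<in>B. (z \<bullet> \<beta> b) *\<^sub>R b) = z"
    and \<Gamma>_eq: "\<Gamma> = {\<Sum>b\<in>B. of_int (c b) *\<^sub>R b | c :: 'a \<Rightarrow> int. True}"

lemma lattice_basis_exists:
  assumes "is_lattice \<Gamma>"
  obtains B \<beta> where "lattice_basis \<Gamma> B \<beta>"
proof -
  obtain B where B: "independent B" "span B = UNIV"
    and \<Gamma>: "\<Gamma> = {\<Sum>b\<in>B. of_int (c b) *\<^sub>R b | c :: 'a \<Rightarrow> int. True}"
    using assms unfolding is_lattice_def by blast
  have fin: "finite B" using B(1) by (rule independent_imp_finite)
  \<comment> \<open>Coordinate functionals are linear, hence inner products with fixed vectors,
    assembled here from their values on \<open>Basis\<close>.\<close>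
  define \<beta> where "\<beta> b = (\<Sum>i\<in>Basis. representation B i b *\<^sub>R i)" for b
  have lin: "linear (\<lambda>z. representation B z b)" for b
    by (rule linearI) (simp_all add: real_vector.representation_add real_vector.representation_scale B)
  have coord: "representation B z b = z \<bullet> \<beta> b" for z b
  proof -
    have "representation B z b = representation B (\<Sum>i\<in>Basis. (z \<bullet> i) *\<^sub>R i) b"
      by (simp add: euclidean_representation)
    also have "\<dots> = (\<Sum>i\<in>Basis. (z \<bullet> i) * representation B i b)"
      using linear_sum[OF lin[of b], of "\<lambda>i. (z \<bullet> i) *\<^sub>R i" Basis] by (simp add: linear_scale[OF lin[of b]])
    also have "\<dots> = z \<bullet> \<beta> b"
      by (simp add: \<beta>_def inner_sum_right mult.commute)
    finally show ?thesis .
  qed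
  have "lattice_basis \<Gamma> B \<beta>"
  proof
    show "b' \<bullet> \<beta> b = (if b' = b then 1 else 0)" if "b \<in> B" "b' \<in> B" for b b'
      using real_vector.representation_basis[OF B(1) that(2)] that by (auto simp: coord[symmetric])
    show "(\<Sum>b\<in>B. (z \<bullet> \<beta> b) *\<^sub>R b) = z" for z
      using real_vector.sum_representation_eq[OF B(1) _ fin order_refl, of z] B(2) by (simp add: coord)
  qed (use fin \<Gamma> in auto)
  then show thesis by (rule that)
qed

context lattice_basis
begin

lemma coord_sum: "b \<in> B \<Longrightarrow> (\<Sum>b'\<in>B. c b' *\<^sub>R b') \<bullet> \<beta> b = c b"
  using finite_B by (simp add: inner_sum_left \<beta> if_distrib[of "\<lambda>x. _ * x"] cong: if_cong)

lemma lattice_iff: "z \<in> \<Gamma> \<longleftrightarrow> (\<forall>b\<in>B. z \<bullet> \<beta> b \<in> \<int>)"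
proof
  assume "\<forall>b\<in>B. z \<bullet> \<beta> b \<in> \<int>"
  then have "z = (\<Sum>b\<in>B. of_int \<lfloor>z \<bullet> \<beta> b\<rfloor> *\<^sub>R b)"
    by (subst expand[of z, symmetric]) (auto intro!: sum.cong elim!: Ints_cases)
  then show "z \<in> \<Gamma>" unfolding \<Gamma>_eq mem_Collect_eq
    by (intro exI[of _ "\<lambda>b. \<lfloor>z \<bullet> \<beta> b\<rfloor>"]) (simp only: simp_thms)
qed (auto simp: \<Gamma>_eq coord_sum)

lemma lattice_0 [simp]: "0 \<in> \<Gamma>"
  and lattice_add: "x \<in> \<Gamma> \<Longrightarrow> y \<in> \<Gamma> \<Longrightarrow> x + y \<in> \<Gamma>"
  and lattice_diff: "x \<in> \<Gamma> \<Longrightarrow> y \<in> \<Gamma> \<Longrightarrow> x - y \<in> \<Gamma>"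
  and lattice_minus: "x \<in> \<Gamma> \<Longrightarrow> - x \<in> \<Gamma>"
  by (auto simp: lattice_iff inner_add_left inner_diff_left)

lemma lattice_scale: "x \<in> \<Gamma> \<Longrightarrow> of_nat n *\<^sub>R x \<in> \<Gamma>"
  by (auto simp: lattice_iff)

lemma dual_basis: "b \<in> B \<Longrightarrow> \<beta> b \<in> dual_lattice \<Gamma>"
  by (auto simp: dual_lattice_def lattice_iff)

lemma coord_eq_0: "(\<And>b. b \<in> B \<Longrightarrow> z \<bullet> \<beta> b = 0) \<Longrightarrow> z = 0"
  using expand[of z] by simp

text \<open>Half-open, so that its lattice translates tile without overlap; centred, so that the
  origin, where the hull function is finally evaluated, is an interior point.\<close>

definition cell :: "'a set" where
  "cell = {z. \<forall>b\<in>B. - (1/2) \<le> z \<bullet> \<beta> b \<and> z \<bullet> \<beta> b < 1/2}"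

definition covol :: real where "covol = measure lborel cell"

definition radius :: real where "radius = (\<Sum>b\<in>B. norm b)"

lemma radius_nonneg: "0 \<le> radius"
  unfolding radius_def by (intro sum_nonneg) auto

lemma norm_le_coords: "(\<And>b. b \<in> B \<Longrightarrow> \<bar>z \<bullet> \<beta> b\<bar> \<le> 1) \<Longrightarrow> norm z \<le> radius"
proof -
  assume *: "\<And>b. b \<in> B \<Longrightarrow> \<bar>z \<bullet> \<beta> b\<bar> \<le> 1"
  have "norm z = norm (\<Sum>b\<in>B. (z \<bullet> \<beta> b) *\<^sub>R b)" by (simp add: expand)
  also have "\<dots> \<le> (\<Sum>b\<in>B. norm ((z \<bullet> \<beta> b) *\<^sub>R b))" by (rule norm_sum)
  also have "\<dots> \<le> radius"
    unfolding radius_def by (intro sum_mono) (use * mult_right_mono in fastforce)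
  finally show ?thesis .
qed

lemma cell_norm: "z \<in> cell \<Longrightarrow> norm z \<le> radius"
  by (rule norm_le_coords) (fastforce simp: cell_def)

lemma cell_bounded: "bounded cell"
  using cell_norm by (auto simp: bounded_iff)

lemma cell_measurable [measurable]: "cell \<in> sets borel"
proof -
  have "cell = (\<Inter>b\<in>B. {z. - (1/2) \<le> z \<bullet> \<beta> b} \<inter> {z. z \<bullet> \<beta> b < 1/2}) \<inter> UNIV"
    by (auto simp: cell_def)
  also have "\<dots> \<in> sets borel"
  proof (cases "B = {}")
    case False
    then show ?thesis using finite_B by (intro sets.Int sets.finite_INT) auto
  qed auto
  finally show ?thesis .
qed

lemma cell_emeasure: "emeasure lborel cell < \<infinity>"
  using cell_bounded by (rule emeasure_bounded_finite)

lemma cell_nhd: obtains d where "d > 0" "ball 0 d \<subseteq> cell"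
proof -
  let ?U = "\<Inter>b\<in>B. {z. \<bar>z \<bullet> \<beta> b\<bar> < 1/2}"
  have "open ?U"
    using finite_B by (intro open_INT ballI open_Collect_less continuous_intros) auto
  moreover have "0 \<in> ?U" by simp
  ultimately obtain d where d: "d > 0" "ball 0 d \<subseteq> ?U"
    using openE by blast
  have "z \<in> cell" if z: "z \<in> ball 0 d" for z
  proof -
    have "\<bar>z \<bullet> \<beta> b\<bar> < 1/2" if "b \<in> B" for b using subsetD[OF d(2) z] that by blast
    then have "- (1/2) \<le> z \<bullet> \<beta> b \<and> z \<bullet> \<beta> b < 1/2" if "b \<in> B" for b
      using that by (metis abs_less_iff less_imp_le minus_less_iff)
    then show ?thesis unfolding cell_def by blast
  qed
  then show thesis using that[OF d(1)] by blast
qed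

lemma covol_pos: "0 < covol"
proof -
  obtain d where d: "d > 0" "ball 0 d \<subseteq> cell" by (rule cell_nhd)
  have "0 < measure lborel (ball (0::'a) d)"
    using d(1) content_ball_pos[of d "0::'a"] by simp
  also have "\<dots> \<le> measure lborel cell"
    using cell_emeasure d by (intro measure_mono_fmeasurable) (auto simp: fmeasurable_def)
  finally show ?thesis by (simp add: covol_def)
qed

lemma cell_cover: obtains \<gamma> where "\<gamma> \<in> \<Gamma>" "z - \<gamma> \<in> cell"
proof -
  define c where "c b = \<lfloor>z \<bullet> \<beta> b + 1/2\<rfloor>" for b
  show thesis
  proof (rule that)
    show "(\<Sum>b\<in>B. of_int (c b) *\<^sub>R b) \<in> \<Gamma>" unfolding \<Gamma>_eq by blast
    show "z - (\<Sum>b\<in>B. of_int (c b) *\<^sub>R b) \<in> cell"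
      unfolding cell_def by (auto simp: inner_diff_left coord_sum c_def; linarith)
  qed
qed

lemma cell_unique:
  assumes "\<gamma> \<in> \<Gamma>" "\<gamma>' \<in> \<Gamma>" "z - \<gamma> \<in> cell" "z - \<gamma>' \<in> cell"
  shows "\<gamma> = \<gamma>'"
proof -
  have "\<gamma> - \<gamma>' = 0"
  proof (rule coord_eq_0)
    fix b assume b: "b \<in> B"
    have "(\<gamma> - \<gamma>') \<bullet> \<beta> b \<in> \<int>" using lattice_diff[OF assms(1,2)] b by (auto simp: lattice_iff)
    moreover have "\<bar>(\<gamma> - \<gamma>') \<bullet> \<beta> b\<bar> < 1"
    proof -
      have "- (1/2) \<le> (z - \<gamma>) \<bullet> \<beta> b" "(z - \<gamma>) \<bullet> \<beta> b < 1/2" "- (1/2) \<le> (z - \<gamma>') \<bullet> \<beta> b" "(z - \<gamma>') \<bullet> \<beta> b < 1/2"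
        using assms(3,4) b by (auto simp: cell_def)
      then show ?thesis unfolding inner_diff_left by linarith
    qed
    ultimately show "(\<gamma> - \<gamma>') \<bullet> \<beta> b = 0" using Ints_nonzero_abs_less1 by blast
  qed
  then show ?thesis by simp
qed

lemma lattice_finite_bounded:
  assumes "bounded S"
  shows "finite (\<Gamma> \<inter> S)"
proof -
  obtain R where R: "\<And>z. z \<in> S \<Longrightarrow> norm z \<le> R" using assms by (auto simp: bounded_iff)
  define N where "N = \<lceil>R * (\<Sum>b\<in>B. norm (\<beta> b))\<rceil>"
  have "\<Gamma> \<inter> S \<subseteq> (\<lambda>c. \<Sum>b\<in>B. of_int (c b) *\<^sub>R b) ` (PiE B (\<lambda>_. {-N..N}))"
  proof
    fix z assume z: "z \<in> \<Gamma> \<inter> S"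
    define c where "c = restrict (\<lambda>b. \<lfloor>z \<bullet> \<beta> b\<rfloor>) B"
    have ci: "of_int (c b) = z \<bullet> \<beta> b" if "b \<in> B" for b
      using z that by (auto simp: lattice_iff c_def elim!: Ints_cases)
    have "z = (\<Sum>b\<in>B. of_int (c b) *\<^sub>R b)"
      by (subst expand[of z, symmetric]) (simp add: ci)
    moreover have "c \<in> PiE B (\<lambda>_. {-N..N})"
    proof (rule PiE_I)
      fix b assume b: "b \<in> B"
      have "\<bar>of_int (c b)\<bar> \<le> norm z * norm (\<beta> b)" unfolding ci[OF b] by (rule Cauchy_Schwarz_ineq2)
      also have "\<dots> \<le> R * (\<Sum>b\<in>B. norm (\<beta> b))"
        using z R[of z] b finite_B order_trans[OF norm_ge_zero R[of z]]
        by (intro mult_mono) (auto intro: member_le_sum)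
      finally have "\<bar>of_int (c b)\<bar> \<le> R * (\<Sum>b\<in>B. norm (\<beta> b))" .
      then show "c b \<in> {-N..N}" unfolding N_def by (simp add: abs_le_iff) linarith
    qed (simp add: c_def)
    ultimately show "z \<in> (\<lambda>c. \<Sum>b\<in>B. of_int (c b) *\<^sub>R b) ` (PiE B (\<lambda>_. {-N..N}))" by blast
  qed
  then show ?thesis by (rule finite_subset) (intro finite_imageI finite_PiE finite_B, auto)
qed

lemma lattice_countable: "countable \<Gamma>"
proof -
  have "\<Gamma> = (\<Union>n::nat. \<Gamma> \<inter> ball 0 (real n))"
    using reals_Archimedean2 by auto
  also have "countable \<dots>"
    by (intro countable_UN) (auto intro: countable_finite lattice_finite_bounded)
  finally show ?thesis .
qed

text \<open>Moving \<open>z\<close> into the cell by a lattice vector is a bijection on the points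
  counted, after which all of them lie in one ball that does not depend on \<open>z\<close>.\<close>

lemma lattice_uniform_count:
  assumes "bounded S"
  obtains M :: nat where "\<And>z. finite {\<gamma> \<in> \<Gamma>. \<gamma> - z \<in> S}" "\<And>z. card {\<gamma> \<in> \<Gamma>. \<gamma> - z \<in> S} \<le> M"
proof -
  obtain R where R: "\<And>z. z \<in> S \<Longrightarrow> norm z \<le> R" using assms by (auto simp: bounded_iff)
  define T where "T = \<Gamma> \<inter> cball 0 (R + radius)"
  have T: "finite T" unfolding T_def by (intro lattice_finite_bounded bounded_cball)
  have *: "finite {\<gamma> \<in> \<Gamma>. \<gamma> - z \<in> S} \<and> card {\<gamma> \<in> \<Gamma>. \<gamma> - z \<in> S} \<le> card T" for z
  proof -
    obtain \<gamma>0 where \<gamma>0: "\<gamma>0 \<in> \<Gamma>" "z - \<gamma>0 \<in> cell" by (rule cell_cover)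
    have sub: "{\<gamma> \<in> \<Gamma>. \<gamma> - z \<in> S} \<subseteq> (\<lambda>x. x + \<gamma>0) ` T"
    proof
      fix \<gamma> assume \<gamma>: "\<gamma> \<in> {\<gamma> \<in> \<Gamma>. \<gamma> - z \<in> S}"
      have "norm (\<gamma> - \<gamma>0) \<le> norm (\<gamma> - z) + norm (z - \<gamma>0)"
        using norm_triangle_ineq[of "\<gamma> - z" "z - \<gamma>0"] by simp
      also have "\<dots> \<le> R + radius" using \<gamma> R cell_norm[OF \<gamma>0(2)] by (intro add_mono) auto
      finally have "\<gamma> - \<gamma>0 \<in> T" using \<gamma> \<gamma>0 by (auto simp: T_def lattice_diff)
      then show "\<gamma> \<in> (\<lambda>x. x + \<gamma>0) ` T" by (rule rev_image_eqI) simp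
    qed
    then show ?thesis
      using T by (meson card_image_le card_mono finite_imageI finite_subset le_trans)
  qed
  then show thesis using that by blast
qed

lemma sum_cell_translates: "((\<lambda>\<gamma>. indicator cell (z + \<gamma>) *\<^sub>R w) has_sum w) \<Gamma>"
  for w :: "'b::{real_normed_vector}"
proof -
  obtain \<gamma> where \<gamma>: "\<gamma> \<in> \<Gamma>" "z - \<gamma> \<in> cell" by (rule cell_cover)
  have "((\<lambda>\<gamma>. indicator cell (z + \<gamma>) *\<^sub>R w) has_sum w) {- \<gamma>}"
    using \<gamma> by (intro has_sum_finiteI) auto
  moreover have "indicator cell (z + \<gamma>') *\<^sub>R w = 0" if "\<gamma>' \<in> \<Gamma> - {-\<gamma>}" for \<gamma>'
    using cell_unique[of "-\<gamma>'" \<gamma> z] that \<gamma> lattice_minus by (auto simp: indicator_def)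
  ultimately show ?thesis
    using \<gamma> lattice_minus[of \<gamma>]
    by (subst has_sum_cong_neutral[where T="{-\<gamma>}" and g="\<lambda>\<gamma>. indicator cell (z + \<gamma>) *\<^sub>R w"]) auto
qed

text \<open>The tiling, integrated: an integral over the whole space becomes a sum of integrals over
  one cell. The bound by the L1 norm is what allows a second summation, over the generators, on top
  of the lattice sum.\<close>

lemma integral_unfold_cell:
  fixes F :: "'a \<Rightarrow> complex"
  assumes F: "integrable lborel F"
  shows "((\<lambda>\<gamma>. \<integral>z. indicator cell z *\<^sub>R F (z - \<gamma>) \<partial>lborel) has_sum (LBINT z. F z)) \<Gamma>"
    and "(\<lambda>\<gamma>. \<integral>z. norm (indicator cell z *\<^sub>R F (z - \<gamma>)) \<partial>lborel) summable_on \<Gamma>"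
    and "(\<Sum>\<^sub>\<infinity>\<gamma>\<in>\<Gamma>. \<integral>z. norm (indicator cell z *\<^sub>R F (z - \<gamma>)) \<partial>lborel) \<le> (LBINT z. norm (F z))"
    and "integrable lborel (\<lambda>z. indicator cell z *\<^sub>R F (z - \<gamma>))"
proof -
  have [measurable]: "F \<in> borel_measurable borel" using F by auto
  define f where "f \<gamma> z = indicator cell (z + \<gamma>) *\<^sub>R F z" for \<gamma> z
  have int: "integrable lborel (\<lambda>z. indicator cell z *\<^sub>R F (z - \<gamma>))" for \<gamma>
    using F by (intro integrable_mult_indicator) (auto simp: integrable_lborel_shift)
  then show "integrable lborel (\<lambda>z. indicator cell z *\<^sub>R F (z - \<gamma>))" .
  have f: "integrable lborel (f \<gamma>)" for \<gamma>
    unfolding f_def using int[of \<gamma>] integrable_lborel_shift(1)[of "\<lambda>z. indicator cell z *\<^sub>R F (z - \<gamma>)" \<gamma>] by simp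
  have shift: "(LBINT z. h (f \<gamma> z)) = (LBINT z. h (indicator cell z *\<^sub>R F (z - \<gamma>)))"
    for h :: "complex \<Rightarrow> 'c::{banach,second_countable_topology}" and \<gamma>
    using integral_lborel_shift(2)[of "\<lambda>z. h (f \<gamma> z)" \<gamma>] by (simp add: f_def)
  have bound: "(\<Sum>\<gamma>\<in>S. \<integral>z. norm (f \<gamma> z) \<partial>lborel) \<le> (LBINT z. norm (F z))" if S: "finite S" "S \<subseteq> \<Gamma>" for S
  proof -
    have "(\<Sum>\<gamma>\<in>S. norm (f \<gamma> z)) \<le> norm (F z)" for z
    proof -
      have "((\<lambda>\<gamma>. norm (f \<gamma> z)) has_sum norm (F z)) \<Gamma>"
        using sum_cell_translates[of z "norm (F z)"] by (simp add: f_def)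
      then show ?thesis
        by (rule finite_sum_le_has_sum) (use S in auto)
    qed
    then have "(LBINT z. (\<Sum>\<gamma>\<in>S. norm (f \<gamma> z))) \<le> (LBINT z. norm (F z))"
      using f F by (intro integral_mono) auto
    then show ?thesis using f by (subst (asm) Bochner_Integration.integral_sum) auto
  qed
  have sum: "(\<lambda>\<gamma>. \<integral>z. norm (f \<gamma> z) \<partial>lborel) summable_on \<Gamma>"
    by (rule nonneg_bdd_above_summable_on) (auto intro!: bdd_aboveI2 bound)
  then show "(\<lambda>\<gamma>. \<integral>z. norm (indicator cell z *\<^sub>R F (z - \<gamma>)) \<partial>lborel) summable_on \<Gamma>"
    by (simp only: shift)
  have "(\<Sum>\<^sub>\<infinity>\<gamma>\<in>\<Gamma>. \<integral>z. norm (f \<gamma> z) \<partial>lborel) \<le> (LBINT z. norm (F z))"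
    using sum by (rule infsum_le_finite_sums) (use bound in auto)
  then show "(\<Sum>\<^sub>\<infinity>\<gamma>\<in>\<Gamma>. \<integral>z. norm (indicator cell z *\<^sub>R F (z - \<gamma>)) \<partial>lborel) \<le> (LBINT z. norm (F z))"
    by (simp only: shift)
  have sumF: "(\<Sum>\<^sub>\<infinity>\<gamma>\<in>\<Gamma>. f \<gamma> z) = F z" for z
    unfolding f_def by (rule infsumI[OF sum_cell_translates])
  have "((\<lambda>\<gamma>. \<integral>z. f \<gamma> z \<partial>lborel) has_sum (LBINT z. (\<Sum>\<^sub>\<infinity>\<gamma>\<in>\<Gamma>. f \<gamma> z))) \<Gamma>"
    by (rule infsum_integral(3)[OF lattice_countable f sum])
  then show "((\<lambda>\<gamma>. \<integral>z. indicator cell z *\<^sub>R F (z - \<gamma>) \<partial>lborel) has_sum (LBINT z. F z)) \<Gamma>"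
    unfolding shift[of "\<lambda>x. x"] sumF .
qed

end

section \<open>Characters on the cell and uniqueness of Fourier coefficients\<close>

context lattice_basis
begin

lemma sum_cell_translates_minus: "((\<lambda>\<gamma>. indicator cell (z - \<gamma>) *\<^sub>R w) has_sum w) \<Gamma>"
  for w :: "'b::{real_normed_vector}"
proof -
  have "bij_betw uminus \<Gamma> \<Gamma>"
    by (rule bij_betwI[where g=uminus]) (auto intro: lattice_minus)
  from has_sum_reindex_bij_betw[OF this, of "\<lambda>\<gamma>. indicator cell (z + \<gamma>) *\<^sub>R w" w]
  show ?thesis using sum_cell_translates[of z w] by simp
qed

lemma dual_ee:
  assumes "\<gamma> \<in> \<Gamma>" "\<eta> \<in> dual_lattice \<Gamma>"
  shows "ee ((z - \<gamma>) \<bullet> \<eta>) = ee (z \<bullet> \<eta>)"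
proof -
  have "\<gamma> \<bullet> \<eta> \<in> \<int>" using assms by (auto simp: dual_lattice_def)
  then show ?thesis by (simp add: inner_diff_left ee_diff ee_Ints)
qed

lemma cell_indicator_integrable:
  assumes [measurable]: "f \<in> borel_measurable borel" and "\<And>z. norm (f z) \<le> M"
  shows "integrable lborel (\<lambda>z. indicator cell z *\<^sub>R (f z :: complex))"
proof (rule Bochner_Integration.integrable_bound)
  show "integrable lborel (\<lambda>z. M * indicator cell z)"
    using cell_emeasure by (intro integrable_mult_right integrable_real_indicator) auto
  show "AE z in lborel. norm (indicator cell z *\<^sub>R f z) \<le> norm (M * indicator cell z)"
    using assms(2) by (intro AE_I2) (auto simp: indicator_def intro: order_trans[OF _ abs_ge_self])
qed measurable

text \<open>Translating by a half-period \<open>z0\<close> of the character changes its sign, while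
  the integral of a periodic function over the cell and over a translated cell agree. So the
  integral equals its own negative unless \<eta> is 0.\<close>

lemma integral_cell_character:
  assumes \<eta>: "\<eta> \<in> dual_lattice \<Gamma>"
  shows "(LBINT z. indicator cell z *\<^sub>R ee (z \<bullet> \<eta>)) = (if \<eta> = 0 then of_real covol else 0)"
proof (cases "\<eta> = 0")
  case True
  have "(LBINT z. indicator cell z *\<^sub>R (1::complex)) = of_real covol"
    using cell_emeasure by (simp add: scaleR_conv_of_real covol_def)
  then show ?thesis using True by simp
next
  case False
  define z0 where "z0 = (1 / (2 * (\<eta> \<bullet> \<eta>))) *\<^sub>R \<eta>"
  have z0: "z0 \<bullet> \<eta> = 1 / 2" using False by (simp add: z0_def)
  have half: "ee (1/2) = -1" by (simp add: ee_def)
  have eez: "ee ((z - z0) \<bullet> \<eta>) = - ee (z \<bullet> \<eta>)" for z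
    unfolding inner_diff_left ee_diff z0 half by simp
  let ?I = "\<integral>z. indicator cell z *\<^sub>R ee (z \<bullet> \<eta>) \<partial>lborel"
  define G where "G z = indicator cell z *\<^sub>R ee ((z - z0) \<bullet> \<eta>)" for z
  \<comment> \<open>The character restricted to the cell moved by \<open>- z0\<close>. The
    translates of that cell tile as well, so unfolding \<open>F\<close> restores the character on
    the original cell.\<close>
  define F where "F z = indicator cell (z + z0) *\<^sub>R ee (z \<bullet> \<eta>)" for z
  have FG: "F z = G (z + z0)" for z by (simp add: F_def G_def)
  have G: "integrable lborel G"
    unfolding G_def by (rule cell_indicator_integrable[where M=1]) auto
  then have F: "integrable lborel F" unfolding FG by (simp add: integrable_lborel_shift)
  have "(LBINT z. F z) = (LBINT z. G z)" unfolding FG by (rule integral_lborel_shift)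
  also have "\<dots> = - ?I" unfolding G_def eez by simp
  finally have 1: "(LBINT z. F z) = - ?I" .
  have Fz: "F (z - \<gamma>) = indicator cell ((z + z0) - \<gamma>) *\<^sub>R ee (z \<bullet> \<eta>)" if "\<gamma> \<in> \<Gamma>" for z \<gamma>
    unfolding F_def dual_ee[OF that \<eta>] by (simp add: algebra_simps)
  have "(\<Sum>\<^sub>\<infinity>\<gamma>\<in>\<Gamma>. indicator cell z *\<^sub>R F (z - \<gamma>)) = indicator cell z *\<^sub>R ee (z \<bullet> \<eta>)" for z
  proof -
    have "(\<Sum>\<^sub>\<infinity>\<gamma>\<in>\<Gamma>. indicator cell z *\<^sub>R F (z - \<gamma>))
        = (\<Sum>\<^sub>\<infinity>\<gamma>\<in>\<Gamma>. indicator cell ((z + z0) - \<gamma>) *\<^sub>R (indicator cell z *\<^sub>R ee (z \<bullet> \<eta>)))"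
      by (rule infsum_cong) (simp add: Fz mult.commute)
    also have "\<dots> = indicator cell z *\<^sub>R ee (z \<bullet> \<eta>)" by (rule infsumI[OF sum_cell_translates_minus])
    finally show ?thesis .
  qed
  then have "((\<lambda>\<gamma>. \<integral>z. indicator cell z *\<^sub>R F (z - \<gamma>) \<partial>lborel) has_sum ?I) \<Gamma>"
    using infsum_integral(3)[OF lattice_countable integral_unfold_cell(4)[OF F] integral_unfold_cell(2)[OF F]] by simp
  from has_sum_unique[OF this integral_unfold_cell(1)[OF F]] 1 have "?I = - ?I" by simp
  then have "?I + ?I = 0" by (metis add.right_inverse)
  then have "2 * ?I = 0" by (simp only: mult_2)
  then have "?I = 0" by simp
  then show ?thesis using False by simp
qed

lemma dual_add: "\<eta> \<in> dual_lattice \<Gamma> \<Longrightarrow> \<eta>' \<in> dual_lattice \<Gamma> \<Longrightarrow> \<eta> + \<eta>' \<in> dual_lattice \<Gamma>"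
  and dual_diff: "\<eta> \<in> dual_lattice \<Gamma> \<Longrightarrow> \<eta>' \<in> dual_lattice \<Gamma> \<Longrightarrow> \<eta> - \<eta>' \<in> dual_lattice \<Gamma>"
  and dual_0: "0 \<in> dual_lattice \<Gamma>"
  by (auto simp: dual_lattice_def inner_add_right inner_diff_right)

text \<open>A trigonometric polynomial on the torus with values in \<open>[0, 1]\<close> whose only peak is the origin; its
  powers serve as an approximate identity.\<close>

definition hump :: "'a \<Rightarrow> real" where
  "hump z = (\<Prod>b\<in>B. (1 + cos (2 * pi * (z \<bullet> \<beta> b))) / 2)"

lemma hump_factor: "0 \<le> (1 + cos (2 * pi * x)) / 2" "(1 + cos (2 * pi * x)) / 2 \<le> 1"
proof -
  define c where "c = cos (2 * pi * x)"
  have "-1 \<le> c" "c \<le> 1" unfolding c_def by (rule cos_ge_minus_one, rule cos_le_one)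
  then have "0 \<le> (1 + c) / 2" "(1 + c) / 2 \<le> 1" by auto
  then show "0 \<le> (1 + cos (2 * pi * x)) / 2" "(1 + cos (2 * pi * x)) / 2 \<le> 1" by (simp_all only: c_def)
qed

lemma hump_nonneg: "0 \<le> hump z" and hump_le_1: "hump z \<le> 1"
  unfolding hump_def by (auto intro!: prod_nonneg prod_le_1 hump_factor simp del: divide_le_eq_numeral1)

lemma hump_0: "hump 0 = 1"
  by (simp add: hump_def)

lemma hump_continuous: "continuous_on UNIV hump"
  unfolding hump_def by (intro continuous_intros) auto

text \<open>Value 1 forces every cosine to be 1, hence every coordinate to be an integer;
  coordinates bounded by \<open>1/2\<close> leave only the origin.\<close>

lemma hump_less_1:
  assumes "z \<noteq> 0" "\<And>b. b \<in> B \<Longrightarrow> \<bar>z \<bullet> \<beta> b\<bar> \<le> 1/2"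
  shows "hump z < 1"
proof (rule ccontr)
  assume "\<not> hump z < 1"
  then have 1: "1 \<le> hump z" by simp
  have "z = 0"
  proof (rule coord_eq_0)
    fix b assume b: "b \<in> B"
    let ?f = "\<lambda>b. (1 + cos (2 * pi * (z \<bullet> \<beta> b))) / 2"
    have "hump z = ?f b * (\<Prod>b\<in>B - {b}. ?f b)"
      unfolding hump_def by (rule prod.remove[OF finite_B b])
    also have "\<dots> \<le> ?f b * 1"
      by (intro mult_left_mono prod_le_1 hump_factor conjI)
    finally have "1 \<le> ?f b" using 1 by simp
    then have "1 \<le> cos (2 * pi * (z \<bullet> \<beta> b))" by simp
    then have "cos (2 * pi * (z \<bullet> \<beta> b)) = 1" by (intro order_antisym cos_le_one)
    then obtain n :: int where "2 * pi * (z \<bullet> \<beta> b) = of_int n * (2 * pi)"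
      unfolding cos_one_2pi_int by auto
    then have n: "z \<bullet> \<beta> b = of_int n" by simp
    with assms(2)[OF b] have "\<bar>of_int n :: real\<bar> < 1" by simp
    then have "n = 0" by linarith
    with n show "z \<bullet> \<beta> b = 0" by simp
  qed
  with assms(1) show False by simp
qed

lemma hump_bound_outside:
  assumes "0 < d"
  obtains \<rho> where "0 \<le> \<rho>" "\<rho> < 1" "\<And>z. z \<in> cell \<Longrightarrow> d \<le> norm z \<Longrightarrow> hump z \<le> \<rho>"
proof -
  \<comment> \<open>The cell is not closed, so the maximum is taken over its closure outside the
    ball, which is compact; \<open>hump\<close> stays below 1 on the added faces too.\<close>
  define C where "C = {z. (\<forall>b\<in>B. \<bar>z \<bullet> \<beta> b\<bar> \<le> 1/2) \<and> d \<le> norm z}"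
  have sub: "z \<in> C" if "z \<in> cell" "d \<le> norm z" for z
    using that unfolding C_def cell_def by (auto simp: abs_le_iff)
  have "C = (\<Inter>b\<in>B. {z. \<bar>z \<bullet> \<beta> b\<bar> \<le> 1/2}) \<inter> {z. d \<le> norm z}"
    by (auto simp: C_def)
  also have "closed \<dots>"
    by (intro closed_Int closed_INT ballI closed_Collect_le continuous_intros)
  finally have "closed C" .
  moreover have "norm z \<le> radius" if "z \<in> C" for z
    by (rule norm_le_coords) (use that in \<open>fastforce simp: C_def\<close>)
  then have "bounded C" by (auto simp: bounded_iff)
  ultimately have C: "compact C" by (simp add: compact_eq_bounded_closed)
  show thesis
  proof (cases "C = {}")
    case True
    then show ?thesis using that[of 0] sub by auto
  next
    case False
    then obtain x where x: "x \<in> C" "\<And>z. z \<in> C \<Longrightarrow> hump z \<le> hump x"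
      using continuous_attains_sup[OF C, of hump] continuous_on_subset[OF hump_continuous] by auto
    show ?thesis
    proof (rule that)
      show "hump x < 1" using x(1) assms by (intro hump_less_1) (auto simp: C_def)
    qed (use x sub hump_nonneg in auto)
  qed
qed

text \<open>Each factor of \<open>hump\<close> is a combination of the characters with frequencies 0
  and plus or minus \<open>\<beta> b\<close>, all in the dual lattice, so \<open>hump ^ N\<close> is
  a trigonometric polynomial of admissible frequencies.\<close>

lemma vanishing_hump:
  assumes F: "integrable lborel (\<lambda>z. indicator cell z *\<^sub>R (F z :: complex))"
    and 0: "\<And>\<eta>. \<eta> \<in> dual_lattice \<Gamma> \<Longrightarrow> (LBINT z. indicator cell z *\<^sub>R F z * ee (z \<bullet> \<eta>)) = 0"
  shows "(LBINT z. indicator cell z *\<^sub>R F z * of_real (hump z ^ N)) = 0"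
proof -
  \<comment> \<open>The multipliers that keep every Fourier coefficient zero. All frequencies must
    be included for the induction, since a cosine factor shifts them; the bound by 1 keeps the
    products integrable.\<close>
  define Z where "Z \<phi> \<longleftrightarrow> \<phi> \<in> borel_measurable borel \<and> (\<forall>z. \<bar>\<phi> z\<bar> \<le> (1::real)) \<and>
     (\<forall>\<eta>\<in>dual_lattice \<Gamma>. (LBINT z. indicator cell z *\<^sub>R F z * of_real (\<phi> z) * ee (z \<bullet> \<eta>)) = 0)" for \<phi> :: "'a \<Rightarrow> real"
  have Z1: "Z (\<lambda>_. 1)" using 0 by (simp add: Z_def)
  have step: "Z (\<lambda>z. \<phi> z * ((1 + cos (2 * pi * (z \<bullet> \<beta> b))) / 2))" if "Z \<phi>" and b: "b \<in> B" for \<phi> b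
  proof -
    have [measurable]: "\<phi> \<in> borel_measurable borel" and bd: "\<And>z. \<bar>\<phi> z\<bar> \<le> 1"
      and z: "\<And>\<eta>. \<eta> \<in> dual_lattice \<Gamma> \<Longrightarrow> (LBINT z. indicator cell z *\<^sub>R F z * of_real (\<phi> z) * ee (z \<bullet> \<eta>)) = 0"
      using that by (auto simp: Z_def)
    have int: "integrable lborel (\<lambda>z. indicator cell z *\<^sub>R F z * of_real (\<phi> z) * ee (z \<bullet> \<eta>))" for \<eta>
    proof (rule Bochner_Integration.integrable_bound[OF F])
      show "AE x in lborel. norm (indicator cell x *\<^sub>R F x * of_real (\<phi> x) * ee (x \<bullet> \<eta>)) \<le> norm (indicator cell x *\<^sub>R F x)"
        using bd by (intro AE_I2) (auto simp: norm_mult indicator_def intro!: mult_left_le)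
      have [measurable]: "(\<lambda>z. indicator cell z *\<^sub>R F z) \<in> borel_measurable borel" using F by auto
      show "(\<lambda>z. indicator cell z *\<^sub>R F z * of_real (\<phi> z) * ee (z \<bullet> \<eta>)) \<in> borel_measurable lborel"
        by measurable
    qed
    have "(LBINT z. indicator cell z *\<^sub>R F z * of_real (\<phi> z * ((1 + cos (2 * pi * (z \<bullet> \<beta> b))) / 2)) * ee (z \<bullet> \<eta>)) = 0"
      if \<eta>: "\<eta> \<in> dual_lattice \<Gamma>" for \<eta>
    proof -
      have cos: "complex_of_real ((1 + cos (2 * pi * x)) / 2) = 1/2 + ee x / 4 + ee (-x) / 4" for x
        by (simp add: complex_eq_iff ee_def)
      have "indicator cell z *\<^sub>R F z * of_real (\<phi> z * ((1 + cos (2 * pi * (z \<bullet> \<beta> b))) / 2)) * ee (z \<bullet> \<eta>)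
        = (1/2) * (indicator cell z *\<^sub>R F z * of_real (\<phi> z) * ee (z \<bullet> \<eta>))
        + (1/4) * (indicator cell z *\<^sub>R F z * of_real (\<phi> z) * ee (z \<bullet> (\<eta> + \<beta> b)))
        + (1/4) * (indicator cell z *\<^sub>R F z * of_real (\<phi> z) * ee (z \<bullet> (\<eta> - \<beta> b)))" for z
        unfolding of_real_mult cos inner_add_right inner_diff_right ee_add ee_diff ee_minus
        by (simp add: scaleR_conv_of_real algebra_simps)
      then have "(LBINT z. indicator cell z *\<^sub>R F z * of_real (\<phi> z * ((1 + cos (2 * pi * (z \<bullet> \<beta> b))) / 2)) * ee (z \<bullet> \<eta>))
        = (LBINT z. (1/2) * (indicator cell z *\<^sub>R F z * of_real (\<phi> z) * ee (z \<bullet> \<eta>)))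
        + (LBINT z. (1/4) * (indicator cell z *\<^sub>R F z * of_real (\<phi> z) * ee (z \<bullet> (\<eta> + \<beta> b))))
        + (LBINT z. (1/4) * (indicator cell z *\<^sub>R F z * of_real (\<phi> z) * ee (z \<bullet> (\<eta> - \<beta> b))))"
        using int by (simp only: Bochner_Integration.integral_add Bochner_Integration.integrable_add integrable_mult_right)
      then show ?thesis
        unfolding integral_mult_right_zero using z \<eta> dual_add[OF \<eta> dual_basis[OF b]] dual_diff[OF \<eta> dual_basis[OF b]]
        by simp
    qed
    moreover have "\<bar>\<phi> z * ((1 + cos (2 * pi * (z \<bullet> \<beta> b))) / 2)\<bar> \<le> 1" for z
      using bd[of z] hump_factor[of "z \<bullet> \<beta> b"] by (simp only: abs_mult mult_le_one abs_of_nonneg abs_ge_zero)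
    ultimately show ?thesis unfolding Z_def by auto
  qed
  have prod: "Z (\<lambda>z. \<phi> z * (\<Prod>b\<in>S. (1 + cos (2 * pi * (z \<bullet> \<beta> b))) / 2))" if "finite S" "S \<subseteq> B" "Z \<phi>" for \<phi> S
    using that(1,2)
  proof (induction S)
    case empty
    then show ?case using that by simp
  next
    case (insert b S)
    then show ?case using step[of "\<lambda>z. \<phi> z * (\<Prod>b\<in>S. (1 + cos (2 * pi * (z \<bullet> \<beta> b))) / 2)" b]
      by (simp add: mult_ac)
  qed
  have "Z (\<lambda>z. hump z ^ N)"
  proof (induction N)
    case 0
    then show ?case using Z1 by simp
  next
    case (Suc N)
    from prod[OF finite_B order_refl this] show ?case
      by (simp add: hump_def mult.commute)
  qed
  then show ?thesis using dual_0 by (fastforce simp: Z_def)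
qed

text \<open>Normalised powers of \<open>hump\<close> concentrate at the origin, so their averages of
  \<open>F\<close> tend to \<open>F 0\<close>, while by \<open>vanishing_hump\<close> all these
  averages are 0. Only boundedness and continuity at one point enter, which suits a function with
  jumps elsewhere.\<close>

theorem fourier_coefficients_zero:
  fixes F :: "'a \<Rightarrow> complex"
  assumes F: "integrable lborel (\<lambda>z. indicator cell z *\<^sub>R F z)"
    and bd: "\<And>z. z \<in> cell \<Longrightarrow> norm (F z) \<le> M" and cont: "isCont F 0"
    and 0: "\<And>\<eta>. \<eta> \<in> dual_lattice \<Gamma> \<Longrightarrow> (LBINT z. indicator cell z *\<^sub>R F z * ee (z \<bullet> \<eta>)) = 0"
  shows "F 0 = 0"
proof -
  obtain d0 where d0: "d0 > 0" "ball 0 d0 \<subseteq> cell" by (rule cell_nhd)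
  have M: "norm (F 0) \<le> M" using d0 by (intro bd) auto
  have humpm [measurable]: "hump \<in> borel_measurable borel"
    using hump_continuous by (rule borel_measurable_continuous_onI)
  have "norm (F 0) \<le> e" if "0 < e" for e
  proof -
    obtain d1 where d1: "d1 > 0" "\<And>z. norm z < d1 \<Longrightarrow> norm (F z - F 0) < e"
      using cont \<open>0 < e\<close> unfolding continuous_at_eps_delta by (auto simp: dist_norm)
    obtain \<rho> where \<rho>: "0 \<le> \<rho>" "\<rho> < 1" "\<And>z. z \<in> cell \<Longrightarrow> d1 \<le> norm z \<Longrightarrow> hump z \<le> \<rho>"
      using hump_bound_outside[OF d1(1)] by blast
    \<comment> \<open>Strictly between \<rho> and 1. Near the origin \<open>hump\<close> exceeds
      \<rho>', so the total mass is at least of order \<open>\<rho>' ^ N\<close>; away from it the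
      contribution is of order \<open>\<rho> ^ N\<close>, and the quotient tends to 0.\<close>
    define \<rho>' where "\<rho>' = (1 + \<rho>) / 2"
    have \<rho>': "\<rho> < \<rho>'" "\<rho>' < 1" "0 < \<rho>'" using \<rho> by (auto simp: \<rho>'_def)
    have "isCont hump 0" using hump_continuous by (simp add: continuous_on_eq_continuous_at)
    then obtain d2 where d2: "d2 > 0" "\<And>z. norm z < d2 \<Longrightarrow> \<bar>hump z - hump 0\<bar> < 1 - \<rho>'"
      unfolding continuous_at_eps_delta using \<rho>' by (auto simp: dist_norm) (metis diff_gt_0_iff_gt)
    define d where "d = min d0 d2"
    have d: "d > 0" "ball 0 d \<subseteq> cell" "\<And>z. norm z < d \<Longrightarrow> \<rho>' \<le> hump z"
      using d0 d2 hump_0 by (force simp: d_def)+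
    define m where "m = measure lborel (ball (0::'a) d)"
    have m: "0 < m" using content_ball_pos[OF d(1), of "0::'a"] by (simp add: m_def)
    have ib: "integrable lborel (indicator (ball (0::'a) d) :: 'a \<Rightarrow> real)"
      by (rule integrable_real_indicator[OF _ emeasure_bounded_finite]) auto
    have ic: "integrable lborel (indicator cell :: 'a \<Rightarrow> real)"
      using cell_emeasure by (intro integrable_real_indicator) auto
    have ih: "integrable lborel (\<lambda>z. indicator cell z * hump z ^ N)" for N
      by (rule Bochner_Integration.integrable_bound[OF ic])
        (auto simp: indicator_def hump_nonneg power_le_one hump_le_1)
    define I where "I N = (LBINT z. indicator cell z * hump z ^ N)" for N
    have I_low: "\<rho>' ^ N * m \<le> I N" for N
    proof -
      have "\<rho>' ^ N * m = (\<integral>z. \<rho>' ^ N * indicator (ball 0 d) z \<partial>(lborel :: 'a measure))"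
        by (simp add: m_def)
      also have "\<dots> \<le> I N"
        unfolding I_def
      proof (rule integral_mono[OF _ ih])
        fix z :: 'a
        show "\<rho>' ^ N * indicator (ball 0 d) z \<le> indicator cell z * hump z ^ N"
          using d \<rho>' by (auto simp: indicator_def hump_nonneg intro!: power_mono)
      qed (use ib in auto)
      finally show ?thesis .
    qed
    have main: "norm (F 0) * I N \<le> e * I N + 2 * M * \<rho> ^ N * covol" for N
    proof -
      have i1: "integrable lborel (\<lambda>z. indicator cell z *\<^sub>R F z * of_real (hump z ^ N))"
      proof (rule Bochner_Integration.integrable_bound[OF F])
        have [measurable]: "(\<lambda>z. indicator cell z *\<^sub>R F z) \<in> borel_measurable borel" using F by auto
        show "(\<lambda>z. indicator cell z *\<^sub>R F z * of_real (hump z ^ N)) \<in> borel_measurable lborel" by measurable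
        show "AE z in lborel. norm (indicator cell z *\<^sub>R F z * of_real (hump z ^ N)) \<le> norm (indicator cell z *\<^sub>R F z)"
          by (intro AE_I2) (auto simp: norm_mult norm_power hump_nonneg indicator_def intro!: mult_left_le power_le_one hump_le_1)
      qed
      have "complex_of_real (I N) = (LBINT z. of_real (indicator cell z * hump z ^ N))"
        unfolding I_def by (simp only: integral_complex_of_real)
      then have "F 0 * of_real (I N) = (LBINT z. F 0 * of_real (indicator cell z * hump z ^ N))"
        by (simp only: integral_mult_right_zero)
      also have "\<dots> = (LBINT z. F 0 * of_real (indicator cell z * hump z ^ N) - indicator cell z *\<^sub>R F z * of_real (hump z ^ N))"
        using ih[of N] i1 vanishing_hump[OF F 0, of N]
        by (subst Bochner_Integration.integral_diff) (auto simp del: of_real_mult of_real_power)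
      finally have "norm (F 0 * of_real (I N)) = norm (LBINT z. F 0 * of_real (indicator cell z * hump z ^ N) - indicator cell z *\<^sub>R F z * of_real (hump z ^ N))"
        by simp
      also have "\<dots> \<le> (LBINT z. norm (F 0 * of_real (indicator cell z * hump z ^ N) - indicator cell z *\<^sub>R F z * of_real (hump z ^ N)))"
        by (rule integral_norm_bound)
      also have "\<dots> \<le> (LBINT z. e * (indicator cell z * hump z ^ N) + 2 * M * \<rho> ^ N * indicator cell z)"
      proof (rule integral_mono)
        show "integrable lborel (\<lambda>z. norm (F 0 * of_real (indicator cell z * hump z ^ N) - indicator cell z *\<^sub>R F z * of_real (hump z ^ N)))"
          using ih[of N] i1 by (intro integrable_norm Bochner_Integration.integrable_diff integrable_mult_right) (auto simp del: of_real_mult of_real_power)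
        show "integrable lborel (\<lambda>z. e * (indicator cell z * hump z ^ N) + 2 * M * \<rho> ^ N * indicator cell z)"
          using ih ic by (intro Bochner_Integration.integrable_add integrable_mult_right) auto
        fix z
        show "norm (F 0 * of_real (indicator cell z * hump z ^ N) - indicator cell z *\<^sub>R F z * of_real (hump z ^ N))
          \<le> e * (indicator cell z * hump z ^ N) + 2 * M * \<rho> ^ N * indicator cell z"
        proof (cases "z \<in> cell")
          case True
          have "norm (F 0 * of_real (indicator cell z * hump z ^ N) - indicator cell z *\<^sub>R F z * of_real (hump z ^ N)) = norm (F 0 - F z) * hump z ^ N"
            using True by (simp add: norm_mult norm_power hump_nonneg flip: left_diff_distrib)
          also have "\<dots> \<le> e * hump z ^ N + 2 * M * \<rho> ^ N"
          proof (cases "norm z < d1")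
            case True
            have "norm (F 0 - F z) * hump z ^ N \<le> e * hump z ^ N"
              using d1(2)[OF True] by (intro mult_right_mono) (auto simp: hump_nonneg norm_minus_commute)
            moreover have "0 \<le> 2 * M * \<rho> ^ N" using order_trans[OF norm_ge_zero M] \<rho>(1) by simp
            ultimately show ?thesis by linarith
          next
            case False
            have "norm (F 0 - F z) \<le> 2 * M" using norm_triangle_ineq4[of "F 0" "F z"] M bd[OF True] by linarith
            then have "norm (F 0 - F z) * hump z ^ N \<le> 2 * M * \<rho> ^ N"
              using \<rho>(3)[OF True] False order_trans[OF norm_ge_zero M]
              by (intro mult_mono power_mono) (auto simp: hump_nonneg)
            moreover have "0 \<le> e * hump z ^ N" using \<open>0 < e\<close> by (simp add: hump_nonneg)
            ultimately show ?thesis by linarith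
          qed
          finally show ?thesis using True by simp
        qed simp
      qed
      also have "\<dots> = e * I N + 2 * M * \<rho> ^ N * covol"
        unfolding I_def covol_def using ih ic by (subst Bochner_Integration.integral_add) auto
      finally show ?thesis
        using I_low[of N] m \<rho>' by (simp add: norm_mult abs_of_nonneg order_trans[OF _ I_low[of N]])
    qed
    have "norm (F 0) \<le> e + 2 * M * covol / m * (\<rho> / \<rho>') ^ N" for N
    proof -
      have pos: "0 < I N" using I_low[of N] m \<rho>' by (meson less_le_trans mult_pos_pos zero_less_power)
      have "norm (F 0) * I N \<le> e * I N + 2 * M * covol / m * (\<rho> / \<rho>') ^ N * (\<rho>' ^ N * m)"
        using main[of N] m \<rho>' by (simp add: power_divide mult_ac)
      also have "\<dots> \<le> e * I N + 2 * M * covol / m * (\<rho> / \<rho>') ^ N * I N"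
        using I_low[of N] m \<rho> \<rho>' order_trans[OF norm_ge_zero M] covol_pos
        by (intro add_left_mono mult_left_mono) auto
      finally have "norm (F 0) * I N \<le> (e + 2 * M * covol / m * (\<rho> / \<rho>') ^ N) * I N"
        by (simp only: distrib_right)
      then show ?thesis by (rule mult_right_le_imp_le[OF _ pos])
    qed
    moreover have "(\<lambda>N. e + 2 * M * covol / m * (\<rho> / \<rho>') ^ N) \<longlonglongrightarrow> e + 2 * M * covol / m * 0"
      using \<rho> \<rho>' by (intro tendsto_intros LIMSEQ_power_zero) auto
    ultimately show ?thesis using LIMSEQ_le_const by fastforce
  qed
  then have "norm (F 0) \<le> 0" using field_le_epsilon[of "norm (F 0)" 0] by simp
  then show ?thesis by simp
qed

end

subsection \<open>The function \<open>\<Phi>\<close>\<close>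

lemma fourier_diff_le:
  assumes f: "integrable lebesgue f" and g: "integrable lebesgue g"
  shows "norm (fourier f \<omega> - fourier g \<omega>) \<le> (\<integral>t. norm (f t - g t) \<partial>lebesgue)"
proof -
  have ex: "exp (- 2 * of_real pi * \<i> * of_real (t \<bullet> \<omega>)) = ee (- (t \<bullet> \<omega>))" for t
    unfolding ee_def cis_conv_exp by (simp add: mult_ac)
  have [measurable]: "(\<lambda>t. - (t \<bullet> \<omega>)) \<in> borel_measurable lebesgue"
    by (rule measurable_completion) measurable
  have i: "integrable lebesgue (\<lambda>t. h t * ee (- (t \<bullet> \<omega>)))" if "integrable lebesgue h" for h
    using that by (rule integrable_mult_ee) measurable
  have "fourier f \<omega> - fourier g \<omega> = (\<integral>t. (f t - g t) * ee (- (t \<bullet> \<omega>)) \<partial>lebesgue)"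
    unfolding fourier_def ex left_diff_distrib
    by (rule Bochner_Integration.integral_diff[symmetric]) (intro i f g)+
  also have "norm \<dots> \<le> (\<integral>t. norm ((f t - g t) * ee (- (t \<bullet> \<omega>))) \<partial>lebesgue)"
    by (rule integral_norm_bound)
  finally show ?thesis by (simp add: norm_mult)
qed

lemma L1_dist_sum_le:
  fixes f :: "nat \<Rightarrow> 'a \<Rightarrow> complex"
  assumes int: "\<And>i. integrable M (f i)" and c: "\<And>i. (\<integral>x. norm (f (Suc i) x - f i x) \<partial>M) \<le> c i"
    and "m \<le> n"
  shows "(\<integral>x. norm (f n x - f m x) \<partial>M) \<le> (\<Sum>i=m..<n. c i)"
  using \<open>m \<le> n\<close>
proof (induction n rule: dec_induct)
  case (step n)
  have "(\<integral>x. norm (f (Suc n) x - f m x) \<partial>M) \<le> (\<integral>x. norm (f (Suc n) x - f n x) \<partial>M) + (\<integral>x. norm (f n x - f m x) \<partial>M)"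
    by (rule L1_dist_triangle) (rule int)+
  then show ?case using step c[of n] by simp
qed simp

text \<open>Completeness of L1 for sequences with summable steps: the telescoping series converges
  absolutely almost everywhere and is dominated by the sum of the norms of its terms.\<close>

lemma L1_limit_exists:
  fixes f :: "nat \<Rightarrow> 'a \<Rightarrow> complex"
  assumes int: "\<And>i. integrable M (f i)" and c: "\<And>i. (\<integral>x. norm (f (Suc i) x - f i x) \<partial>M) \<le> c i"
    and sum: "summable c"
  obtains g where "integrable M g" "(\<lambda>n. \<integral>x. norm (f n x - g x) \<partial>M) \<longlonglongrightarrow> 0"
proof -
  define d where "d i x = f (Suc i) x - f i x" for i x
  have d: "integrable M (d i)" for i unfolding d_def using int by auto
  have c0: "0 \<le> c i" for i using c[of i] by (rule order_trans[rotated]) simp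
  have sd: "summable (\<lambda>i. \<integral>x. norm (d i x) \<partial>M)"
    using sum by (rule summable_comparison_test') (use c in \<open>auto simp: d_def\<close>)
  note AE = suminf_integral(1)[OF d sd]
  have id: "integrable M (\<lambda>x. \<Sum>i. d i x)" by (rule integrable_suminf[OF d AE sd])
  define g where "g x = f 0 x + (\<Sum>i. d i x)" for x
  have g: "integrable M g" unfolding g_def using int id by auto
  have "(\<lambda>n. \<integral>x. norm (f n x - g x) \<partial>M) \<longlonglongrightarrow> (\<integral>x. 0 \<partial>M)"
  proof (rule integral_dominated_convergence[where w="\<lambda>x. 2 * (\<Sum>i. norm (d i x))"])
    show "integrable M (\<lambda>x. 2 * (\<Sum>i. norm (d i x)))"
      using d AE sd by (intro integrable_mult_right integrable_suminf) auto
    show "AE x in M. (\<lambda>n. norm (f n x - g x)) \<longlonglongrightarrow> 0"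
      using AE
    proof eventually_elim
      case (elim x)
      have "(\<lambda>n. f 0 x + (\<Sum>i<n. d i x)) \<longlonglongrightarrow> g x"
        unfolding g_def by (intro tendsto_intros summable_LIMSEQ summable_norm_cancel[OF elim])
      moreover have "f 0 x + (\<Sum>i<n. d i x) = f n x" for n
        unfolding d_def sum_lessThan_telescope[of "\<lambda>i. f i x"] by simp
      ultimately have "(\<lambda>n. f n x) \<longlonglongrightarrow> g x" by simp
      then have "(\<lambda>n. norm (f n x - g x)) \<longlonglongrightarrow> norm (g x - g x)" by (intro tendsto_intros)
      then show ?case by simp
    qed
    show "AE x in M. norm (norm (f n x - g x)) \<le> 2 * (\<Sum>i. norm (d i x))" for n
      using AE
    proof eventually_elim
      case (elim x)
      have "f 0 x + (\<Sum>i<n. d i x) = f n x" unfolding d_def sum_lessThan_telescope[of "\<lambda>i. f i x"] by simp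
      then have "f n x - g x = (f 0 x + (\<Sum>i<n. d i x)) - g x" by simp
      also have "\<dots> = (\<Sum>i<n. d i x) - (\<Sum>i. d i x)" by (simp add: g_def)
      also have "norm \<dots> \<le> norm (\<Sum>i<n. d i x) + norm (\<Sum>i. d i x)" by (rule norm_triangle_ineq4)
      also have "\<dots> \<le> (\<Sum>i<n. norm (d i x)) + (\<Sum>i. norm (d i x))"
        by (intro add_mono norm_sum summable_norm elim)
      also have "(\<Sum>i<n. norm (d i x)) \<le> (\<Sum>i. norm (d i x))"
        by (rule sum_le_suminf[OF elim]) auto
      finally show ?case by simp
    qed
  qed (use int g in auto)
  then show thesis using that[OF g] by simp
qed

lemma L1_average_norm_le:
  fixes u :: "'a::euclidean_space \<Rightarrow> complex" and a :: "'a \<Rightarrow> real"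
  assumes u: "integrable lborel u" and a: "integrable lborel a" "\<And>s. 0 \<le> a s" "(LBINT s. a s) = 1"
  shows "(LBINT x. norm (LBINT s. a s * u (x - s))) \<le> (LBINT x. norm (u x))"
proof -
  have i1: "integrable (lborel \<Otimes>\<^sub>M lborel) (\<lambda>(x, s). of_real (a s) * u (x - s))"
    by (rule convolution_pair_integrable) (use u a in auto)
  have i4: "integrable (lborel \<Otimes>\<^sub>M lborel) (\<lambda>(x, s). a s * norm (u (x - s)))"
    using integrable_norm[OF i1] a(2) by (simp add: case_prod_unfold norm_mult)
  have "(LBINT x. norm (LBINT s. a s * u (x - s))) \<le> (LBINT x. (LBINT s. a s * norm (u (x - s))))"
  proof (rule integral_mono)
    show "integrable lborel (\<lambda>x. norm (LBINT s. a s * u (x - s)))"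
      using lborel_pair.integrable_fst'[OF i1] by simp
    show "integrable lborel (\<lambda>x. \<integral>s. a s * norm (u (x - s)) \<partial>lborel)"
      using lborel_pair.integrable_fst'[OF i4] by simp
    show "norm (LBINT s. a s * u (x - s)) \<le> (LBINT s. a s * norm (u (x - s)))" for x
      using integral_norm_bound[of lborel "\<lambda>s. a s * u (x - s)"] a(2) by (simp add: norm_mult)
  qed
  also have "\<dots> = (LBINT s. (LBINT x. a s * norm (u (x - s))))"
    using lborel_pair.Fubini_integral[of "\<lambda>x s. a s * norm (u (x - s))"] i4 by simp
  also have "\<dots> = (LBINT s. a s * (LBINT x. norm (u x)))"
    using integral_lborel_shift(2)[of "\<lambda>x. norm (u x)"] by simp
  finally show ?thesis using a by simp
qed

section \<open>Iterated box averages and their limit\<close>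

definition box_density :: "real \<Rightarrow> real \<Rightarrow> real" where
  "box_density r x = indicator {-r..r} x / (2 * r)"

lemma box_density:
  assumes "0 < r"
  shows "integrable lborel (box_density r)" "0 \<le> box_density r x" "(LBINT x. box_density r x) = 1"
    "box_density r \<in> borel_measurable borel" "box_density r x \<le> 1 / (2 * r)" "box_density r x \<noteq> 0 \<Longrightarrow> \<bar>x\<bar> \<le> r"
proof -
  have i: "integrable lborel (indicator {-r..r} :: real \<Rightarrow> real)"
    by (rule integrable_real_indicator) (use assms in auto)
  have m: "(LBINT x. indicator {-r..r} x) = 2 * r" using assms by simp
  show "integrable lborel (box_density r)" "(LBINT x. box_density r x) = 1"
    unfolding box_density_def[abs_def] using i m assms by simp_all
  show "box_density r \<in> borel_measurable borel" unfolding box_density_def[abs_def] by measurable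
qed (use assms in \<open>auto simp: box_density_def indicator_def split: if_splits\<close>)

text \<open>A shifted interval differs from the original only near the two ends, inside intervals of
  length \<open>2 * \<bar>s\<bar>\<close>, where the density is \<open>1 / (2 * r)\<close>.\<close>

lemma box_density_translation:
  assumes r: "0 < r"
  shows "(LBINT t. norm (complex_of_real (box_density r (t - s)) - complex_of_real (box_density r t))) \<le> 2 * \<bar>s\<bar> / r"
proof -
  have "norm (complex_of_real (box_density r (t - s)) - complex_of_real (box_density r t))
     \<le> (indicator {-r-\<bar>s\<bar>..-r+\<bar>s\<bar>} t + indicator {r-\<bar>s\<bar>..r+\<bar>s\<bar>} t) / (2 * r)" for t
  proof -
    have "norm (complex_of_real (box_density r (t - s)) - complex_of_real (box_density r t))
       = \<bar>indicator {-r..r} (t - s) - indicator {-r..r} t\<bar> / (2 * r)"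
      using r unfolding of_real_diff[symmetric] norm_of_real by (simp add: box_density_def abs_divide flip: diff_divide_distrib)
    also have "\<dots> \<le> (indicator {-r-\<bar>s\<bar>..-r+\<bar>s\<bar>} t + indicator {r-\<bar>s\<bar>..r+\<bar>s\<bar>} t) / (2 * r)"
      using r by (intro divide_right_mono) (auto simp: indicator_def)
    finally show ?thesis .
  qed
  then have "(LBINT t. norm (complex_of_real (box_density r (t - s)) - complex_of_real (box_density r t)))
    \<le> (LBINT t. (indicator {-r-\<bar>s\<bar>..-r+\<bar>s\<bar>} t + indicator {r-\<bar>s\<bar>..r+\<bar>s\<bar>} t) / (2 * r))"
    using box_density(1)[OF r] by (intro integral_mono) (auto simp: integrable_lborel_shift)
  also have "\<dots> = ((LBINT t. indicator {-r-\<bar>s\<bar>..-r+\<bar>s\<bar>} t) + (LBINT t. indicator {r-\<bar>s\<bar>..r+\<bar>s\<bar>} t)) / (2 * r)"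
    by (subst Bochner_Integration.integral_add[symmetric]) auto
  also have "\<dots> = 2 * \<bar>s\<bar> / r" using r by (simp add: field_simps)
  finally show ?thesis .
qed

lemma convolve_box:
  fixes u :: "real \<Rightarrow> complex"
  assumes u: "integrable lborel u" and r: "0 < r"
  shows "convolve u (\<lambda>x. of_real (box_density r x)) x = (LBINT s. box_density r s * u (x - s))"
proof -
  note [measurable] = box_density(4)[OF r]
  have [measurable]: "u \<in> borel_measurable borel" using u by auto
  have "convolve u (\<lambda>x. of_real (box_density r x)) x = (LBINT y. u y * of_real (box_density r (x - y)))"
    unfolding convolve_def by (simp add: integral_completion)
  also have "\<dots> = (LBINT s. box_density r s * u (x - s))"
    using integral_lborel_shift(4)[of "\<lambda>y. u y * of_real (box_density r (x - y))" x] by (simp add: mult.commute)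
  finally show ?thesis .
qed

lemma box_average_integrable:
  fixes u :: "real \<Rightarrow> complex"
  assumes u: "integrable lborel u" and r: "0 < r"
  shows "integrable lborel (\<lambda>s. complex_of_real (box_density r s) * u (x - s))"
proof (rule Bochner_Integration.integrable_bound)
  note [measurable] = box_density(4)[OF r]
  have [measurable]: "u \<in> borel_measurable borel" using u by auto
  show "(\<lambda>s. complex_of_real (box_density r s) * u (x - s)) \<in> borel_measurable lborel" by measurable
  show "integrable lborel (\<lambda>s. 1 / (2 * r) * norm (u (x - s)))"
    using u by (intro integrable_mult_right integrable_norm) (simp add: integrable_lborel_shift)
  show "AE s in lborel. norm (complex_of_real (box_density r s) * u (x - s)) \<le> norm (1 / (2 * r) * norm (u (x - s)))"
  proof (intro AE_I2)
    fix s
    have "norm (complex_of_real (box_density r s) * u (x - s)) = box_density r s * norm (u (x - s))"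
      using box_density(2)[OF r] by (simp add: norm_mult)
    also have "\<dots> \<le> 1 / (2 * r) * norm (u (x - s))"
      by (intro mult_right_mono box_density(5)[OF r]) auto
    finally show "norm (complex_of_real (box_density r s) * u (x - s)) \<le> norm (1 / (2 * r) * norm (u (x - s)))"
      using r by simp
  qed
qed

context
  fixes a \<epsilon> :: real and W :: "real set" and n :: nat
  assumes a: "0 < a" and W: "W = {-a..a}" and \<epsilon>: "0 < \<epsilon>" "\<epsilon> < 1" and n: "0 < n"
begin

private abbreviation "q \<equiv> \<epsilon> ^ n"

lemma ratio_bounds: "0 < q" "q < 1"
  using \<epsilon> n by (auto simp: power_Suc_less_one power_less_one_iff)

text \<open>All factors are centred boxes, with half-lengths in geometric progression of ratio
  \<open>\<epsilon> ^ n\<close>. The shrinking by \<open>1 - \<epsilon> ^ n\<close> is chosen so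
  that the half-lengths add up to \<open>a\<close>.\<close>

lemma psi_factor_eq: "psi_factor W \<epsilon> n s = (\<lambda>x. of_real (box_density (q ^ s * ((1 - q) * a)) x))"
proof -
  have im: "(\<lambda>x. c * x) ` {-r..r} = {- (c * r)..c * r}" if "0 < c" for c r :: real
    using that by (subst image_mult_atLeastAtMost_if) auto
  have pos: "0 < q ^ s * ((1 - q) * a)" using ratio_bounds a by simp
  show ?thesis
    unfolding psi_factor_def normalized_indicator_def shrunk_window_def W box_density_def
    using ratio_bounds a pos by (subst im, simp, subst im, simp) (auto simp: power_mult fun_eq_iff)
qed

text \<open>The translation modulus of the widest box is inherited by all further products, because
  averaging commutes with translation and does not increase the L1 norm.\<close>

lemma psi_partial_props:
  "integrable lborel (psi_partial W \<epsilon> n N) \<and>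
   (\<forall>s. (LBINT t. norm (psi_partial W \<epsilon> n N (t - s) - psi_partial W \<epsilon> n N t)) \<le> 2 * \<bar>s\<bar> / ((1 - q) * a))"
proof (induction N)
  case 0
  have "0 < (1 - q) * a" using ratio_bounds a by simp
  from box_density(1)[OF this] box_density_translation[OF this] show ?case
    by (simp add: psi_factor_eq)
next
  case (Suc N)
  define r where "r = q ^ Suc N * ((1 - q) * a)"
  have r: "0 < r" using ratio_bounds a by (simp add: r_def)
  let ?p = "psi_partial W \<epsilon> n N"
  have p: "integrable lborel ?p" using Suc by blast
  have eq: "psi_partial W \<epsilon> n (Suc N) = (\<lambda>x. \<integral>s. box_density r s * ?p (x - s) \<partial>lborel)"
    by (rule ext) (simp only: psi_partial.simps psi_factor_eq r_def[symmetric] convolve_box[OF p r])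
  have i: "integrable lborel (\<lambda>x. \<integral>s. box_density r s * ?p (x - s) \<partial>lborel)"
    by (rule L1_dist_average_le(1)[where e="2 * r / ((1 - q) * a)"])
      (use p box_density[OF r] Suc ratio_bounds a in \<open>auto intro!: order_trans[OF _ divide_right_mono[OF mult_left_mono[OF box_density(6)[OF r]]]]\<close>)
  have "(LBINT t. norm ((LBINT \<sigma>. box_density r \<sigma> * ?p (t - s - \<sigma>)) - (LBINT \<sigma>. box_density r \<sigma> * ?p (t - \<sigma>))))
     \<le> 2 * \<bar>s\<bar> / ((1 - q) * a)" for s
  proof -
    let ?u = "\<lambda>t. ?p (t - s) - ?p t"
    have u: "integrable lborel ?u" using p by (simp add: integrable_lborel_shift)
    have "(LBINT \<sigma>. box_density r \<sigma> * ?p (t - s - \<sigma>)) - (LBINT \<sigma>. box_density r \<sigma> * ?p (t - \<sigma>))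
      = (LBINT \<sigma>. box_density r \<sigma> * ?u (t - \<sigma>))" for t
      by (subst Bochner_Integration.integral_diff[symmetric, OF box_average_integrable[OF p r] box_average_integrable[OF p r]])
        (simp add: right_diff_distrib algebra_simps)
    then have "(LBINT t. norm ((LBINT \<sigma>. box_density r \<sigma> * ?p (t - s - \<sigma>)) - (LBINT \<sigma>. box_density r \<sigma> * ?p (t - \<sigma>))))
      = (LBINT t. norm (LBINT \<sigma>. box_density r \<sigma> * ?u (t - \<sigma>)))" by simp
    also have "\<dots> \<le> (LBINT t. norm (?u t))"
      by (rule L1_average_norm_le[OF u box_density(1-3)[OF r]])
    also have "\<dots> \<le> 2 * \<bar>s\<bar> / ((1 - q) * a)" using Suc by blast
    finally show ?thesis .
  qed
  then show ?case unfolding eq using i by simp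
qed

text \<open>The limits are controlled in \<open>L\<^sup>1\<close> only; the product formula with \<open>sinc\<close> factors is never needed.\<close>

lemma psi_partial_step:
  "(LBINT t. norm (psi_partial W \<epsilon> n (Suc N) t - psi_partial W \<epsilon> n N t)) \<le> 2 * q ^ Suc N"
proof -
  define r where "r = q ^ Suc N * ((1 - q) * a)"
  have r: "0 < r" using ratio_bounds a by (simp add: r_def)
  let ?p = "psi_partial W \<epsilon> n N"
  have p: "integrable lborel ?p" using psi_partial_props by blast
  have eq: "psi_partial W \<epsilon> n (Suc N) = (\<lambda>x. \<integral>s. box_density r s * ?p (x - s) \<partial>lborel)"
    by (rule ext) (simp only: psi_partial.simps psi_factor_eq r_def[symmetric] convolve_box[OF p r])
  show ?thesis unfolding eq
  proof (rule L1_dist_average_le(2)[OF p box_density(1-3)[OF r]])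
    fix s assume "box_density r s \<noteq> 0"
    then have s: "\<bar>s\<bar> \<le> r" by (rule box_density(6)[OF r])
    have "(LBINT x. norm (?p (x - s) - ?p x)) \<le> 2 * \<bar>s\<bar> / ((1 - q) * a)" using psi_partial_props by blast
    also have "\<dots> \<le> 2 * r / ((1 - q) * a)" using s ratio_bounds a by (intro divide_right_mono) auto
    also have "\<dots> = 2 * q ^ Suc N" using ratio_bounds a by (simp add: r_def)
    finally show "(LBINT x. norm (?p (x - s) - ?p x)) \<le> 2 * q ^ Suc N" .
  qed
qed

lemma integral_norm_lebesgue:
  fixes u v :: "real \<Rightarrow> complex"
  assumes "integrable lborel u" "integrable lborel v"
  shows "(\<integral>t. norm (u t - v t) \<partial>lebesgue) = (LBINT t. norm (u t - v t))"
proof -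
  have [measurable]: "u \<in> borel_measurable borel" "v \<in> borel_measurable borel" using assms by auto
  show ?thesis by (intro integral_completion) measurable
qed

text \<open>The choice in \<open>psi\<close> carries information only after some L1 limit has been
  exhibited. Any limit then lies within the geometric series \<open>2 * q ^ Suc i\<close> of the
  first factor, whose sum is \<open>2 * q / (1 - q)\<close>.\<close>

lemma psi_props:
  "integrable lebesgue (psi W \<epsilon> n)"
  "(\<integral>x. norm (psi_partial W \<epsilon> n 0 x - psi W \<epsilon> n x) \<partial>lebesgue) \<le> 2 * q / (1 - q)"
proof -
  let ?p = "psi_partial W \<epsilon> n"
  have p: "integrable lborel (?p N)" for N using psi_partial_props by blast
  then have pm: "?p N \<in> borel_measurable borel" for N by auto
  have pl: "integrable lebesgue (?p N)" for N using p[of N] pm[of N] by (simp add: integrable_completion)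
  have geo: "(\<lambda>N. 2 * q ^ Suc N) sums (2 * (q * (1 / (1 - q))))"
    using sums_mult[OF sums_mult[OF geometric_sums[of q], of q], of 2] ratio_bounds by simp
  obtain g where "integrable lborel g" "(\<lambda>N. \<integral>x. norm (?p N x - g x) \<partial>lborel) \<longlonglongrightarrow> 0"
    using L1_limit_exists[OF p psi_partial_step sums_summable[OF geo]] by blast
  then have "\<exists>\<psi>. integrable lebesgue \<psi> \<and> (\<lambda>N. \<integral>x. norm (?p N x - \<psi> x) \<partial>lebesgue) \<longlonglongrightarrow> 0"
    using integral_norm_lebesgue[OF p] by (intro exI[of _ g]) (auto simp: integrable_completion)
  from someI_ex[OF this] have i: "integrable lebesgue (psi W \<epsilon> n)"
    and lim: "(\<lambda>N. \<integral>x. norm (?p N x - psi W \<epsilon> n x) \<partial>lebesgue) \<longlonglongrightarrow> 0"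
    unfolding psi_def by auto
  show "integrable lebesgue (psi W \<epsilon> n)" by (fact i)
  have "(\<integral>x. norm (?p 0 x - psi W \<epsilon> n x) \<partial>lebesgue) \<le> 2 * q / (1 - q) + (\<integral>x. norm (?p N x - psi W \<epsilon> n x) \<partial>lebesgue)" for N
  proof -
    have "(\<integral>x. norm (?p 0 x - psi W \<epsilon> n x) \<partial>lebesgue)
      \<le> (\<integral>x. norm (?p 0 x - ?p N x) \<partial>lebesgue) + (\<integral>x. norm (?p N x - psi W \<epsilon> n x) \<partial>lebesgue)"
      by (rule L1_dist_triangle) (intro pl i)+
    also have "(\<integral>x. norm (?p 0 x - ?p N x) \<partial>lebesgue) = (LBINT x. norm (?p N x - ?p 0 x))"
      unfolding integral_norm_lebesgue[OF p p] by (intro Bochner_Integration.integral_cong norm_minus_commute refl)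
    also have "\<dots> \<le> (\<Sum>i=0..<N. 2 * q ^ Suc i)"
      by (rule L1_dist_sum_le[where f="?p" and c="\<lambda>i. 2 * q ^ Suc i", OF p psi_partial_step]) simp
    also have "\<dots> \<le> 2 * (q * (1 / (1 - q)))"
      using sum_le_suminf[OF sums_summable[OF geo], of "{0..<N}"] ratio_bounds sums_unique[OF geo] by auto
    finally show ?thesis by simp
  qed
  moreover have "(\<lambda>N. 2 * q / (1 - q) + (\<integral>x. norm (?p N x - psi W \<epsilon> n x) \<partial>lebesgue)) \<longlonglongrightarrow> 2 * q / (1 - q) + 0"
    by (intro tendsto_intros lim)
  ultimately show "(\<integral>x. norm (?p 0 x - psi W \<epsilon> n x) \<partial>lebesgue) \<le> 2 * q / (1 - q)"
    using LIMSEQ_le_const by fastforce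
qed

lemma normalized_indicator_eq: "normalized_indicator W = (\<lambda>x. of_real (box_density a x))"
  using a by (auto simp: normalized_indicator_def box_density_def W fun_eq_iff)

lemma fourier_psi_diff:
  "norm (fourier (psi W \<epsilon> n) t - fourier (normalized_indicator W) t) \<le> 2 * q / (1 - q) + 2 * q"
proof -
  let ?p = "psi_partial W \<epsilon> n 0"
  define r where "r = (1 - q) * a"
  have r: "0 < r" "r \<le> a" using ratio_bounds a by (auto simp: r_def mult_le_cancel_right1)
  have p: "?p = (\<lambda>x. of_real (box_density r x))" by (simp add: psi_factor_eq r_def)
  have ip: "integrable lborel ?p" using psi_partial_props by blast
  have ia: "integrable lborel (normalized_indicator W)" using box_density(1)[OF a] by (simp add: normalized_indicator_eq)
  have ipl: "integrable lebesgue ?p" using ip by (subst integrable_completion) auto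
  have ial: "integrable lebesgue (normalized_indicator W)" using ia by (subst integrable_completion) auto
  have "norm (fourier (psi W \<epsilon> n) t - fourier (normalized_indicator W) t)
     \<le> norm (fourier ?p t - fourier (psi W \<epsilon> n) t) + norm (fourier ?p t - fourier (normalized_indicator W) t)"
    by (metis norm_minus_commute norm_triangle_sub norm_diff_triangle_le order_refl)
  also have "norm (fourier ?p t - fourier (psi W \<epsilon> n) t) \<le> 2 * q / (1 - q)"
    using fourier_diff_le[OF ipl psi_props(1)] psi_props(2) by (rule order_trans)
  also have "norm (fourier ?p t - fourier (normalized_indicator W) t) \<le> (LBINT x. norm (?p x - normalized_indicator W x))"
    using fourier_diff_le[OF ipl ial] integral_norm_lebesgue[OF ip ia] by simp
  \<comment> \<open>The narrower box is higher inside and vanishes on the rest of the window, where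
    the difference is \<open>- 1 / (2 * a)\<close>. Adding \<open>1 / a\<close> there flips the sign
    to the absolute value, while the difference itself integrates to 0.\<close>
  also have "\<dots> = (LBINT x. (box_density r x - box_density a x) + (1 / a) * (indicator {-a..a} x - indicator {-r..r} x))"
  proof (rule Bochner_Integration.integral_cong[OF refl])
    fix x
    have ar: "1 / (2 * a) \<le> 1 / (2 * r)" using r a by (intro divide_left_mono) auto
    have "norm (?p x - normalized_indicator W x) = \<bar>box_density r x - box_density a x\<bar>"
      unfolding p normalized_indicator_eq by (simp flip: of_real_diff)
    also have "\<dots> = (box_density r x - box_density a x) + (1 / a) * (indicator {-a..a} x - indicator {-r..r} x)"
      using ar r a by (auto simp: box_density_def indicator_def)
    finally show "norm (?p x - normalized_indicator W x) = (box_density r x - box_density a x) + (1 / a) * (indicator {-a..a} x - indicator {-r..r} x)" .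
  qed
  also have "\<dots> = (1 / a) * (2 * a - 2 * r)"
    using box_density[OF r(1)] box_density[OF a] r a by simp
  also have "\<dots> = 2 * q" using a by (simp add: r_def field_simps)
  finally show ?thesis by simp
qed

end

lemma Psi_eq:
  assumes a: "0 < a" and W: "W = {-a..a}" and \<epsilon>: "0 < \<epsilon>" "\<epsilon> < 1"
  shows "Psi W \<epsilon> = fourier (normalized_indicator W)"
proof -
  let ?F = "fourier (normalized_indicator W)"
  have ul: "uniform_limit UNIV (\<lambda>n. fourier (psi W \<epsilon> n)) ?F sequentially"
  proof (rule uniform_limitI)
    fix e :: real assume "0 < e"
    have "(\<lambda>n. 2 * \<epsilon> ^ n / (1 - \<epsilon> ^ n) + 2 * \<epsilon> ^ n) \<longlonglongrightarrow> 2 * 0 / (1 - 0) + 2 * 0"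
      using \<epsilon> by (intro tendsto_intros LIMSEQ_power_zero) auto
    then have "\<forall>\<^sub>F n in sequentially. 2 * \<epsilon> ^ n / (1 - \<epsilon> ^ n) + 2 * \<epsilon> ^ n < e"
      using \<open>0 < e\<close> by (intro order_tendstoD) auto
    then show "\<forall>\<^sub>F n in sequentially. \<forall>t\<in>UNIV. dist (fourier (psi W \<epsilon> n) t) (?F t) < e"
      \<comment> \<open>Index 0 must be dropped: there the shrunk window is a point and the ratio
        \<open>\<epsilon> ^ n\<close> is 1.\<close>
      using eventually_gt_at_top[of 0]
    proof eventually_elim
      case (elim n)
      then show ?case
        using le_less_trans[OF fourier_psi_diff[OF a W \<epsilon> elim(2)] elim(1)] by (auto simp: dist_norm)
    qed
  qed
  show ?thesis unfolding Psi_def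
  proof (rule the_equality, rule ul)
    fix F assume F: "uniform_limit UNIV (\<lambda>n. fourier (psi W \<epsilon> n)) F sequentially"
    show "F = ?F"
    proof
      fix t
      show "F t = ?F t"
        by (rule LIMSEQ_unique[OF tendsto_uniform_limitI[OF F UNIV_I] tendsto_uniform_limitI[OF ul UNIV_I]])
    qed
  qed
qed

text \<open>Plancherel takes the place of a convolution theorem: a reflected and shifted transform
  of the box is the conjugate transform of a modulated box, so the convolution integrates the
  squared box against a character. The square is the box divided by \<open>2 * a\<close>, so \<Phi>
  coincides with \<Psi>.\<close>

lemma Phi_eq:
  assumes a: "0 < a" and W: "W = {-a..a}" and \<epsilon>: "0 < \<epsilon>" "\<epsilon> < 1"
  shows "Phi W \<epsilon> t = (LBINT s. indicator W s *\<^sub>R ee (- (s * t))) / of_real (2 * a)"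
proof -
  let ?b = "\<lambda>x. complex_of_real (box_density a x)"
  have bi: "integrable lborel ?b" using box_density(1)[OF a] by simp
  note [measurable] = box_density(4)[OF a]
  have nb: "normalized_indicator W = ?b"
    using a by (auto simp: normalized_indicator_def box_density_def W fun_eq_iff)
  have F: "fourier ?b t = (LBINT s. ?b s * ee (- (s * t)))" for t
    by (simp add: fourier_lborel)
  let ?v = "\<lambda>s. ?b s * ee (s * t)"
  have vm: "?v \<in> borel_measurable borel" by measurable
  have vi: "integrable lborel ?v" by (rule integrable_mult_ee[OF bi]) measurable
  have bb: "norm (?b s) \<le> 1 / (2 * a)" "norm (?v s) \<le> 1 / (2 * a)" for s
    using box_density(2,5)[OF a, of s] by (auto simp: norm_mult)
  have Ft: "fourier ?b (t - y) = cnj (fourier ?v y)" for y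
  proof -
    have "cnj (fourier ?v y) = (LBINT s. cnj (?v s * ee (- (s * y))))"
      by (simp only: fourier_lborel[OF vm] Bochner_Integration.integral_cnj inner_real_def)
    also have "\<dots> = fourier ?b (t - y)"
      unfolding F by (intro Bochner_Integration.integral_cong)
        (auto simp: right_diff_distrib ee_diff ee_minus ee_add)
    finally show ?thesis by simp
  qed
  have "convolve (Psi W \<epsilon>) (Psi W \<epsilon>) t = (LBINT y. fourier ?b y * fourier ?b (t - y))"
    unfolding convolve_def Psi_eq[OF assms] nb by (rule integral_completion) measurable
  also have "\<dots> = (LBINT s. ?b s * cnj (?v s))"
    unfolding Ft by (rule plancherel[OF bi bb(1) vi bb(2)])
  also have "\<dots> = (LBINT s. indicator W s *\<^sub>R ee (- (s * t)) / (of_real (2 * a))\<^sup>2)"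
    using a by (intro Bochner_Integration.integral_cong) (auto simp: box_density_def W indicator_def ee_minus power2_eq_square)
  also have "\<dots> = (LBINT s. indicator W s *\<^sub>R ee (- (s * t))) / (of_real (2 * a))\<^sup>2" by simp
  finally show ?thesis
    unfolding Phi_def using a by (simp add: W power2_eq_square)
qed

section \<open>Counting lattice points by volume\<close>

context lattice_basis
begin

lemma integral_cell_shift:
  "integrable lborel (\<lambda>z. indicator cell (z - \<gamma>) :: real)" "(LBINT z. indicator cell (z - \<gamma>)) = covol"
proof -
  have "integrable lborel (indicator cell :: 'a \<Rightarrow> real)"
    using cell_emeasure by (intro integrable_real_indicator) auto
  then show "integrable lborel (\<lambda>z. indicator cell (z - \<gamma>) :: real)" by (subst integrable_lborel_shift)
  show "(LBINT z. indicator cell (z - \<gamma>)) = covol"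
    unfolding integral_lborel_shift(2)[of "indicator cell :: 'a \<Rightarrow> real"] covol_def by simp
qed

text \<open>Attach to each counted point its translate of the cell. These translates are disjoint
  and lie in \<open>T\<close>, so their total volume is at most that of \<open>T\<close>;
  \<open>count_ge\<close> uses that they cover.\<close>

lemma count_le:
  assumes S: "finite (\<Gamma> \<inter> S)" and T: "T \<in> sets borel" "emeasure lborel T < \<infinity>"
    and sub: "\<And>\<gamma> z. \<gamma> \<in> \<Gamma> \<inter> S \<Longrightarrow> z - \<gamma> \<in> cell \<Longrightarrow> z \<in> T"
  shows "card (\<Gamma> \<inter> S) * covol \<le> measure lborel T"
proof -
  have "(\<Sum>\<gamma>\<in>\<Gamma> \<inter> S. indicator cell (z - \<gamma>)) \<le> (indicator T z :: real)" for z
  proof (cases "z \<in> T")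
    case True
    have "(\<Sum>\<gamma>\<in>\<Gamma> \<inter> S. indicator cell (z - \<gamma>) *\<^sub>R (1::real)) \<le> 1"
      by (rule finite_sum_le_has_sum[OF sum_cell_translates_minus S]) auto
    then show ?thesis using True by simp
  next
    case False
    then have "(\<Sum>\<gamma>\<in>\<Gamma> \<inter> S. indicator cell (z - \<gamma>)) = (0::real)"
      using sub by (intro sum.neutral) (auto simp: indicator_def)
    then show ?thesis by simp
  qed
  then have "(LBINT z. (\<Sum>\<gamma>\<in>\<Gamma> \<inter> S. indicator cell (z - \<gamma>) :: real)) \<le> (LBINT z. indicator T z)"
    using T by (intro integral_mono) (auto intro!: integral_cell_shift integrable_real_indicator)
  then show ?thesis using T integral_cell_shift by (simp add: Bochner_Integration.integral_sum)
qed

lemma count_ge: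
  assumes S: "finite (\<Gamma> \<inter> S)" and T: "T \<in> sets borel" "emeasure lborel T < \<infinity>"
    and sub: "\<And>\<gamma> z. z \<in> T \<Longrightarrow> \<gamma> \<in> \<Gamma> \<Longrightarrow> z - \<gamma> \<in> cell \<Longrightarrow> \<gamma> \<in> S"
  shows "measure lborel T \<le> card (\<Gamma> \<inter> S) * covol"
proof -
  have "(indicator T z :: real) \<le> (\<Sum>\<gamma>\<in>\<Gamma> \<inter> S. indicator cell (z - \<gamma>))" for z
  proof (cases "z \<in> T")
    case True
    obtain \<gamma> where \<gamma>: "\<gamma> \<in> \<Gamma>" "z - \<gamma> \<in> cell" by (rule cell_cover)
    then have "\<gamma> \<in> \<Gamma> \<inter> S" using sub True by auto
    then have "indicator cell (z - \<gamma>) \<le> (\<Sum>\<gamma>\<in>\<Gamma> \<inter> S. indicator cell (z - \<gamma>) :: real)"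
      using S by (intro member_le_sum) auto
    then show ?thesis using True \<gamma> by simp
  qed (auto intro: sum_nonneg)
  then have "(LBINT z. indicator T z) \<le> (LBINT z. (\<Sum>\<gamma>\<in>\<Gamma> \<inter> S. indicator cell (z - \<gamma>) :: real))"
    using T by (intro integral_mono) (auto intro!: integral_cell_shift integrable_real_indicator)
  then show ?thesis using T integral_cell_shift by (simp add: Bochner_Integration.integral_sum)
qed

end

subsection \<open>The density of a model set\<close>

definition slab :: "real^'m \<Rightarrow> real \<Rightarrow> real \<Rightarrow> real \<Rightarrow> ((real^'m) \<times> real) set" where
  "slab x R c d = {z. (\<forall>i. x $ i \<le> fst z $ i \<and> fst z $ i \<le> x $ i + R) \<and> c \<le> snd z \<and> snd z \<le> d}"

lemma slab_cbox: "slab x R c d = cbox (x, c) (x + (\<chi> i. R), d)"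
  by (auto simp: slab_def cbox_Pair_eq mem_box_cart)

lemma slab_measure:
  assumes "0 \<le> R" "c \<le> d"
  shows "measure lborel (slab x R c d :: ((real^'m) \<times> real) set) = R ^ CARD('m) * (d - c)"
proof -
  have "cbox x (x + (\<chi> i. R)) \<noteq> {}" using assms by (auto simp: interval_ne_empty_cart)
  then show ?thesis
    unfolding slab_cbox using assms by (simp add: content_Pair content_cbox_cart)
qed

lemma slab_borel: "slab x R c d \<in> sets borel"
  and slab_finite: "emeasure lborel (slab x R c d) < \<infinity>"
  unfolding slab_cbox by (simp, rule emeasure_bounded_finite[OF bounded_cbox])

locale cut_project = lattice_basis \<Gamma> B \<beta>
  for \<Gamma> :: "((real^'m) \<times> real) set" and B \<beta> +
  assumes inj_fst: "inj_on fst \<Gamma>" and dense_snd: "closure (snd ` \<Gamma>) = UNIV"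
begin

text \<open>The form in which density of the second projection is used: windows can be moved by
  lattice vectors by almost any prescribed amount.\<close>

lemma lattice_between:
  assumes "u < v"
  obtains \<gamma> where "\<gamma> \<in> \<Gamma>" "u < snd \<gamma>" "snd \<gamma> < v"
proof -
  have "(u + v) / 2 \<in> closure (snd ` \<Gamma>)" using dense_snd by simp
  then obtain \<gamma> where "\<gamma> \<in> \<Gamma>" "dist (snd \<gamma>) ((u + v) / 2) < (v - u) / 2"
    unfolding closure_approachable using assms by (metis (no_types, lifting) diff_gt_0_iff_gt half_gt_zero imageE)
  then show thesis using that[of \<gamma>] by (auto simp: dist_real_def abs_less_iff field_simps)
qed

definition cnt :: "real^'m \<Rightarrow> real \<Rightarrow> real \<Rightarrow> real \<Rightarrow> nat" where
  "cnt x R c d = card (\<Gamma> \<inter> slab x R c d)"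

lemma cnt_finite: "finite (\<Gamma> \<inter> slab x R c d)"
  by (rule lattice_finite_bounded) (simp add: slab_cbox bounded_cbox)

lemma fst_coord_le: "\<bar>fst z $ i\<bar> \<le> norm z" and snd_le: "\<bar>snd z\<bar> \<le> norm z" for z :: "(real^'m) \<times> real"
  by (auto intro: order_trans[OF component_le_norm_cart norm_fst_le[of "fst z" "snd z", simplified]]
    order_trans[OF _ norm_snd_le[of "snd z" "fst z", simplified]])

lemma cell_coords:
  assumes "z - \<gamma> \<in> cell"
  shows "\<bar>fst z $ i - fst \<gamma> $ i\<bar> \<le> radius" "\<bar>snd z - snd \<gamma>\<bar> \<le> radius"
  using order_trans[OF fst_coord_le[of "z - \<gamma>" i] cell_norm[OF assms]]
    order_trans[OF snd_le[of "z - \<gamma>"] cell_norm[OF assms]] by simp_all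

lemma cnt_upper:
  assumes "0 \<le> R" "c \<le> d"
  shows "cnt x R c d * covol \<le> (R + 2 * radius) ^ CARD('m) * (d - c + 2 * radius)"
proof -
  have "cnt x R c d * covol \<le> measure lborel (slab (x - (\<chi> i. radius)) (R + 2 * radius) (c - radius) (d + radius))"
    unfolding cnt_def
  proof (rule count_le[OF cnt_finite])
    fix \<gamma> z assume "\<gamma> \<in> \<Gamma> \<inter> slab x R c d" and z: "z - \<gamma> \<in> cell"
    then show "z \<in> slab (x - (\<chi> i. radius)) (R + 2 * radius) (c - radius) (d + radius)"
      using cell_coords[OF z] unfolding slab_def by (auto simp: abs_le_iff) (smt (verit))+
  qed (use slab_borel slab_finite in auto)
  then show ?thesis
    using assms radius_nonneg by (subst (asm) slab_measure) (auto simp: add.commute)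
qed

lemma cnt_lower:
  assumes "2 * radius \<le> R" "2 * radius \<le> d - c"
  shows "(R - 2 * radius) ^ CARD('m) * (d - c - 2 * radius) \<le> cnt x R c d * covol"
proof -
  have "measure lborel (slab (x + (\<chi> i. radius)) (R - 2 * radius) (c + radius) (d - radius)) \<le> cnt x R c d * covol"
    unfolding cnt_def
  proof (rule count_ge[OF cnt_finite])
    fix \<gamma> z assume "z \<in> slab (x + (\<chi> i. radius)) (R - 2 * radius) (c + radius) (d - radius)" and z: "z - \<gamma> \<in> cell"
    then show "\<gamma> \<in> slab x R c d"
      using cell_coords[OF z] unfolding slab_def by (auto simp: abs_le_iff) (smt (verit))+
  qed (use slab_borel slab_finite in auto)
  then show ?thesis
    using assms radius_nonneg by (subst (asm) slab_measure) (auto simp: add.commute)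
qed

text \<open>A lattice translation preserves the point set, so a window moved by
  \<open>snd \<gamma>\<close> can be brought back at the price of moving the cube by
  \<open>fst \<gamma>\<close>, which an enlargement by \<delta> on each side absorbs.\<close>

lemma cnt_shift:
  assumes \<gamma>: "\<gamma> \<in> \<Gamma>" and \<delta>: "norm (fst \<gamma>) \<le> \<delta>"
  shows "cnt x R (c + snd \<gamma>) (d + snd \<gamma>) \<le> cnt (x - (\<chi> i. \<delta>)) (R + 2 * \<delta>) c d"
  unfolding cnt_def
proof (rule card_inj_on_le[where f="\<lambda>z. z - \<gamma>"])
  have "\<bar>fst \<gamma> $ i\<bar> \<le> \<delta>" for i using component_le_norm_cart[of "fst \<gamma>" i] \<delta> by linarith
  then show "(\<lambda>z. z - \<gamma>) ` (\<Gamma> \<inter> slab x R (c + snd \<gamma>) (d + snd \<gamma>)) \<subseteq> \<Gamma> \<inter> slab (x - (\<chi> i. \<delta>)) (R + 2 * \<delta>) c d"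
    using lattice_diff[OF _ \<gamma>] by (auto simp: slab_def abs_le_iff) (smt (verit))+
qed (auto simp: inj_on_def cnt_finite)

lemma norm_fst_scale_le: "j \<le> K \<Longrightarrow> norm (fst (of_nat j *\<^sub>R \<gamma>)) \<le> real K * norm (fst \<gamma>)"
  by (auto intro: mult_right_mono)

text \<open>Translating the window by multiples of one lattice vector changes the count only by a boundary
  effect. Translates with step slightly below (above) the length of the window cover (are disjoint in)
  a long interval, where the lattice points are counted by volume.\<close>

lemma cnt_window_lower:
  assumes \<gamma>: "\<gamma> \<in> \<Gamma>" and \<tau>: "0 < snd \<gamma>" "snd \<gamma> \<le> 2 * a" and K: "0 < K" "2 * radius \<le> K * snd \<gamma>"
    and \<delta>: "\<delta> = real K * norm (fst \<gamma>)" and R: "2 * \<delta> + 2 * radius \<le> R"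
  shows "(R - 2 * \<delta> - 2 * radius) ^ CARD('m) * (K * snd \<gamma> - 2 * radius) \<le> K * cnt x R (-a) a * covol"
proof -
  let ?\<tau> = "snd \<gamma>"
  let ?x = "x + (\<chi> i. \<delta>)" and ?R = "R - 2 * \<delta>"
  have "(?R - 2 * radius) ^ CARD('m) * ((-a + K * ?\<tau>) - (-a) - 2 * radius) \<le> cnt ?x ?R (-a) (-a + K * ?\<tau>) * covol"
    by (rule cnt_lower) (use K R in auto)
  also have "cnt ?x ?R (-a) (-a + K * ?\<tau>) \<le> (\<Sum>j<K. cnt ?x ?R (-a + j * ?\<tau>) (a + j * ?\<tau>))"
  proof -
    have "\<Gamma> \<inter> slab ?x ?R (-a) (-a + K * ?\<tau>) \<subseteq> (\<Union>j<K. \<Gamma> \<inter> slab ?x ?R (-a + j * ?\<tau>) (a + j * ?\<tau>))"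
    proof
      fix z assume z: "z \<in> \<Gamma> \<inter> slab ?x ?R (-a) (-a + K * ?\<tau>)"
      define s where "s = (snd z + a) / ?\<tau>"
      have s: "0 \<le> s" "s \<le> K" "snd z = -a + s * ?\<tau>" using z \<tau> by (auto simp: slab_def s_def field_simps)
      \<comment> \<open>The minimum handles the upper end: \<open>s = K\<close> would give index
        \<open>K\<close>, which is out of range, but that point still lies in the last translate
        because the step is at most \<open>2 * a\<close>.\<close>
      define j where "j = min (nat \<lfloor>s\<rfloor>) (K - 1)"
      have j: "j < K" "j \<le> s" "s \<le> j + 1"
        using s K unfolding j_def by (auto simp: min_def of_nat_diff) linarith+
      have "j * ?\<tau> \<le> s * ?\<tau>" "s * ?\<tau> \<le> (j + 1) * ?\<tau>" using j \<tau> by (auto intro!: mult_right_mono)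
      then have "-a + j * ?\<tau> \<le> snd z" "snd z \<le> a + j * ?\<tau>" using s(3) \<tau> by (auto simp: algebra_simps)
      then show "z \<in> (\<Union>j<K. \<Gamma> \<inter> slab ?x ?R (-a + j * ?\<tau>) (a + j * ?\<tau>))"
        using z j(1) by (auto simp: slab_def)
    qed
    then have "cnt ?x ?R (-a) (-a + K * ?\<tau>) \<le> card (\<Union>j<K. \<Gamma> \<inter> slab ?x ?R (-a + j * ?\<tau>) (a + j * ?\<tau>))"
      unfolding cnt_def by (intro card_mono finite_UN_I cnt_finite finite_lessThan)
    also have "\<dots> \<le> (\<Sum>j<K. cnt ?x ?R (-a + j * ?\<tau>) (a + j * ?\<tau>))"
      unfolding cnt_def by (rule card_UN_le) simp
    finally show ?thesis .
  qed
  also have "(\<Sum>j<K. cnt ?x ?R (-a + j * ?\<tau>) (a + j * ?\<tau>)) \<le> (\<Sum>j<K. cnt x R (-a) a)"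
  proof (rule sum_mono)
    fix j assume "j \<in> {..<K}"
    then have "norm (fst (of_nat j *\<^sub>R \<gamma>)) \<le> \<delta>" unfolding \<delta> by (intro norm_fst_scale_le) auto
    from cnt_shift[OF lattice_scale[OF \<gamma>] this, of ?x ?R "-a" a]
    show "cnt ?x ?R (-a + j * ?\<tau>) (a + j * ?\<tau>) \<le> cnt x R (-a) a" by simp
  qed
  finally show ?thesis using covol_pos by (simp add: mult_right_mono)
qed

lemma cnt_window_upper:
  assumes \<gamma>: "\<gamma> \<in> \<Gamma>" and \<tau>: "0 < a" "2 * a < snd \<gamma>"
    and \<delta>: "\<delta> = real K * norm (fst \<gamma>)" and R: "0 \<le> R"
  shows "K * cnt x R (-a) a * covol \<le> (R + 2 * \<delta> + 2 * radius) ^ CARD('m) * (K * snd \<gamma> + 2 * a + 2 * radius)"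
proof -
  let ?\<tau> = "snd \<gamma>"
  let ?x = "x - (\<chi> i. \<delta>)" and ?R = "R + 2 * \<delta>"
  have "\<delta> \<ge> 0" by (simp add: \<delta>)
  \<comment> \<open>The step exceeds the window length, so a translate with larger index lies
    strictly above every earlier one.\<close>
  have less: "False" if "i < j" "snd z \<le> a + i * ?\<tau>" "-a + j * ?\<tau> \<le> snd z" for i j :: nat and z :: "(real^'m) \<times> real"
  proof -
    have "real (i + 1) * ?\<tau> \<le> real j * ?\<tau>" using that(1) \<tau> by (intro mult_right_mono) auto
    with that \<tau> show False by (simp add: algebra_simps)
  qed
  have disj: "(\<Gamma> \<inter> slab ?x ?R (-a + i * ?\<tau>) (a + i * ?\<tau>)) \<inter> (\<Gamma> \<inter> slab ?x ?R (-a + j * ?\<tau>) (a + j * ?\<tau>)) = {}"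
    if "i \<noteq> j" for i j :: nat
  proof -
    have False if z: "z \<in> slab ?x ?R (-a + i * ?\<tau>) (a + i * ?\<tau>)" "z \<in> slab ?x ?R (-a + j * ?\<tau>) (a + j * ?\<tau>)" for z
      using less[of i j z] less[of j i z] z \<open>i \<noteq> j\<close> unfolding slab_def by (cases "i < j") auto
    then show ?thesis by blast
  qed
  have "(\<Sum>j<K. cnt x R (-a) a) \<le> (\<Sum>j<K. cnt ?x ?R (-a + j * ?\<tau>) (a + j * ?\<tau>))"
  proof (rule sum_mono)
    fix j assume "j \<in> {..<K}"
    then have "norm (fst (- (of_nat j *\<^sub>R \<gamma>))) \<le> \<delta>" unfolding \<delta> using norm_fst_scale_le[of j K \<gamma>] by auto
    from cnt_shift[OF lattice_minus[OF lattice_scale[OF \<gamma>]] this, of x R "-a + j * ?\<tau>" "a + j * ?\<tau>"]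
    show "cnt x R (-a) a \<le> cnt ?x ?R (-a + j * ?\<tau>) (a + j * ?\<tau>)" by simp
  qed
  also have "\<dots> = card (\<Union>j<K. \<Gamma> \<inter> slab ?x ?R (-a + j * ?\<tau>) (a + j * ?\<tau>))"
    unfolding cnt_def by (rule card_UN_disjoint[symmetric]) (use disj in \<open>auto simp: cnt_finite\<close>)
  also have "\<dots> \<le> cnt ?x ?R (-a) (a + K * ?\<tau>)"
    unfolding cnt_def
  proof (rule card_mono[OF cnt_finite], rule UN_least)
    fix j assume "j \<in> {..<K}"
    then have "j * ?\<tau> \<le> K * ?\<tau>" "0 \<le> j * ?\<tau>" using \<tau> by (auto intro!: mult_right_mono)
    then show "\<Gamma> \<inter> slab ?x ?R (-a + j * ?\<tau>) (a + j * ?\<tau>) \<subseteq> \<Gamma> \<inter> slab ?x ?R (-a) (a + K * ?\<tau>)"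
      by (auto simp: slab_def)
  qed
  finally have "K * cnt x R (-a) a \<le> cnt ?x ?R (-a) (a + K * ?\<tau>)" by simp
  then have "K * cnt x R (-a) a * covol \<le> cnt ?x ?R (-a) (a + K * ?\<tau>) * covol"
    using covol_pos by (intro mult_right_mono) (auto simp flip: of_nat_mult)
  also have "\<dots> \<le> (?R + 2 * radius) ^ CARD('m) * ((a + K * ?\<tau>) - (-a) + 2 * radius)"
    by (rule cnt_upper) (use R \<tau> \<open>\<delta> \<ge> 0\<close> in auto)
  finally show ?thesis by (simp add: algebra_simps)
qed

lemma tendsto_shift_power: "((\<lambda>R. ((R + c) / R) ^ n * e) \<longlongrightarrow> e) at_top" for c e :: real
proof -
  have "((\<lambda>R. (R + c) / R) \<longlongrightarrow> 1) at_top" by real_asymp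
  from tendsto_mult[OF tendsto_power[OF this] tendsto_const[of e]] show ?thesis by simp
qed

text \<open>Quantifiers in this order: a lattice vector whose step is between \<open>2 * a\<close>
  and \<open>D * covol\<close>, then \<open>K\<close> so large that the ends of the long interval
  are negligible, and only then \<open>R\<close>, since the boundary width \<delta> depends on
  \<open>K\<close> and the vector.\<close>

lemma cnt_tendsto:
  assumes a: "0 < a"
  shows "((\<lambda>R. cnt x R (-a) a / R ^ CARD('m)) \<longlongrightarrow> 2 * a / covol) at_top"
proof (rule order_tendstoI)
  fix D assume D: "D < 2 * a / covol"
  \<comment> \<open>The maximum with 0 forces a positive step even when \<open>D\<close> is
    negative.\<close>
  then have "max 0 (D * covol) < 2 * a" using a covol_pos by (simp add: field_simps)
  then obtain \<gamma> where \<gamma>: "\<gamma> \<in> \<Gamma>" "max 0 (D * covol) < snd \<gamma>" "snd \<gamma> < 2 * a" by (rule lattice_between)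
  have "(\<lambda>K. snd \<gamma> - 2 * radius * (1 / real K)) \<longlonglongrightarrow> snd \<gamma> - 2 * radius * 0"
    by (intro tendsto_intros lim_1_over_n)
  then have "\<forall>\<^sub>F K in sequentially. max 0 (D * covol) < snd \<gamma> - 2 * radius * (1 / real K)"
    using \<gamma> by (intro order_tendstoD) auto
  then obtain K where K: "0 < K" "max 0 (D * covol) < snd \<gamma> - 2 * radius * (1 / real K)"
    using eventually_happens'[OF _ eventually_conj[OF eventually_gt_at_top[of 0]]] by (metis (mono_tags, lifting) trivial_limit_sequentially)
  define L where "L = (snd \<gamma> - 2 * radius * (1 / real K)) / covol"
  have L: "D < L" using K covol_pos by (simp add: L_def field_simps)
  have K2: "2 * radius \<le> K * snd \<gamma>" using K by (simp add: field_simps)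
  define \<delta> where "\<delta> = real K * norm (fst \<gamma>)"
  have "\<forall>\<^sub>F R in at_top. D < ((R + - (2 * \<delta> + 2 * radius)) / R) ^ CARD('m) * L"
    by (rule order_tendstoD(1)[OF tendsto_shift_power L])
  then show "\<forall>\<^sub>F R in at_top. D < cnt x R (-a) a / R ^ CARD('m)"
    using eventually_ge_at_top[of "2 * \<delta> + 2 * radius"] eventually_gt_at_top[of 0]
  proof eventually_elim
    case (elim R)
    have "(R - 2 * \<delta> - 2 * radius) ^ CARD('m) * (K * snd \<gamma> - 2 * radius) \<le> K * cnt x R (-a) a * covol"
      by (rule cnt_window_lower[OF \<gamma>(1) _ _ K(1) K2 \<delta>_def]) (use \<gamma> elim in auto)
    moreover have eq: "K * snd \<gamma> - 2 * radius = L * (K * covol)"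
      using K covol_pos by (simp add: L_def field_simps)
    ultimately have "(R - 2 * \<delta> - 2 * radius) ^ CARD('m) * (L * (K * covol)) \<le> K * cnt x R (-a) a * covol"
      by (simp only: eq)
    then have "(R - 2 * \<delta> - 2 * radius) ^ CARD('m) * L * (K * covol) \<le> cnt x R (-a) a * (K * covol)"
      by (simp add: mult_ac)
    then have "(R - 2 * \<delta> - 2 * radius) ^ CARD('m) * L \<le> cnt x R (-a) a"
      by (rule mult_right_le_imp_le) (use K covol_pos in auto)
    then have "(R - 2 * \<delta> - 2 * radius) ^ CARD('m) * L / R ^ CARD('m) \<le> cnt x R (-a) a / R ^ CARD('m)"
      using elim by (intro divide_right_mono) auto
    then show ?case using elim(1) by (simp add: power_divide algebra_simps)
  qed
next
  fix D assume D: "2 * a / covol < D"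
  then have "2 * a < D * covol" using covol_pos by (simp add: field_simps)
  then obtain \<gamma> where \<gamma>: "\<gamma> \<in> \<Gamma>" "2 * a < snd \<gamma>" "snd \<gamma> < D * covol" by (rule lattice_between)
  have "(\<lambda>K. snd \<gamma> + (2 * a + 2 * radius) * (1 / real K)) \<longlonglongrightarrow> snd \<gamma> + (2 * a + 2 * radius) * 0"
    by (intro tendsto_intros lim_1_over_n)
  then have "\<forall>\<^sub>F K in sequentially. snd \<gamma> + (2 * a + 2 * radius) * (1 / real K) < D * covol"
    using \<gamma> by (intro order_tendstoD) auto
  then obtain K where K: "0 < K" "snd \<gamma> + (2 * a + 2 * radius) * (1 / real K) < D * covol"
    using eventually_happens'[OF _ eventually_conj[OF eventually_gt_at_top[of 0]]] by (metis (mono_tags, lifting) trivial_limit_sequentially)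
  define L where "L = (snd \<gamma> + (2 * a + 2 * radius) * (1 / real K)) / covol"
  have L: "L < D" using K covol_pos by (simp add: L_def field_simps)
  define \<delta> where "\<delta> = real K * norm (fst \<gamma>)"
  have "\<forall>\<^sub>F R in at_top. ((R + (2 * \<delta> + 2 * radius)) / R) ^ CARD('m) * L < D"
    by (rule order_tendstoD(2)[OF tendsto_shift_power L])
  then show "\<forall>\<^sub>F R in at_top. cnt x R (-a) a / R ^ CARD('m) < D"
    using eventually_gt_at_top[of 0]
  proof eventually_elim
    case (elim R)
    have "K * cnt x R (-a) a * covol \<le> (R + 2 * \<delta> + 2 * radius) ^ CARD('m) * (K * snd \<gamma> + 2 * a + 2 * radius)"
      by (rule cnt_window_upper[OF \<gamma>(1) a _ \<delta>_def]) (use \<gamma> elim in auto)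
    moreover have eq: "K * snd \<gamma> + 2 * a + 2 * radius = L * (K * covol)"
      using K covol_pos by (simp add: L_def field_simps)
    ultimately have "K * cnt x R (-a) a * covol \<le> (R + 2 * \<delta> + 2 * radius) ^ CARD('m) * (L * (K * covol))"
      by (simp only: eq)
    then have "cnt x R (-a) a * (K * covol) \<le> (R + 2 * \<delta> + 2 * radius) ^ CARD('m) * L * (K * covol)"
      by (simp add: mult_ac)
    then have "cnt x R (-a) a \<le> (R + 2 * \<delta> + 2 * radius) ^ CARD('m) * L"
      by (rule mult_right_le_imp_le) (use K covol_pos in auto)
    then have "cnt x R (-a) a / R ^ CARD('m) \<le> (R + 2 * \<delta> + 2 * radius) ^ CARD('m) * L / R ^ CARD('m)"
      using elim by (intro divide_right_mono) auto
    then show ?case using elim(1) by (simp add: power_divide algebra_simps)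
  qed
qed

text \<open>Injectivity of the first projection turns points of the model set in a cube into lattice
  points in a slab. The definite description is then resolved by uniqueness of limits.\<close>

theorem point_density_model_set:
  assumes a: "0 < a"
  shows "point_density (model_set \<Gamma> {-a..a}) = 2 * a / covol"
proof -
  have card: "card (model_set \<Gamma> {-a..a} \<inter> (\<lambda>y. x + R *\<^sub>R y) ` cbox 0 1) = cnt x R (-a) a" if "0 < R" for x :: "real^'m" and R
  proof -
    have im: "(\<lambda>y. x + R *\<^sub>R y) ` cbox 0 1 = {y. \<forall>i. x $ i \<le> y $ i \<and> y $ i \<le> x $ i + R}"
    proof (intro set_eqI iffI)
      fix y assume "y \<in> {y. \<forall>i. x $ i \<le> y $ i \<and> y $ i \<le> x $ i + R}"
      then have "y = x + R *\<^sub>R ((1 / R) *\<^sub>R (y - x))" "(1 / R) *\<^sub>R (y - x) \<in> cbox 0 1"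
        using \<open>0 < R\<close> by (auto simp: mem_box_cart field_simps)
      then show "y \<in> (\<lambda>y. x + R *\<^sub>R y) ` cbox 0 1" by blast
    next
      fix y assume "y \<in> (\<lambda>y. x + R *\<^sub>R y) ` cbox 0 1"
      then show "y \<in> {y. \<forall>i. x $ i \<le> y $ i \<and> y $ i \<le> x $ i + R}"
        using \<open>0 < R\<close> by (auto simp: mem_box_cart)
    qed
    have "model_set \<Gamma> {-a..a} \<inter> (\<lambda>y. x + R *\<^sub>R y) ` cbox 0 1 = fst ` (\<Gamma> \<inter> slab x R (-a) a)"
      unfolding im by (auto simp: model_set_def slab_def)
    then show ?thesis
      unfolding cnt_def by (simp add: card_image inj_on_subset[OF inj_fst])
  qed
  have lim: "((\<lambda>R. real (card (model_set \<Gamma> {-a..a} \<inter> (\<lambda>y. x + R *\<^sub>R y) ` cbox 0 1)) / R ^ CARD('m)) \<longlongrightarrow> 2 * a / covol) at_top" for x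
    by (rule Lim_transform_eventually[OF cnt_tendsto[OF a]])
      (rule eventually_mono[OF eventually_gt_at_top[of 0]], simp add: card)
  show ?thesis unfolding point_density_def
  proof (rule the_equality)
    fix D assume "\<forall>x. ((\<lambda>R. real (card (model_set \<Gamma> {-a..a} \<inter> (\<lambda>y. x + R *\<^sub>R y) ` cbox 0 1)) / R ^ CARD('m)) \<longlongrightarrow> D) at_top"
    then show "D = 2 * a / covol" using lim[of 0] by (blast intro: tendsto_unique[OF trivial_limit_at_top_linorder])
  qed (use lim in blast)
qed

end

subsection \<open>Mollification and Bessel systems\<close>

definition average_kernel :: "real \<Rightarrow> 'a::euclidean_space \<Rightarrow> real" where
  "average_kernel r s = indicator (ball 0 r) s / measure lborel (ball (0::'a) r)"

definition mollify :: "real \<Rightarrow> ('a::euclidean_space \<Rightarrow> complex) \<Rightarrow> 'a \<Rightarrow> complex" where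
  "mollify r f t = (LBINT s. complex_of_real (average_kernel r s) * f (t - s))"

lemma ball_indicator_integrable: "integrable lborel (indicator (ball c r) :: 'a::euclidean_space \<Rightarrow> real)"
  by (rule integrable_real_indicator[OF _ emeasure_bounded_finite]) auto

lemma average_kernel:
  fixes s :: "'a::euclidean_space"
  assumes "0 < r"
  shows "integrable lborel (average_kernel r :: 'a \<Rightarrow> real)" "0 \<le> average_kernel r s"
    "(LBINT s. average_kernel r (s::'a)) = 1" "average_kernel r s \<noteq> 0 \<Longrightarrow> norm s < r"
    "(average_kernel r :: 'a \<Rightarrow> real) \<in> borel_measurable borel"
proof -
  have m: "0 < measure lborel (ball (0::'a) r)" using assms by (rule content_ball_pos)
  show "integrable lborel (average_kernel r :: 'a \<Rightarrow> real)" "(LBINT s. average_kernel r (s::'a)) = 1"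
    unfolding average_kernel_def[abs_def] using m ball_indicator_integrable[of "0::'a" r] by simp_all
  show "0 \<le> average_kernel r s" "average_kernel r s \<noteq> 0 \<Longrightarrow> norm s < r"
    by (auto simp: average_kernel_def indicator_def split: if_splits)
  have [measurable]: "ball (0::'a) r \<in> sets borel" by simp
  show "(average_kernel r :: 'a \<Rightarrow> real) \<in> borel_measurable borel"
    unfolding average_kernel_def[abs_def] by measurable
qed

lemma mollify_measurable [measurable]:
  assumes [measurable]: "f \<in> borel_measurable borel" and "0 < r"
  shows "mollify r f \<in> borel_measurable borel"
proof -
  note [measurable] = average_kernel(5)[OF \<open>0 < r\<close>]
  show ?thesis unfolding mollify_def[abs_def] by measurable
qed

lemma average_kernel_mult_integrable:
  fixes u :: "'a::euclidean_space \<Rightarrow> 'b::{banach, second_countable_topology,real_normed_algebra_1}"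
  assumes r: "0 < r" and [measurable]: "u \<in> borel_measurable borel" and M: "\<And>x. norm (u x) \<le> M"
  shows "integrable lborel (\<lambda>s. of_real (average_kernel r s) * u s)"
proof (rule Bochner_Integration.integrable_bound)
  note [measurable] = average_kernel(5)[OF \<open>0 < r\<close>]
  show "integrable lborel (\<lambda>s::'a. M * average_kernel r s)"
    by (intro integrable_mult_right average_kernel(1)[OF r])
  show "(\<lambda>s. of_real (average_kernel r s) * u s) \<in> borel_measurable lborel"
    unfolding scaleR_conv_of_real[symmetric] by measurable
  show "AE s in lborel. norm (of_real (average_kernel r s) * u s) \<le> norm (M * average_kernel r s)"
  proof (rule AE_I2)
    fix s :: 'a
    have "norm (of_real (average_kernel r s) * u s) \<le> average_kernel r s * norm (u s)"
      using average_kernel(2)[OF r, of s] norm_mult_ineq[of "of_real (average_kernel r s)" "u s"] by simp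
    also have "\<dots> \<le> average_kernel r s * M"
      using average_kernel(2)[OF r] M by (rule mult_left_mono[rotated])
    finally show "norm (of_real (average_kernel r s) * u s) \<le> norm (M * average_kernel r s)"
      by (simp add: mult.commute)
  qed
qed

lemma mollify_bounded:
  assumes r: "0 < r" and [measurable]: "f \<in> borel_measurable borel" and M: "\<And>x. norm (f x) \<le> M"
  shows "norm (mollify r f t) \<le> M"
proof -
  have i: "integrable lborel (\<lambda>s. of_real (average_kernel r s) * f (t - s))"
    by (rule average_kernel_mult_integrable[OF r _ M]) measurable
  have "norm (mollify r f t) \<le> (LBINT s. norm (of_real (average_kernel r s) * f (t - s)))"
    unfolding mollify_def by (rule integral_norm_bound)
  also have "\<dots> \<le> (\<integral>s. average_kernel r s * M \<partial>(lborel :: 'a measure))"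
    using i average_kernel(1)[OF r]
    by (intro integral_mono integrable_norm) (auto simp: norm_mult average_kernel(2)[OF r] intro!: mult_left_mono M)
  finally show ?thesis using average_kernel(3)[OF r, where 'a='a] by simp
qed

lemma mollify_integrable:
  assumes f: "integrable lborel f" and r: "0 < r"
  shows "integrable lborel (mollify r f)"
proof -
  have "(LBINT x. norm (f (x - s) - f x)) \<le> 2 * (LBINT x. norm (f x))" for s
  proof -
    have "(LBINT x. norm (f (x - s) - f x)) \<le> (LBINT x. norm (f (x - s)) + norm (f x))"
      using f by (intro integral_mono) (auto simp: integrable_lborel_shift norm_triangle_ineq4)
    also have "\<dots> = 2 * (LBINT x. norm (f x))"
      using f integral_lborel_shift(2)[of "\<lambda>x. norm (f x)" s] by (simp add: integrable_lborel_shift)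
    finally show ?thesis .
  qed
  from L1_dist_average_le(1)[OF f average_kernel(1-3)[OF r] this]
  show ?thesis unfolding mollify_def[abs_def] .
qed

text \<open>Jensen's inequality for the square, obtained from nonnegativity of the variance of
  \<open>norm (u s)\<close> about its mean \<open>c\<close>.\<close>

lemma average_jensen:
  fixes u :: "'a::euclidean_space \<Rightarrow> complex"
  assumes r: "0 < r" and [measurable]: "u \<in> borel_measurable borel" and M: "\<And>x. norm (u x) \<le> M"
  shows "(norm (LBINT s. average_kernel r s * u s))\<^sup>2 \<le> (LBINT s. average_kernel r s * (norm (u s))\<^sup>2)"
proof -
  define c where "c = (LBINT s. average_kernel r s * norm (u s))"
  have i1: "integrable lborel (\<lambda>s. average_kernel r s * norm (u s))"
    using average_kernel_mult_integrable[OF r, of "\<lambda>s. norm (u s)" M] M by simp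
  have i2: "integrable lborel (\<lambda>s. average_kernel r s * (norm (u s))\<^sup>2)"
    using average_kernel_mult_integrable[OF r, of "\<lambda>s. (norm (u s))\<^sup>2" "M\<^sup>2"] M by (simp add: power_mono)
  have "norm (LBINT s. average_kernel r s * u s) \<le> c"
    unfolding c_def using integral_norm_bound[of lborel "\<lambda>s. average_kernel r s * u s"]
    by (simp add: norm_mult average_kernel(2)[OF r])
  then have "(norm (LBINT s. average_kernel r s * u s))\<^sup>2 \<le> c\<^sup>2" by (intro power_mono) auto
  also have "c\<^sup>2 \<le> (LBINT s. average_kernel r s * (norm (u s))\<^sup>2)"
  proof -
    have "0 \<le> (LBINT s. average_kernel r s * (norm (u s) - c)\<^sup>2)"
      by (intro integral_nonneg_AE AE_I2 mult_nonneg_nonneg average_kernel(2)[OF r]) auto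
    also have "\<dots> = (LBINT s. average_kernel r s * (norm (u s))\<^sup>2 + c\<^sup>2 * average_kernel r s - (2 * c) * (average_kernel r s * norm (u s)))"
      by (intro Bochner_Integration.integral_cong) (auto simp: power2_diff algebra_simps)
    also have "\<dots> = (LBINT s. average_kernel r s * (norm (u s))\<^sup>2) + c\<^sup>2 - 2 * c * c"
      using i1 i2 average_kernel(1)[OF r, where 'a='a] average_kernel(3)[OF r, where 'a='a]
      by (simp add: c_def[symmetric])
    finally show ?thesis by (simp add: power2_eq_square)
  qed
  finally show ?thesis .
qed

lemma corr_bounded_left: 
  assumes "integrable lborel g" and "f \<in> borel_measurable borel" "\<And>t. norm (f t) \<le> M"
  shows "norm (corr f g x) \<le> M * (LBINT t. norm (g t))"
  unfolding corr_flip[of f] complex_mod_cnj by (rule corr_bounded[OF assms])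

lemma corr_shift: "corr (\<lambda>t. f (t - s)) g l = corr f g (l - s)"
proof -
  have "corr (\<lambda>t. f (t - s)) g l = (LBINT t. f (t + s - s) * cnj (g (t + s - l)))"
    unfolding corr_def using integral_lborel_shift(1)[of "\<lambda>t. f (t - s) * cnj (g (t - l))" s] by simp
  then show ?thesis by (simp add: corr_def algebra_simps)
qed

text \<open>This is the purpose of mollifying the test function: by Fubini the coefficient function
  itself gets averaged, for every generator at once and with the same kernel.\<close>

lemma corr_mollify:
  fixes f g :: "'a::euclidean_space \<Rightarrow> complex"
  assumes r: "0 < r" and f: "f \<in> borel_measurable borel" "\<And>x. norm (f x) \<le> M" and g: "integrable lborel g"
  shows "corr (mollify r f) g x = (LBINT s. average_kernel r s * corr f g (x - s))"
proof -
  note [measurable] = average_kernel(5)[OF r] f(1)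
  have [measurable]: "g \<in> borel_measurable borel" using g by auto
  have gx: "integrable lborel (\<lambda>t. norm (g (t - x)))" using g by (simp add: integrable_lborel_shift)
  have fg: "integrable lborel (\<lambda>t. f (t - s) * cnj (g (t - x)))" for s
  proof (rule Bochner_Integration.integrable_bound)
    show "integrable lborel (\<lambda>t. M * norm (g (t - x)))" using gx by simp
    show "AE t in lborel. norm (f (t - s) * cnj (g (t - x))) \<le> norm (M * norm (g (t - x)))"
      using f(2) order_trans[OF norm_ge_zero f(2)] by (auto simp: norm_mult abs_mult intro!: AE_I2 mult_right_mono)
  qed measurable
  have i: "integrable (lborel \<Otimes>\<^sub>M lborel) (\<lambda>(s, t). of_real (average_kernel r s) * (f (t - s) * cnj (g (t - x))))"
  proof (rule lborel_pair.Fubini_integrable)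
    show "integrable lborel (\<lambda>s. \<integral>t. norm (case (s, t) of (s, t) \<Rightarrow> complex_of_real (average_kernel r s) * (f (t - s) * cnj (g (t - x)))) \<partial>lborel)"
    proof (rule Bochner_Integration.integrable_bound)
      show "integrable lborel (\<lambda>s::'a. average_kernel r s * (M * (LBINT t. norm (g (t - x)))))"
        by (intro integrable_mult_left average_kernel(1)[OF r])
      show "AE s in lborel. norm (LBINT t. norm (case (s, t) of (s, t) \<Rightarrow> complex_of_real (average_kernel r s) * (f (t - s) * cnj (g (t - x)))))
        \<le> norm (average_kernel r s * (M * (LBINT t. norm (g (t - x)))))"
      proof (rule AE_I2)
        fix s
        have "(LBINT t. norm (f (t - s) * cnj (g (t - x)))) \<le> (LBINT t. M * norm (g (t - x)))"
          using f(2) by (intro integral_mono integrable_norm fg integrable_mult_right gx) (auto simp: norm_mult intro!: mult_right_mono)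
        then have "average_kernel r s * (LBINT t. norm (f (t - s) * cnj (g (t - x)))) \<le> average_kernel r s * (M * (LBINT t. norm (g (t - x))))"
          using average_kernel(2)[OF r, of s] by (intro mult_left_mono) auto
        moreover have "0 \<le> average_kernel r s * (LBINT t. norm (f (t - s) * cnj (g (t - x))))"
          using average_kernel(2)[OF r, of s] by simp
        ultimately show "norm (LBINT t. norm (case (s, t) of (s, t) \<Rightarrow> complex_of_real (average_kernel r s) * (f (t - s) * cnj (g (t - x)))))
          \<le> norm (average_kernel r s * (M * (LBINT t. norm (g (t - x)))))"
          using average_kernel(2)[OF r, of s] by (simp add: norm_mult)
      qed
    qed measurable
    show "AE s in lborel. integrable lborel (\<lambda>t. case (s, t) of (s, t) \<Rightarrow> complex_of_real (average_kernel r s) * (f (t - s) * cnj (g (t - x))))"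
      using fg by simp
  qed measurable
  have "corr (mollify r f) g x = (LBINT t. (LBINT s. of_real (average_kernel r s) * (f (t - s) * cnj (g (t - x)))))"
    unfolding corr_def mollify_def by (intro Bochner_Integration.integral_cong) (simp_all flip: integral_mult_left_zero add: mult.assoc)
  also have "\<dots> = (LBINT s. (LBINT t. of_real (average_kernel r s) * (f (t - s) * cnj (g (t - x)))))"
    by (rule lborel_pair.Fubini_integral[OF i])
  also have "\<dots> = (LBINT s. average_kernel r s * corr f g (x - s))"
    using corr_shift[of f _ g x] by (simp add: corr_def)
  finally show ?thesis .
qed

text \<open>A point value is now bounded by an integral over a ball. The ball may be centred at a
  nearby \<open>y\<close>, at the cost of a larger radius, so that one bound serves for all
  \<open>x\<close> close to \<open>y\<close>.\<close>

lemma corr_mollify_le: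
  fixes f g :: "'a::euclidean_space \<Rightarrow> complex"
  assumes r: "0 < r" and f: "f \<in> borel_measurable borel" "\<And>x. norm (f x) \<le> M" and g: "integrable lborel g"
    and i: "integrable lborel (\<lambda>x. (norm (corr f g x))\<^sup>2)" and R: "norm (y - x) + r \<le> R"
  shows "(norm (corr (mollify r f) g x))\<^sup>2
     \<le> (LBINT s. indicator (ball y R) s * (norm (corr f g s))\<^sup>2) / measure lborel (ball (0::'a) r)"
proof -
  have [measurable]: "g \<in> borel_measurable borel" "f \<in> borel_measurable borel" using f g by auto
  let ?V = "measure lborel (ball (0::'a) r)"
  have V: "0 < ?V" using r by (rule content_ball_pos)
  have ib: "integrable lborel (\<lambda>s. indicator A s * (norm (corr f g s))\<^sup>2)" if "A \<in> sets borel" for A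
    using integrable_mult_indicator[of A lborel, OF _ i] that by simp
  have "(norm (corr (mollify r f) g x))\<^sup>2 \<le> (LBINT s. average_kernel r s * (norm (corr f g (x - s)))\<^sup>2)"
    unfolding corr_mollify[OF r f g]
    by (rule average_jensen[OF r]) (measurable, rule corr_bounded_left[OF g f])
  also have "\<dots> = (LBINT s. indicator (ball x r) s * (norm (corr f g s))\<^sup>2 / ?V)"
  proof -
    have ke: "average_kernel r (x - s) = indicator (ball x r) s / ?V" for s
      by (auto simp: average_kernel_def indicator_def dist_norm norm_minus_commute)
    have "(LBINT s. average_kernel r s * (norm (corr f g (x - s)))\<^sup>2) = (LBINT s. average_kernel r (x - s) * (norm (corr f g s))\<^sup>2)"
      using integral_lborel_shift(4)[of "\<lambda>s. average_kernel r (x - s) * (norm (corr f g s))\<^sup>2" x] by simp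
    then show ?thesis unfolding ke by simp
  qed
  also have "\<dots> = (LBINT s. indicator (ball x r) s * (norm (corr f g s))\<^sup>2) / ?V" by simp
  also have "\<dots> \<le> (LBINT s. indicator (ball y R) s * (norm (corr f g s))\<^sup>2) / ?V"
  proof (intro divide_right_mono integral_mono ib)
    fix s
    have "s \<in> ball y R" if "s \<in> ball x r"
      using that R dist_triangle[of y s x] by (simp add: dist_norm)
    then show "indicator (ball x r) s * (norm (corr f g s))\<^sup>2 \<le> indicator (ball y R) s * (norm (corr f g s))\<^sup>2"
      by (auto simp: indicator_def)
  qed (use V in auto)
  finally show ?thesis .
qed

lemma corr_L2_bounded:
  assumes [measurable]: "f \<in> borel_measurable borel" "g \<in> borel_measurable borel"
    and i: "integrable lborel (\<lambda>x. (norm (f x))\<^sup>2)" "integrable lborel (\<lambda>x. (norm (g x))\<^sup>2)"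
  shows "norm (corr f g x) \<le> (LBINT x. (norm (f x))\<^sup>2) + (LBINT x. (norm (g x))\<^sup>2)"
proof -
  have gx: "integrable lborel (\<lambda>t. (norm (g (t - x)))\<^sup>2)" using i(2) integrable_lborel_shift(2)[of "\<lambda>x. (norm (g x))\<^sup>2" x] by simp
  have "norm (corr f g x) \<le> (LBINT t. norm (f t * cnj (g (t - x))))"
    unfolding corr_def by (rule integral_norm_bound)
  also have "\<dots> \<le> (LBINT t. (norm (f t))\<^sup>2 + (norm (g (t - x)))\<^sup>2)"
    using i gx by (intro integral_mono integrable_norm L2_mult_integrable) (auto simp: norm_mult intro: mult_le_sum_power2)
  also have "\<dots> = (LBINT x. (norm (f x))\<^sup>2) + (LBINT x. (norm (g x))\<^sup>2)"
    using i gx integral_lborel_shift(2)[of "\<lambda>x. (norm (g x))\<^sup>2" x] by simp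
  finally show ?thesis .
qed

text \<open>Fatou's lemma along growing balls. Bessel sums are available for finitely many points at
  a time, hence for bounded regions, with a bound independent of the region.\<close>

lemma integrable_of_ball_bound:
  fixes A :: "'a::euclidean_space \<Rightarrow> real"
  assumes [measurable]: "A \<in> borel_measurable borel" and A: "\<And>x. 0 \<le> A x"
    and i: "\<And>n::nat. integrable lborel (\<lambda>x. indicator (ball 0 n) x * A x)"
    and V: "\<And>n::nat. (LBINT x. indicator (ball 0 n) x * A x) \<le> V"
  shows "integrable lborel A" "(LBINT x. A x) \<le> V"
proof -
  have [measurable]: "ball 0 x \<in> sets (borel :: 'a measure)" for x by simp
  have V0: "0 \<le> V" using V[of 0] by simp
  have "(\<integral>\<^sup>+x. ennreal (A x) \<partial>lborel) = (\<integral>\<^sup>+x. liminf (\<lambda>n. ennreal (indicator (ball 0 (real n)) x * A x)) \<partial>lborel)"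
  proof (rule nn_integral_cong)
    fix x :: 'a
    obtain N :: nat where N: "norm x < N" using reals_Archimedean2 by blast
    have "(\<lambda>n. ennreal (indicator (ball 0 (real n)) x * A x)) \<longlonglongrightarrow> ennreal (A x)"
      by (rule tendsto_eventually, rule eventually_mono[OF eventually_ge_at_top[of N]]) (use N in auto)
    from lim_imp_Liminf[OF _ this] show "ennreal (A x) = liminf (\<lambda>n. ennreal (indicator (ball 0 (real n)) x * A x))" by simp
  qed
  also have "\<dots> \<le> liminf (\<lambda>n. \<integral>\<^sup>+x. ennreal (indicator (ball 0 (real n)) x * A x) \<partial>lborel)"
    by (rule nn_integral_liminf) measurable
  also have "\<dots> \<le> liminf (\<lambda>n::nat. ennreal V)"
  proof (rule Liminf_mono, rule always_eventually, rule allI)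
    fix n :: nat
    have "(\<integral>\<^sup>+x. ennreal (indicator (ball 0 (real n)) x * A x) \<partial>lborel) = ennreal (LBINT x. indicator (ball 0 (real n)) x * A x)"
      by (rule nn_integral_eq_integral[OF i]) (use A in auto)
    also have "\<dots> \<le> ennreal V" using V by (rule ennreal_leI)
    finally show "(\<integral>\<^sup>+x. ennreal (indicator (ball 0 (real n)) x * A x) \<partial>lborel) \<le> ennreal V" .
  qed
  also have "\<dots> = ennreal V" by (simp add: Liminf_const)
  finally have le: "(\<integral>\<^sup>+x. ennreal (A x) \<partial>lborel) \<le> ennreal V" .
  show iA: "integrable lborel A"
    by (rule integrableI_nonneg) (use A le in \<open>auto intro: le_less_trans\<close>)
  have "(\<integral>\<^sup>+x. ennreal (A x) \<partial>lborel) = ennreal (LBINT x. A x)"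
    by (rule nn_integral_eq_integral[OF iA]) (use A in auto)
  then show "(LBINT x. A x) \<le> V" using le V0 by (simp add: ennreal_le_iff)
qed

text \<open>The Bessel inequality in working form: Borel representatives, correlation values in
  place of inner products, finite partial sums in place of infinite ones.\<close>

locale bessel_system = cut_project \<Gamma> B \<beta>
  for \<Gamma> :: "((real^'m) \<times> real) set" and B \<beta> +
  fixes a :: real and K :: "'k set" and g :: "'k \<Rightarrow> real^'m \<Rightarrow> complex" and C :: real
  assumes a: "0 < a"
    and g1: "\<And>k. k \<in> K \<Longrightarrow> integrable lborel (g k)"
    and g2: "\<And>k. k \<in> K \<Longrightarrow> integrable lborel (\<lambda>x. (norm (g k x))\<^sup>2)"
    and bessel: "\<And>f F. f \<in> borel_measurable borel \<Longrightarrow> integrable lborel (\<lambda>x. (norm (f x))\<^sup>2) \<Longrightarrow>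
      finite F \<Longrightarrow> F \<subseteq> K \<times> model_set \<Gamma> {-a..a} \<Longrightarrow>
      (\<Sum>(k, l)\<in>F. (norm (corr f (g k) l))\<^sup>2) \<le> C * (LBINT x. (norm (f x))\<^sup>2)"
begin

lemma gm: "k \<in> K \<Longrightarrow> g k \<in> borel_measurable borel"
  using g1[of k] by auto

text \<open>Reducing \<open>(x, 0)\<close> modulo the lattice gives a vector near \<open>x\<close>
  whose level lies in a fixed compact interval. By compactness one of finitely many lattice vectors
  corrects the level into the window, so the first coordinate moves by a bounded amount.\<close>

lemma relatively_dense:
  obtains \<rho> where "0 < \<rho>" "\<And>x. \<exists>\<gamma>\<in>\<Gamma>. snd \<gamma> \<in> {-a..a} \<and> norm (fst \<gamma> - x) \<le> \<rho>"
proof -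
  have sub: "{-radius..radius} \<subseteq> (\<Union>\<gamma>\<in>\<Gamma>. {snd \<gamma> - a<..<snd \<gamma> + a})"
  proof
    fix t :: real
    obtain \<gamma> where "\<gamma> \<in> \<Gamma>" "t - a < snd \<gamma>" "snd \<gamma> < t + a" using lattice_between[of "t - a" "t + a"] a by auto
    then show "t \<in> (\<Union>\<gamma>\<in>\<Gamma>. {snd \<gamma> - a<..<snd \<gamma> + a})" by force
  qed
  obtain T where T: "T \<subseteq> \<Gamma>" "finite T" "{-radius..radius} \<subseteq> (\<Union>\<gamma>\<in>T. {snd \<gamma> - a<..<snd \<gamma> + a})"
    by (rule compactE_image[OF compact_Icc _ sub]) auto
  define \<rho> where "\<rho> = radius + (\<Sum>\<gamma>\<in>T. norm (fst \<gamma>)) + 1"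
  show thesis
  proof (rule that)
    show "0 < \<rho>" unfolding \<rho>_def using radius_nonneg sum_nonneg[of T "\<lambda>\<gamma>. norm (fst \<gamma>)"] by simp
    fix x
    obtain \<gamma> where \<gamma>: "\<gamma> \<in> \<Gamma>" "(x, 0) - \<gamma> \<in> cell" by (rule cell_cover)
    have n: "norm (fst \<gamma> - x) \<le> radius" "\<bar>snd \<gamma>\<bar> \<le> radius"
      using order_trans[OF norm_fst_le[of "fst ((x, 0) - \<gamma>)" "snd ((x, 0) - \<gamma>)", unfolded prod.collapse] cell_norm[OF \<gamma>(2)]]
        order_trans[OF norm_snd_le[of "snd ((x, 0) - \<gamma>)" "fst ((x, 0) - \<gamma>)", unfolded prod.collapse] cell_norm[OF \<gamma>(2)]]
      by (simp_all add: norm_minus_commute)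
    then have "snd \<gamma> \<in> {-radius..radius}" by auto
    then obtain \<gamma>' where \<gamma>': "\<gamma>' \<in> T" "snd \<gamma> \<in> {snd \<gamma>' - a<..<snd \<gamma>' + a}" using T(3) by blast
    have "norm (fst (\<gamma> - \<gamma>') - x) \<le> norm (fst \<gamma> - x) + norm (fst \<gamma>')"
      using norm_triangle_ineq4[of "fst \<gamma> - x" "fst \<gamma>'"] by (simp add: algebra_simps)
    also have "norm (fst \<gamma>') \<le> (\<Sum>\<gamma>\<in>T. norm (fst \<gamma>))" by (rule member_le_sum) (use \<gamma>' T in auto)
    finally have "norm (fst (\<gamma> - \<gamma>') - x) \<le> \<rho>" unfolding \<rho>_def using n by simp
    moreover have "\<gamma> - \<gamma>' \<in> \<Gamma>" using lattice_diff[OF \<gamma>(1) subsetD[OF T(1) \<gamma>'(1)]] .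
    moreover have "snd (\<gamma> - \<gamma>') \<in> {-a..a}" using \<gamma>' by auto
    ultimately show "\<exists>\<gamma>\<in>\<Gamma>. snd \<gamma> \<in> {-a..a} \<and> norm (fst \<gamma> - x) \<le> \<rho>" by blast
  qed
qed

text \<open>Since the model set is relatively dense, integrals over the whole space are bounded by integrals of
  the Bessel sum over one fixed ball.\<close>

lemma corr_square_integral:
  assumes [measurable]: "f \<in> borel_measurable borel" and f: "integrable lborel (\<lambda>x. (norm (f x))\<^sup>2)"
  shows "k \<in> K \<Longrightarrow> integrable lborel (\<lambda>x. (norm (corr f (g k) x))\<^sup>2)"
    and "(\<lambda>k. \<integral>x. (norm (corr f (g k) x))\<^sup>2 \<partial>lborel) summable_on K"
proof -
  obtain \<rho> where \<rho>: "0 < \<rho>" "\<And>x. \<exists>\<gamma>\<in>\<Gamma>. snd \<gamma> \<in> {-a..a} \<and> norm (fst \<gamma> - x) \<le> \<rho>"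
    using relatively_dense by blast
  let ?N = "\<integral>x. (norm (f x))\<^sup>2 \<partial>lborel"
  define V where "V = measure lborel (cball (0::real^'m) \<rho>) * (C * ?N)"
  have ic: "integrable lborel (indicator (cball 0 \<rho>) :: real^'m \<Rightarrow> real)"
    by (rule integrable_real_indicator[OF _ emeasure_bounded_finite]) auto
  have [measurable]: "ball 0 x \<in> sets (borel :: (real^'m) measure)" "cball 0 x \<in> sets (borel :: (real^'m) measure)" for x by auto
  have main: "integrable lborel (\<lambda>x. \<Sum>k\<in>F. (norm (corr f (g k) x))\<^sup>2) \<and> (LBINT x. (\<Sum>k\<in>F. (norm (corr f (g k) x))\<^sup>2)) \<le> V"
    if F: "finite F" "F \<subseteq> K" for F
  proof -
    define A where "A x = (\<Sum>k\<in>F. (norm (corr f (g k) x))\<^sup>2)" for x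
    have Am [measurable]: "A \<in> borel_measurable borel"
      unfolding A_def using gm F by (intro borel_measurable_sum borel_measurable_power borel_measurable_norm[THEN measurable_compose_rev] borel_measurable_norm corr_measurable) auto
    have A0: "0 \<le> A x" for x by (auto simp: A_def intro: sum_nonneg)
    have Ab: "A x \<le> (\<Sum>k\<in>F. (?N + (LBINT x. (norm (g k x))\<^sup>2))\<^sup>2)" for x
      unfolding A_def using F gm g2 f by (intro sum_mono power_mono corr_L2_bounded) auto
    have iA: "integrable lborel (\<lambda>x. h x * A x)" if h: "integrable lborel h" for h :: "real^'m \<Rightarrow> real"
    proof (rule Bochner_Integration.integrable_bound)
      have [measurable]: "h \<in> borel_measurable borel" using h by auto
      show "(\<lambda>x. h x * A x) \<in> borel_measurable lborel" by measurable
      show "integrable lborel (\<lambda>x. h x * (\<Sum>k\<in>F. (?N + (LBINT x. (norm (g k x))\<^sup>2))\<^sup>2))" using h by simp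
      show "AE x in lborel. norm (h x * A x) \<le> norm (h x * (\<Sum>k\<in>F. (?N + (LBINT x. (norm (g k x))\<^sup>2))\<^sup>2))"
        using Ab A0 by (intro AE_I2) (auto simp: abs_mult intro!: mult_left_mono order_trans[OF Ab abs_ge_self])
    qed
    \<comment> \<open>The shift by \<open>s\<close> is transferred from the sampling points to
      \<open>f\<close>, whose norm does not change, so the Bessel constant is the same for every
      \<open>s\<close>.\<close>
    have pw: "(\<Sum>\<gamma>\<in>T. A (fst \<gamma> - s)) \<le> C * ?N" if T: "finite T" "T \<subseteq> {\<gamma>\<in>\<Gamma>. snd \<gamma> \<in> {-a..a}}" for T s
    proof -
      have inj: "inj_on (\<lambda>(k, \<gamma>). (k, fst \<gamma>)) (F \<times> T)"
        using inj_on_subset[OF inj_fst, of T] T by (fastforce simp: inj_on_def)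
      have "(\<Sum>\<gamma>\<in>T. A (fst \<gamma> - s)) = (\<Sum>(k, \<gamma>)\<in>F \<times> T. (norm (corr (\<lambda>t. f (t - s)) (g k) (fst \<gamma>)))\<^sup>2)"
        unfolding A_def corr_shift by (subst sum.swap) (simp add: sum.cartesian_product)
      also have "\<dots> = (\<Sum>(k, l)\<in>(\<lambda>(k, \<gamma>). (k, fst \<gamma>)) ` (F \<times> T). (norm (corr (\<lambda>t. f (t - s)) (g k) l))\<^sup>2)"
        using inj by (subst sum.reindex) (auto simp: case_prod_unfold)
      also have "\<dots> \<le> C * (LBINT x. (norm (f (x - s)))\<^sup>2)"
        using F T f by (intro bessel) (auto simp: model_set_def integrable_lborel_shift(2)[of "\<lambda>x. (norm (f x))\<^sup>2"])
      also have "(LBINT x. (norm (f (x - s)))\<^sup>2) = ?N" by (rule integral_lborel_shift)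
      finally show ?thesis .
    qed
    have ib: "integrable lborel (\<lambda>x. indicator (ball 0 (real n)) x * A x)" for n
      by (rule iA[OF ball_indicator_integrable])
    have bound: "(LBINT x. indicator (ball 0 (real n)) x * A x) \<le> V" for n :: nat
    proof -
      \<comment> \<open>Finitely many model points whose balls of radius \<rho> cover the ball of
        radius \<open>n\<close>. After substitution all these balls become
        \<open>cball 0 \<rho>\<close>, which is why the final bound \<open>V\<close> depends neither
        on \<open>n\<close> nor on \<open>F\<close>.\<close>
      define T where "T = \<Gamma> \<inter> {z. norm (fst z) \<le> n + \<rho> \<and> snd z \<in> {-a..a}}"
      have "bounded {z :: (real^'m) \<times> real. norm (fst z) \<le> n + \<rho> \<and> snd z \<in> {-a..a}}"
        by (rule bounded_subset[OF bounded_Times[OF bounded_cball[of "0::real^'m" "n + \<rho>"] bounded_cball[of "0::real" a]]]) (auto simp: mem_Times_iff dist_norm)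
      then have T: "finite T" unfolding T_def by (rule lattice_finite_bounded)
      have ish: "integrable lborel (\<lambda>x. indicator (cball 0 \<rho>) (c - x) * A x)" for c
        by (rule iA) (simp add: integrable_lborel_shift ic)
      have ish': "integrable lborel (\<lambda>x. indicator (cball 0 \<rho>) x * A (c - x))" for c
        using ish[of c] integrable_lborel_shift(4)[of "\<lambda>x. indicator (cball 0 \<rho>) (c - x) * A x" c] by simp
      have "indicator (ball 0 (real n)) x * A x \<le> (\<Sum>\<gamma>\<in>T. indicator (cball 0 \<rho>) (fst \<gamma> - x) * A x)" for x
      proof (cases "x \<in> ball 0 (real n)")
        case True
        obtain \<gamma> where \<gamma>: "\<gamma> \<in> \<Gamma>" "snd \<gamma> \<in> {-a..a}" "norm (fst \<gamma> - x) \<le> \<rho>" using \<rho>(2) by blast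
        have "norm (fst \<gamma>) \<le> n + \<rho>" using norm_triangle_ineq[of "fst \<gamma> - x" x] \<gamma> True by auto
        then have "\<gamma> \<in> T" using \<gamma> by (simp add: T_def)
        then have "indicator (cball 0 \<rho>) (fst \<gamma> - x) * A x \<le> (\<Sum>\<gamma>\<in>T. indicator (cball 0 \<rho>) (fst \<gamma> - x) * A x)"
          using T A0 by (intro member_le_sum) auto
        then show ?thesis using True \<gamma> by simp
      qed (auto intro!: sum_nonneg A0 simp: indicator_def)
      then have "(LBINT x. indicator (ball 0 (real n)) x * A x) \<le> (LBINT x. (\<Sum>\<gamma>\<in>T. indicator (cball 0 \<rho>) (fst \<gamma> - x) * A x))"
        using ib ish by (intro integral_mono Bochner_Integration.integrable_sum) auto
      also have "\<dots> = (\<Sum>\<gamma>\<in>T. \<integral>x. indicator (cball 0 \<rho>) (fst \<gamma> - x) * A x \<partial>lborel)"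
        using ish by (intro Bochner_Integration.integral_sum) auto
      also have "\<dots> = (\<Sum>\<gamma>\<in>T. \<integral>s. indicator (cball 0 \<rho>) s * A (fst \<gamma> - s) \<partial>lborel)"
      proof (rule sum.cong[OF refl])
        fix \<gamma>
        show "(LBINT x. indicator (cball 0 \<rho>) (fst \<gamma> - x) * A x) = (LBINT s. indicator (cball 0 \<rho>) s * A (fst \<gamma> - s))"
          using integral_lborel_shift(4)[of "\<lambda>x. indicator (cball 0 \<rho>) (fst \<gamma> - x) * A x" "fst \<gamma>"] by simp
      qed
      also have "\<dots> = (LBINT s. (\<Sum>\<gamma>\<in>T. indicator (cball 0 \<rho>) s * A (fst \<gamma> - s)))"
        using ish' by (intro Bochner_Integration.integral_sum[symmetric]) auto
      also have "\<dots> \<le> (\<integral>s. indicator (cball 0 \<rho>) s * (C * ?N) \<partial>(lborel :: (real^'m) measure))"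
      proof (rule integral_mono)
        fix s
        have "(\<Sum>\<gamma>\<in>T. indicator (cball 0 \<rho>) s * A (fst \<gamma> - s)) = indicator (cball 0 \<rho>) s * (\<Sum>\<gamma>\<in>T. A (fst \<gamma> - s))"
          by (simp add: sum_distrib_left)
        also have "\<dots> \<le> indicator (cball 0 \<rho>) s * (C * ?N)"
          by (intro mult_left_mono pw T) (auto simp: T_def)
        finally show "(\<Sum>\<gamma>\<in>T. indicator (cball 0 \<rho>) s * A (fst \<gamma> - s)) \<le> indicator (cball 0 \<rho>) s * (C * ?N)" .
      qed (use ish' ic in auto)
      also have "\<dots> = V" by (simp add: V_def)
      finally show ?thesis .
    qed
    show ?thesis
      using integrable_of_ball_bound[OF Am A0 ib bound] unfolding A_def by blast
  qed
  show int: "integrable lborel (\<lambda>x. (norm (corr f (g k) x))\<^sup>2)" if "k \<in> K" for k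
    using main[of "{k}"] that by simp
  show "(\<lambda>k. \<integral>x. (norm (corr f (g k) x))\<^sup>2 \<partial>lborel) summable_on K"
  proof (rule nonneg_bdd_above_summable_on)
    show "bdd_above (sum (\<lambda>k. \<integral>x. (norm (corr f (g k) x))\<^sup>2 \<partial>lborel) ` {F. F \<subseteq> K \<and> finite F})"
    proof (rule bdd_aboveI2)
      fix F assume "F \<in> {F. F \<subseteq> K \<and> finite F}"
      then show "(\<Sum>k\<in>F. \<integral>x. (norm (corr f (g k) x))\<^sup>2 \<partial>lborel) \<le> V"
        using main[of F] int by (subst Bochner_Integration.integral_sum[symmetric]) auto
    qed
  qed auto
qed

end

lemma norm_mult_le_sum_power2: "norm (x * cnj y) \<le> (norm x)\<^sup>2 + (norm y)\<^sup>2" for x y :: complex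
  by (simp add: norm_mult mult_le_sum_power2)

text \<open>The Weierstrass test makes the partial sums converge uniformly near \<open>z0\<close>;
  the terms need to be continuous at \<open>z0\<close> only, as they may jump nearby.\<close>

lemma isCont_infsum:
  fixes f :: "'i \<Rightarrow> 'a::t2_space \<Rightarrow> complex"
  assumes U: "open U" "z0 \<in> U" and le: "\<And>i z. i \<in> I \<Longrightarrow> z \<in> U \<Longrightarrow> norm (f i z) \<le> m i"
    and m: "m summable_on I" and c: "\<And>i. i \<in> I \<Longrightarrow> isCont (f i) z0"
  shows "isCont (\<lambda>z. \<Sum>\<^sub>\<infinity>i\<in>I. f i z) z0"
proof -
  have ul: "uniform_limit U (\<lambda>X z. \<Sum>i\<in>X. f i z) (\<lambda>z. \<Sum>\<^sub>\<infinity>i\<in>I. f i z) (finite_subsets_at_top I)"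
    using le m by (rule Weierstrass_m_test_general)
  have ci: "(f i \<longlongrightarrow> f i z0) (at z0 within U)" if "i \<in> I" for i
    using c[OF that] unfolding isCont_def by (rule tendsto_within_subset) simp
  have "((\<lambda>z. \<Sum>\<^sub>\<infinity>i\<in>I. f i z) \<longlongrightarrow> (\<Sum>\<^sub>\<infinity>i\<in>I. f i z0)) (at z0 within U)"
  proof (rule swap_uniform_limit[OF _ _ ul])
    show "\<forall>\<^sub>F X in finite_subsets_at_top I. ((\<lambda>z. \<Sum>i\<in>X. f i z) \<longlongrightarrow> (\<Sum>i\<in>X. f i z0)) (at z0 within U)"
    proof (rule eventually_finite_subsets_at_top_weakI)
      fix X assume "finite X" "X \<subseteq> I"
      then show "((\<lambda>z. \<Sum>i\<in>X. f i z) \<longlongrightarrow> (\<Sum>i\<in>X. f i z0)) (at z0 within U)"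
        using ci by (intro tendsto_sum) blast
    qed
    show "((\<lambda>X. \<Sum>i\<in>X. f i z0) \<longlongrightarrow> (\<Sum>\<^sub>\<infinity>i\<in>I. f i z0)) (finite_subsets_at_top I)"
      by (rule tendsto_uniform_limitI[OF ul U(2)])
  qed simp
  then show ?thesis
    unfolding isCont_def using at_within_open[OF U(2,1)] by simp
qed

context bessel_system
begin

text \<open>Dominates the squared coefficients for all \<open>z\<close> within distance 1 of
  \<open>z0\<close> in both coordinates at once; hence \<open>a + 1\<close> for the window and
  \<open>r + 1\<close> for the ball.\<close>

definition majorant :: "real \<Rightarrow> (real^'m \<Rightarrow> complex) \<Rightarrow> (real^'m) \<times> real \<Rightarrow> 'k \<times> ((real^'m) \<times> real) \<Rightarrow> real" where
  "majorant r f z0 = (\<lambda>(k, \<gamma>). indicator {\<gamma>. \<bar>snd \<gamma> - snd z0\<bar> \<le> a + 1} \<gamma> *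
     ((LBINT s. indicator (ball (fst \<gamma> - fst z0) (r + 1)) s * (norm (corr f (g k) s))\<^sup>2) / measure lborel (ball (0::real^'m) r)))"

lemma majorant_bound:
  assumes r: "0 < r" and f: "f \<in> borel_measurable borel" "\<And>x. norm (f x) \<le> M" "integrable lborel (\<lambda>x. (norm (f x))\<^sup>2)"
    and k: "k \<in> K" and z: "norm (fst z - fst z0) \<le> 1" "\<bar>snd z - snd z0\<bar> \<le> 1"
  shows "indicator {-a..a} (snd \<gamma> - snd z) * (norm (corr (mollify r f) (g k) (fst \<gamma> - fst z)))\<^sup>2 \<le> majorant r f z0 (k, \<gamma>)"
proof (cases "snd \<gamma> - snd z \<in> {-a..a}")
  case True
  then have 1: "\<bar>snd \<gamma> - snd z0\<bar> \<le> a + 1" using z(2) by auto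
  have "norm ((fst \<gamma> - fst z0) - (fst \<gamma> - fst z)) + r \<le> r + 1" using z(1) by (simp add: algebra_simps)
  from corr_mollify_le[OF r f(1,2) g1[OF k] corr_square_integral(1)[OF f(1,3) k] this] show ?thesis
    using True 1 by (simp add: majorant_def)
next
  case False
  then show ?thesis using content_ball_pos[OF r, of "0::real^'m"]
    by (auto simp: majorant_def intro!: mult_nonneg_nonneg divide_nonneg_pos integral_nonneg_AE)
qed

text \<open>A given point \<open>s\<close> lies in at most \<open>M\<close> of the balls attached to
  lattice points of admissible level, with \<open>M\<close> independent of \<open>s\<close> and
  \<open>z0\<close>. The lattice sum is thus at most \<open>M / ?V\<close> times an integral over
  all of space, and these integrals are summable over \<open>K\<close>.\<close>

lemma majorant_summable:
  assumes r: "0 < r" and f: "f \<in> borel_measurable borel" "integrable lborel (\<lambda>x. (norm (f x))\<^sup>2)"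
  obtains T where "\<And>z0. majorant r f z0 summable_on K \<times> \<Gamma>" "\<And>z0. (\<Sum>\<^sub>\<infinity>i\<in>K \<times> \<Gamma>. majorant r f z0 i) \<le> T"
proof -
  let ?V = "measure lborel (ball (0::real^'m) r)"
  have V: "0 < ?V" using r by (rule content_ball_pos)
  let ?I = "\<lambda>k. \<integral>s. (norm (corr f (g k) s))\<^sup>2 \<partial>lborel"
  define S where "S = {z :: (real^'m) \<times> real. norm (fst z) \<le> r + 1 \<and> \<bar>snd z\<bar> \<le> a + 1}"
  have "bounded S" unfolding S_def
    by (rule bounded_subset[OF bounded_Times[OF bounded_cball[of "0::real^'m" "r + 1"] bounded_cball[of "0::real" "a + 1"]]]) (auto simp: mem_Times_iff dist_norm)
  then obtain M where M: "\<And>z. finite {\<gamma> \<in> \<Gamma>. \<gamma> - z \<in> S}" "\<And>z. card {\<gamma> \<in> \<Gamma>. \<gamma> - z \<in> S} \<le> M"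
    using lattice_uniform_count by blast
  define T where "T = (M / ?V) * (\<Sum>\<^sub>\<infinity>k\<in>K. ?I k)"
  have i: "k \<in> K \<Longrightarrow> integrable lborel (\<lambda>s. indicator A s * (norm (corr f (g k) s))\<^sup>2)" if "A \<in> sets borel" for A k
    using integrable_mult_indicator[of A lborel, OF _ corr_square_integral(1)[OF f, of k]] that by simp
  have nn: "0 \<le> majorant r f z0 (k, \<gamma>)" for z0 k \<gamma>
    using V by (auto simp: majorant_def intro!: mult_nonneg_nonneg divide_nonneg_pos integral_nonneg_AE)
  have inner: "(\<Sum>\<gamma>\<in>F. majorant r f z0 (k, \<gamma>)) \<le> (M / ?V) * ?I k" if F: "finite F" "F \<subseteq> \<Gamma>" and k: "k \<in> K" for F k z0
  proof -
    define F' where "F' = F \<inter> {\<gamma>. \<bar>snd \<gamma> - snd z0\<bar> \<le> a + 1}"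
    have F': "finite F'" "F' \<subseteq> \<Gamma>" using F by (auto simp: F'_def)
    have "(\<Sum>\<gamma>\<in>F. majorant r f z0 (k, \<gamma>)) = (\<Sum>\<gamma>\<in>F'. majorant r f z0 (k, \<gamma>))"
      unfolding F'_def using F by (intro sum.mono_neutral_right) (auto simp: majorant_def)
    also have "\<dots> = (\<Sum>\<gamma>\<in>F'. \<integral>s. indicator (ball (fst \<gamma> - fst z0) (r + 1)) s * (norm (corr f (g k) s))\<^sup>2 \<partial>lborel) / ?V"
      unfolding sum_divide_distrib by (rule sum.cong) (auto simp: majorant_def F'_def)
    also have "(\<Sum>\<gamma>\<in>F'. \<integral>s. indicator (ball (fst \<gamma> - fst z0) (r + 1)) s * (norm (corr f (g k) s))\<^sup>2 \<partial>lborel)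
      = (LBINT s. (\<Sum>\<gamma>\<in>F'. indicator (ball (fst \<gamma> - fst z0) (r + 1)) s * (norm (corr f (g k) s))\<^sup>2))"
      using i k by (intro Bochner_Integration.integral_sum[symmetric]) auto
    also have "\<dots> \<le> (LBINT s. M * (norm (corr f (g k) s))\<^sup>2)"
    proof (rule integral_mono)
      fix s :: "real^'m"
      have "(\<Sum>\<gamma>\<in>F'. indicator (ball (fst \<gamma> - fst z0) (r + 1)) s :: real) = card (F' \<inter> {\<gamma>. s \<in> ball (fst \<gamma> - fst z0) (r + 1)})"
        using F' by (simp add: indicator_def flip: sum.inter_filter)
      also have "\<dots> \<le> card {\<gamma> \<in> \<Gamma>. \<gamma> - (z0 + (s, 0)) \<in> S}"
        using F' by (intro of_nat_mono card_mono M) (auto simp: S_def F'_def dist_norm algebra_simps)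
      also have "\<dots> \<le> M" using M by simp
      finally have "(\<Sum>\<gamma>\<in>F'. indicator (ball (fst \<gamma> - fst z0) (r + 1)) s :: real) \<le> M" by simp
      then show "(\<Sum>\<gamma>\<in>F'. indicator (ball (fst \<gamma> - fst z0) (r + 1)) s * (norm (corr f (g k) s))\<^sup>2) \<le> M * (norm (corr f (g k) s))\<^sup>2"
        by (subst sum_distrib_right[symmetric]) (intro mult_right_mono, auto)
    qed (use i k corr_square_integral(1)[OF f] in auto)
    finally show ?thesis using V by (simp add: divide_right_mono)
  qed
  have bound: "sum (majorant r f z0) F \<le> T" if F: "finite F" "F \<subseteq> K \<times> \<Gamma>" for F z0
  proof -
    have "sum (majorant r f z0) F \<le> sum (majorant r f z0) (fst ` F \<times> snd ` F)"
      using F nn by (intro sum_mono2 subset_fst_snd) (auto simp: nn)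
    also have "\<dots> = (\<Sum>k\<in>fst ` F. \<Sum>\<gamma>\<in>snd ` F. majorant r f z0 (k, \<gamma>))"
      by (simp add: sum.cartesian_product)
    also have "\<dots> \<le> (\<Sum>k\<in>fst ` F. (M / ?V) * ?I k)"
      using F by (intro sum_mono inner) auto
    also have "\<dots> = (M / ?V) * (\<Sum>k\<in>fst ` F. ?I k)" by (simp add: sum_distrib_left)
    also have "\<dots> \<le> T" unfolding T_def
      using F V corr_square_integral(2)[OF f] by (intro mult_left_mono finite_sum_le_infsum) auto
    finally show ?thesis .
  qed
  have s: "majorant r f z0 summable_on K \<times> \<Gamma>" for z0
  proof (rule nonneg_bdd_above_summable_on)
    show "0 \<le> majorant r f z0 i" for i by (cases i) (simp only: nn)
    show "bdd_above (sum (majorant r f z0) ` {F. F \<subseteq> K \<times> \<Gamma> \<and> finite F})"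
      by (rule bdd_aboveI2[where M=T], rule bound) auto
  qed
  show thesis
    by (rule that[OF s]) (rule infsum_le_finite_sums[OF s], rule bound)
qed

end

subsection \<open>The frame form on the hull\<close>

locale bessel_pair = G: bessel_system \<Gamma> B \<beta> a K g C + H: bessel_system \<Gamma> B \<beta> a K h C'
  for \<Gamma> :: "((real^'m) \<times> real) set" and B \<beta> a and K :: "'k set" and g h C C' +
  assumes K: "countable K"
begin

definition summand :: "(real^'m \<Rightarrow> complex) \<Rightarrow> (real^'m \<Rightarrow> complex) \<Rightarrow> (real^'m) \<times> real \<Rightarrow> 'k \<times> ((real^'m) \<times> real) \<Rightarrow> complex" where
  "summand f1 f2 z = (\<lambda>(k, \<gamma>). indicator {-a..a} (snd \<gamma> - snd z) *\<^sub>R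
      (corr f1 (g k) (fst \<gamma> - fst z) * cnj (corr f2 (h k) (fst \<gamma> - fst z))))"

text \<open>Kept sesquilinear, with two functions: translating the test function in one slot only is
  what later isolates the symbol.\<close>

definition hull_form :: "(real^'m \<Rightarrow> complex) \<Rightarrow> (real^'m \<Rightarrow> complex) \<Rightarrow> (real^'m) \<times> real \<Rightarrow> complex" where
  "hull_form f1 f2 z = (\<Sum>\<^sub>\<infinity>i\<in>K \<times> \<Gamma>. summand f1 f2 z i)"

definition frame_form :: "(real^'m \<Rightarrow> complex) \<Rightarrow> (real^'m \<Rightarrow> complex) \<Rightarrow> complex" where
  "frame_form f1 f2 = (\<Sum>\<^sub>\<infinity>(k, l)\<in>K \<times> model_set \<Gamma> {-a..a}. corr f1 (g k) l * cnj (corr f2 (h k) l))"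

text \<open>For mollified functions the coefficients at the points of a uniformly discrete set are dominated by
  integrals of coefficients, so the tails over \<open>K\<close> are uniformly small on the whole hull.\<close>

definition mollified :: "(real^'m \<Rightarrow> complex) \<Rightarrow> bool" where
  "mollified f \<longleftrightarrow> (\<exists>r f0 M. 0 < r \<and> integrable lborel f0 \<and> (\<forall>x. norm (f0 x) \<le> M) \<and> f = mollify r f0)"

lemma bounded_integrable_L2:
  assumes f: "integrable lborel f" and M: "\<And>x. norm (f x) \<le> M"
  shows "integrable lborel (\<lambda>x. (norm (f x :: complex))\<^sup>2)"
proof (rule Bochner_Integration.integrable_bound)
  have [measurable]: "f \<in> borel_measurable lborel" using f by auto
  show "(\<lambda>x. (norm (f x))\<^sup>2) \<in> borel_measurable lborel" by measurable
  show "integrable lborel (\<lambda>x. M * norm (f x))" using f by simp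
  show "AE x in lborel. norm ((norm (f x))\<^sup>2) \<le> norm (M * norm (f x))"
    using M order_trans[OF norm_ge_zero M] by (intro AE_I2) (auto simp: power2_eq_square abs_mult intro!: mult_right_mono)
qed

lemma mollified_props:
  assumes "mollified f"
  obtains M where "integrable lborel f" "\<And>x. norm (f x) \<le> M" "f \<in> borel_measurable borel" "integrable lborel (\<lambda>x. (norm (f x))\<^sup>2)"
proof -
  obtain r f0 M where f: "0 < r" "integrable lborel f0" "\<And>x. norm (f0 x) \<le> M" "f = mollify r f0"
    using assms by (auto simp: mollified_def)
  have i: "integrable lborel f" using f by (simp add: mollify_integrable)
  have b: "norm (f x) \<le> M" for x unfolding f(4) by (rule mollify_bounded) (use f in auto)
  show thesis using that[of M] i b bounded_integrable_L2[OF i b] by auto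
qed

text \<open>Each product is bounded by a sum of two squares, and both squares have majorants. Local
  uniformity in \<open>z\<close> gives continuity of the hull function, and the bound
  \<open>T\<close> common to all \<open>z0\<close> gives its boundedness.\<close>

lemma summand_majorant:
  assumes "mollified f1" "mollified f2"
  obtains m T where "\<And>z0. m z0 summable_on K \<times> \<Gamma>" "\<And>z0. (\<Sum>\<^sub>\<infinity>i\<in>K \<times> \<Gamma>. m z0 i) \<le> T"
    "\<And>z z0 i. i \<in> K \<times> \<Gamma> \<Longrightarrow> norm (fst z - fst z0) \<le> 1 \<Longrightarrow> \<bar>snd z - snd z0\<bar> \<le> 1 \<Longrightarrow> norm (summand f1 f2 z i) \<le> m z0 i"
proof -
  obtain r f0 M where f: "0 < r" "integrable lborel f0" "\<And>x. norm (f0 x) \<le> M" "f1 = mollify r f0"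
    using assms(1) by (auto simp: mollified_def)
  obtain r' f0' M' where f': "0 < r'" "integrable lborel f0'" "\<And>x. norm (f0' x) \<le> M'" "f2 = mollify r' f0'"
    using assms(2) by (auto simp: mollified_def)
  have fm: "f0 \<in> borel_measurable borel" "f0' \<in> borel_measurable borel" using f f' by auto
  note L2 = bounded_integrable_L2[OF f(2,3)] and L2' = bounded_integrable_L2[OF f'(2,3)]
  obtain T where T: "\<And>z0. G.majorant r f0 z0 summable_on K \<times> \<Gamma>" "\<And>z0. (\<Sum>\<^sub>\<infinity>i\<in>K \<times> \<Gamma>. G.majorant r f0 z0 i) \<le> T"
    using G.majorant_summable[OF f(1) fm(1) L2] by blast
  obtain T' where T': "\<And>z0. H.majorant r' f0' z0 summable_on K \<times> \<Gamma>" "\<And>z0. (\<Sum>\<^sub>\<infinity>i\<in>K \<times> \<Gamma>. H.majorant r' f0' z0 i) \<le> T'"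
    using H.majorant_summable[OF f'(1) fm(2) L2'] by blast
  show thesis
  proof (rule that[of "\<lambda>z0 i. G.majorant r f0 z0 i + H.majorant r' f0' z0 i" "T + T'"])
    show "(\<lambda>i. G.majorant r f0 z0 i + H.majorant r' f0' z0 i) summable_on K \<times> \<Gamma>" for z0
      using T T' by (intro summable_on_add)
    show "(\<Sum>\<^sub>\<infinity>i\<in>K \<times> \<Gamma>. G.majorant r f0 z0 i + H.majorant r' f0' z0 i) \<le> T + T'" for z0
      using T(1) T'(1) by (subst infsum_add) (auto intro!: add_mono T(2) T'(2) simp del: split_paired_All)
    fix z z0 :: "(real^'m) \<times> real" and i assume i: "i \<in> K \<times> \<Gamma>" and z: "norm (fst z - fst z0) \<le> 1" "\<bar>snd z - snd z0\<bar> \<le> 1"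
    obtain k \<gamma> where k: "i = (k, \<gamma>)" "k \<in> K" using i by auto
    have "norm (summand f1 f2 z i) = indicator {-a..a} (snd \<gamma> - snd z) * norm (corr f1 (g k) (fst \<gamma> - fst z) * cnj (corr f2 (h k) (fst \<gamma> - fst z)))"
      by (simp add: summand_def k)
    also have "\<dots> \<le> indicator {-a..a} (snd \<gamma> - snd z) * ((norm (corr f1 (g k) (fst \<gamma> - fst z)))\<^sup>2 + (norm (corr f2 (h k) (fst \<gamma> - fst z)))\<^sup>2)"
      by (intro mult_left_mono norm_mult_le_sum_power2) auto
    also have "\<dots> \<le> G.majorant r f0 z0 i + H.majorant r' f0' z0 i"
      using G.majorant_bound[OF f(1) fm(1) f(3) L2 k(2) z, of \<gamma>] H.majorant_bound[OF f'(1) fm(2) f'(3) L2' k(2) z, of \<gamma>]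
      unfolding k(1) f(4) f'(4) distrib_left by (rule add_mono)
    finally show "norm (summand f1 f2 z i) \<le> G.majorant r f0 z0 i + H.majorant r' f0' z0 i" .
  qed
qed

text \<open>Levels at which no lattice point sits on the boundary of the shifted window, so that no
  summand jumps there.\<close>

definition generic_level :: "real \<Rightarrow> bool" where
  "generic_level y \<longleftrightarrow> (\<forall>\<gamma>\<in>\<Gamma>. snd \<gamma> - y \<noteq> a \<and> snd \<gamma> - y \<noteq> - a)"

lemma isCont_cutoff:
  assumes "t \<noteq> a" "t \<noteq> - a"
  shows "isCont (indicator {-a..a} :: real \<Rightarrow> real) t"
  unfolding isCont_indicator
  using assms by (auto simp: frontier_def interior_atLeastAtMost_real)

lemma summand_isCont:
  assumes "mollified f1" "mollified f2" "generic_level (snd z0)" "i \<in> K \<times> \<Gamma>"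
  shows "isCont (\<lambda>z. summand f1 f2 z i) z0"
proof -
  obtain k \<gamma> where i: "i = (k, \<gamma>)" "k \<in> K" "\<gamma> \<in> \<Gamma>" using assms by auto
  obtain M where f1: "integrable lborel f1" "\<And>x. norm (f1 x) \<le> M" "f1 \<in> borel_measurable borel"
    using mollified_props[OF assms(1)] by metis
  obtain M' where f2: "integrable lborel f2" "\<And>x. norm (f2 x) \<le> M'" "f2 \<in> borel_measurable borel"
    using mollified_props[OF assms(2)] by metis
  have c1: "isCont (corr f1 (g k)) x" for x
    using corr_continuous_left[OF G.g1[OF i(2)] f1(3,2)] by (simp add: continuous_on_eq_continuous_at)
  have c2: "isCont (corr f2 (h k)) x" for x
    using corr_continuous_left[OF H.g1[OF i(2)] f2(3,2)] by (simp add: continuous_on_eq_continuous_at)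
  have "isCont (\<lambda>z. indicator {-a..a} (snd \<gamma> - snd z) :: real) z0"
    by (rule isCont_o2[where g="indicator {-a..a}" and f="\<lambda>z. snd \<gamma> - snd z"])
      (use assms(3) i(3) in \<open>auto intro!: isCont_cutoff continuous_intros simp: generic_level_def\<close>)
  moreover have "isCont (\<lambda>z. corr f1 (g k) (fst \<gamma> - fst z)) z0"
    by (rule isCont_o2[OF _ c1]) (intro continuous_intros)
  moreover have "isCont (\<lambda>z. corr f2 (h k) (fst \<gamma> - fst z)) z0"
    by (rule isCont_o2[OF _ c2]) (intro continuous_intros)
  ultimately show ?thesis unfolding summand_def i by (auto intro!: continuous_intros)
qed

lemma hull_form_isCont:
  assumes "mollified f1" "mollified f2" "generic_level (snd z0)"
  shows "isCont (hull_form f1 f2) z0"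
proof -
  obtain m T where m: "\<And>z0. m z0 summable_on K \<times> \<Gamma>"
    "\<And>z z0 i. i \<in> K \<times> \<Gamma> \<Longrightarrow> norm (fst z - fst z0) \<le> 1 \<Longrightarrow> \<bar>snd z - snd z0\<bar> \<le> 1 \<Longrightarrow> norm (summand f1 f2 z i) \<le> m z0 i"
    using summand_majorant[OF assms(1,2)] by metis
  have "norm (fst z - fst z0) \<le> 1 \<and> \<bar>snd z - snd z0\<bar> \<le> 1" if "z \<in> ball z0 1" for z
  proof -
    have "norm (z - z0) < 1" using that by (simp add: dist_norm norm_minus_commute)
    then show ?thesis
      using norm_fst_le[of "fst (z - z0)" "snd (z - z0)", unfolded prod.collapse] norm_snd_le[of "snd (z - z0)" "fst (z - z0)", unfolded prod.collapse] by simp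
  qed
  then show ?thesis
    unfolding hull_form_def[abs_def]
    by (intro isCont_infsum[where U="ball z0 1", OF _ _ _ m(1)[of z0]] summand_isCont assms) (auto intro!: m(2))
qed

lemma hull_form_summable:
  assumes "mollified f1" "mollified f2"
  shows "(\<lambda>i. norm (summand f1 f2 z i)) summable_on K \<times> \<Gamma>"
proof -
  obtain m T where m: "\<And>z0. m z0 summable_on K \<times> \<Gamma>"
    "\<And>z z0 i. i \<in> K \<times> \<Gamma> \<Longrightarrow> norm (fst z - fst z0) \<le> 1 \<Longrightarrow> \<bar>snd z - snd z0\<bar> \<le> 1 \<Longrightarrow> norm (summand f1 f2 z i) \<le> m z0 i"
    using summand_majorant[OF assms(1,2)] by metis
  show ?thesis
    by (rule summable_on_comparison_test[OF m(1)[of z]]) (use m(2) in auto)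
qed

lemma hull_form_bounded:
  assumes "mollified f1" "mollified f2"
  obtains T where "\<And>z. norm (hull_form f1 f2 z) \<le> T"
proof -
  obtain m T where m: "\<And>z0. m z0 summable_on K \<times> \<Gamma>" "\<And>z0. (\<Sum>\<^sub>\<infinity>i\<in>K \<times> \<Gamma>. m z0 i) \<le> T"
    "\<And>z z0 i. i \<in> K \<times> \<Gamma> \<Longrightarrow> norm (fst z - fst z0) \<le> 1 \<Longrightarrow> \<bar>snd z - snd z0\<bar> \<le> 1 \<Longrightarrow> norm (summand f1 f2 z i) \<le> m z0 i"
    using summand_majorant[OF assms(1,2)] by metis
  have "norm (hull_form f1 f2 z) \<le> T" for z
  proof -
    have "norm (hull_form f1 f2 z) \<le> (\<Sum>\<^sub>\<infinity>i\<in>K \<times> \<Gamma>. norm (summand f1 f2 z i))"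
      unfolding hull_form_def by (rule norm_infsum_bound[OF hull_form_summable[OF assms]])
    also have "\<dots> \<le> (\<Sum>\<^sub>\<infinity>i\<in>K \<times> \<Gamma>. m z i)"
      by (rule infsum_mono[OF hull_form_summable[OF assms] m(1)]) (use m(3) in auto)
    finally show ?thesis using m(2)[of z] by linarith
  qed
  then show thesis by (rule that)
qed

lemma hull_form_periodic:
  assumes "\<gamma>0 \<in> \<Gamma>"
  shows "hull_form f1 f2 (z + \<gamma>0) = hull_form f1 f2 z"
proof -
  have bij: "bij_betw (\<lambda>(k, \<gamma>). (k, \<gamma> + \<gamma>0)) (K \<times> \<Gamma>) (K \<times> \<Gamma>)"
    by (rule bij_betwI[where g="\<lambda>(k, \<gamma>). (k, \<gamma> - \<gamma>0)"]) (use assms in \<open>auto intro: G.lattice_add G.lattice_diff\<close>)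
  have "hull_form f1 f2 (z + \<gamma>0) = (\<Sum>\<^sub>\<infinity>i\<in>K \<times> \<Gamma>. summand f1 f2 (z + \<gamma>0) ((\<lambda>(k, \<gamma>). (k, \<gamma> + \<gamma>0)) i))"
    unfolding hull_form_def by (rule infsum_reindex_bij_betw[OF bij, symmetric])
  also have "\<dots> = hull_form f1 f2 z"
    unfolding hull_form_def by (rule infsum_cong) (auto simp: summand_def)
  finally show ?thesis .
qed

text \<open>At level 0 the window condition selects exactly the model set, and moving by
  \<open>x\<close> along this leaf amounts to translating both functions.\<close>

lemma hull_form_leaf:
  "hull_form f1 f2 (x, 0) = frame_form (\<lambda>t. f1 (t - x)) (\<lambda>t. f2 (t - x))"
proof -
  let ?S = "{\<gamma> \<in> \<Gamma>. snd \<gamma> \<in> {-a..a}}"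
  have "hull_form f1 f2 (x, 0) = (\<Sum>\<^sub>\<infinity>i\<in>K \<times> ?S. summand f1 f2 (x, 0) i)"
    unfolding hull_form_def by (rule infsum_cong_neutral) (auto simp: summand_def indicator_def)
  also have "\<dots> = (\<Sum>\<^sub>\<infinity>i\<in>K \<times> ?S. (\<lambda>(k, l). corr (\<lambda>t. f1 (t - x)) (g k) l * cnj (corr (\<lambda>t. f2 (t - x)) (h k) l)) ((\<lambda>(k, \<gamma>). (k, fst \<gamma>)) i))"
    by (rule infsum_cong) (auto simp: summand_def corr_shift)
  also have "\<dots> = frame_form (\<lambda>t. f1 (t - x)) (\<lambda>t. f2 (t - x))"
    unfolding frame_form_def
  proof (rule infsum_reindex_bij_betw)
    have "inj_on (\<lambda>(k, \<gamma>). (k, fst \<gamma>)) (K \<times> ?S)"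
      using G.inj_fst by (fastforce simp: inj_on_def)
    moreover have "(\<lambda>(k, \<gamma>). (k, fst \<gamma>)) ` (K \<times> ?S) = K \<times> model_set \<Gamma> {-a..a}"
      by (force simp: model_set_def image_iff)
    ultimately show "bij_betw (\<lambda>(k, \<gamma>). (k, fst \<gamma>)) (K \<times> ?S) (K \<times> model_set \<Gamma> {-a..a})"
      by (simp add: bij_betw_def)
  qed
  finally show ?thesis .
qed

end

section \<open>Fourier coefficients of the hull function\<close>

lemma integral_fst_snd:
  fixes u :: "'a::euclidean_space \<Rightarrow> complex" and v :: "'b::euclidean_space \<Rightarrow> complex"
  assumes u: "integrable lborel u" and v: "integrable lborel v"
  shows "integrable lborel (\<lambda>z. u (fst z) * v (snd z))"
    and "(LBINT z. u (fst z) * v (snd z)) = (LBINT x. u x) * (LBINT y. v y)"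
proof -
  have [measurable]: "u \<in> borel_measurable borel" "v \<in> borel_measurable borel" using u v by auto
  have i: "integrable (lborel \<Otimes>\<^sub>M lborel) (\<lambda>(x, y). u x * v y)"
  proof (rule lborel_pair.Fubini_integrable)
    show "integrable lborel (\<lambda>x. \<integral>y. norm (case (x, y) of (x, y) \<Rightarrow> u x * v y) \<partial>lborel)"
      using u by (simp add: norm_mult)
  qed (use v in auto)
  then show "integrable lborel (\<lambda>z. u (fst z) * v (snd z))"
    unfolding lborel_prod[symmetric] by (simp add: case_prod_unfold)
  show "(LBINT z. u (fst z) * v (snd z)) = (LBINT x. u x) * (LBINT y. v y)"
    using lborel_pair.integral_fst'[OF i] unfolding lborel_prod[symmetric] by (simp add: case_prod_unfold)
qed

text \<open>Plancherel applied to one correlation and a modulated second one: modulation by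
  \<open>p\<close> shifts the second transform by \<open>p\<close>, and correlations are products on
  the Fourier side.\<close>

lemma corr_spectral:
  fixes f1 f2 g h :: "'a::euclidean_space \<Rightarrow> complex"
  assumes f1: "integrable lborel f1" "\<And>x. norm (f1 x) \<le> M" and f2: "integrable lborel f2" "\<And>x. norm (f2 x) \<le> N"
    and g: "integrable lborel g" and h: "integrable lborel h"
  shows "(LBINT x. corr f1 g x * cnj (corr f2 h x) * ee (- (x \<bullet> p)))
    = (LBINT \<omega>. fourier f1 \<omega> * cnj (fourier f2 (\<omega> - p)) * (cnj (fourier g \<omega>) * fourier h (\<omega> - p)))"
proof -
  have [measurable]: "f1 \<in> borel_measurable borel" "f2 \<in> borel_measurable borel" "g \<in> borel_measurable borel" "h \<in> borel_measurable borel"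
    using f1 f2 g h by auto
  let ?u = "corr f1 g" and ?w = "\<lambda>x. corr f2 h x * ee (x \<bullet> p)"
  have u: "integrable lborel ?u" "\<And>x. norm (?u x) \<le> M * (LBINT t. norm (g t))"
    using corr_integrable[OF f1(1) g] corr_bounded_left[OF g _ f1(2)] by auto
  have w: "integrable lborel ?w" "\<And>x. norm (?w x) \<le> N * (LBINT t. norm (h t))"
    using integrable_mult_ee[OF corr_integrable[OF f2(1) h], of "\<lambda>x. x \<bullet> p"] corr_bounded_left[OF h _ f2(2)] by (auto simp: norm_mult)
  have Fw: "fourier ?w \<omega> = fourier f2 (\<omega> - p) * cnj (fourier h (\<omega> - p))" for \<omega>
  proof -
    have "fourier ?w \<omega> = fourier (corr f2 h) (\<omega> - p)"
      by (subst (1 2) fourier_lborel) (auto intro!: Bochner_Integration.integral_cong simp: inner_diff_right ee_diff ee_minus mult_ac)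
    then show ?thesis by (simp add: fourier_corr[OF f2(1) h])
  qed
  have "(LBINT x. corr f1 g x * cnj (corr f2 h x) * ee (- (x \<bullet> p))) = (LBINT x. ?u x * cnj (?w x))"
    by (simp add: ee_minus mult_ac)
  also have "\<dots> = (LBINT \<omega>. fourier ?u \<omega> * cnj (fourier ?w \<omega>))"
    by (rule plancherel[OF u w, symmetric])
  also have "\<dots> = (LBINT \<omega>. fourier f1 \<omega> * cnj (fourier f2 (\<omega> - p)) * (cnj (fourier g \<omega>) * fourier h (\<omega> - p)))"
    unfolding Fw fourier_corr[OF f1(1) g] by (simp add: mult_ac)
  finally show ?thesis .
qed

lemma plancherel_norm:
  fixes u :: "'a::euclidean_space \<Rightarrow> complex"
  assumes u: "integrable lborel u" "\<And>t. norm (u t) \<le> M"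
  shows "(LBINT \<omega>. (norm (fourier u \<omega>))\<^sup>2) = (LBINT t. (norm (u t))\<^sup>2)"
proof -
  have "complex_of_real (LBINT \<omega>. (norm (fourier u \<omega>))\<^sup>2) = of_real (LBINT t. (norm (u t))\<^sup>2)"
    using plancherel[OF u u] unfolding complex_norm_square[symmetric] of_real_power[symmetric] integral_complex_of_real .
  then show ?thesis by (simp only: of_real_eq_iff)
qed

context bessel_pair
begin

lemma mollified_corr_square:
  assumes "mollified f"
  shows "k \<in> K \<Longrightarrow> integrable lborel (\<lambda>x. (norm (corr f (g k) x))\<^sup>2)"
    "(\<lambda>k. \<integral>x. (norm (corr f (g k) x))\<^sup>2 \<partial>lborel) summable_on K"
    "k \<in> K \<Longrightarrow> integrable lborel (\<lambda>x. (norm (corr f (h k) x))\<^sup>2)"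
    "(\<lambda>k. \<integral>x. (norm (corr f (h k) x))\<^sup>2 \<partial>lborel) summable_on K"
proof -
  obtain M where f: "f \<in> borel_measurable borel" "integrable lborel (\<lambda>x. (norm (f x))\<^sup>2)"
    using mollified_props[OF assms] by metis
  show "k \<in> K \<Longrightarrow> integrable lborel (\<lambda>x. (norm (corr f (g k) x))\<^sup>2)"
    "(\<lambda>k. \<integral>x. (norm (corr f (g k) x))\<^sup>2 \<partial>lborel) summable_on K"
    "k \<in> K \<Longrightarrow> integrable lborel (\<lambda>x. (norm (corr f (h k) x))\<^sup>2)"
    "(\<lambda>k. \<integral>x. (norm (corr f (h k) x))\<^sup>2 \<partial>lborel) summable_on K"
    using G.corr_square_integral[OF f] H.corr_square_integral[OF f] by auto
qed

text \<open>The Fourier transform of the window's indicator; by evenness it is \<open>2 * a\<close>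
  times the value of \<Phi> at \<open>- t\<close>.\<close>

definition window_char :: "real \<Rightarrow> complex" where
  "window_char t = (LBINT y. indicator {-a..a} y *\<^sub>R ee (- (y * t)))"

lemma window_indicator_integrable: "integrable lborel (indicator {-a..a} :: real \<Rightarrow> real)"
  by (rule integrable_real_indicator) (use G.a in auto)

lemma coefficient_correlation:
  assumes n: "mollified f1" "mollified f2" and \<eta>: "\<eta> \<in> dual_lattice \<Gamma>"
  shows "((\<lambda>k. (LBINT x. corr f1 (g k) x * cnj (corr f2 (h k) x) * ee (- (x \<bullet> fst \<eta>))) * window_char (snd \<eta>))
      has_sum (LBINT z. indicator G.cell z *\<^sub>R hull_form f1 f2 z * ee (z \<bullet> \<eta>))) K"
    and "integrable lborel (\<lambda>z. indicator G.cell z *\<^sub>R hull_form f1 f2 z * ee (z \<bullet> \<eta>))"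
proof -
  define U where "U k x = corr f1 (g k) x * cnj (corr f2 (h k) x)" for k x
  \<comment> \<open>The function whose lattice translates add up to the contribution of
    \<open>k\<close> times the character. It is a product in the two coordinates; the minus signs
    occur because coefficients are taken at \<open>fst \<gamma> - fst z\<close>.\<close>
  define E where "E k z = (U k (- fst z) * ee (fst z \<bullet> fst \<eta>)) * (indicator {-a..a} (- snd z) *\<^sub>R ee (snd z * snd \<eta>))" for k z
  obtain M where f1: "f1 \<in> borel_measurable borel" using mollified_props[OF n(1)] by metis
  obtain M where f2: "f2 \<in> borel_measurable borel" using mollified_props[OF n(2)] by metis
  have Um: "U k \<in> borel_measurable borel" if "k \<in> K" for k
    unfolding U_def[abs_def] using corr_measurable[OF f1 G.gm[OF that]] corr_measurable[OF f2 H.gm[OF that]] by measurable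
  have iU: "integrable lborel (U k)" and nU: "(LBINT x. norm (U k x)) \<le> (LBINT x. (norm (corr f1 (g k) x))\<^sup>2) + (LBINT x. (norm (corr f2 (h k) x))\<^sup>2)" if k: "k \<in> K" for k
  proof -
    have s: "integrable lborel (\<lambda>x. (norm (corr f1 (g k) x))\<^sup>2 + (norm (corr f2 (h k) x))\<^sup>2)"
      using mollified_corr_square[OF n(1)] mollified_corr_square[OF n(2)] k by auto
    have le: "norm (U k x) \<le> (norm (corr f1 (g k) x))\<^sup>2 + (norm (corr f2 (h k) x))\<^sup>2" for x
      unfolding U_def by (rule norm_mult_le_sum_power2)
    show iU: "integrable lborel (U k)"
      by (rule Bochner_Integration.integrable_bound[OF s]) (use Um[OF k] le in \<open>auto intro!: AE_I2 order_trans[OF le]\<close>)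
    have "(LBINT x. norm (U k x)) \<le> (LBINT x. (norm (corr f1 (g k) x))\<^sup>2 + (norm (corr f2 (h k) x))\<^sup>2)"
      using iU s le by (intro integral_mono) auto
    then show "(LBINT x. norm (U k x)) \<le> (LBINT x. (norm (corr f1 (g k) x))\<^sup>2) + (LBINT x. (norm (corr f2 (h k) x))\<^sup>2)"
      using mollified_corr_square[OF n(1)] mollified_corr_square[OF n(2)] k by simp
  qed
  have sU: "(\<lambda>k. \<integral>x. norm (U k x) \<partial>lborel) summable_on K"
    by (rule summable_on_comparison_test[OF summable_on_add[OF mollified_corr_square(2)[OF n(1)] mollified_corr_square(4)[OF n(2)]]])
      (use nU in auto)
  have iu: "integrable lborel (\<lambda>x. U k (- x) * ee (x \<bullet> fst \<eta>))" if "k \<in> K" for k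
    by (rule integrable_mult_ee) (use integrable_lborel_shift(4)[of "U k" 0] iU[OF that] in auto)
  have iv: "integrable lborel (\<lambda>y. indicator {-a..a} (- y) *\<^sub>R ee (y * snd \<eta>))"
  proof -
    have "integrable lborel (\<lambda>y. complex_of_real (indicator {-a..a} (0 - y)) * ee (y * snd \<eta>))"
      by (rule integrable_mult_ee) (use integrable_lborel_shift(4)[of "indicator {-a..a} :: real \<Rightarrow> real" 0] window_indicator_integrable in auto)
    then show ?thesis by (simp add: scaleR_conv_of_real)
  qed
  have iE: "integrable lborel (E k)" if "k \<in> K" for k
    unfolding E_def by (rule integral_fst_snd(1)[OF iu[OF that] iv])
  have intE: "(LBINT z. E k z) = (LBINT x. U k x * ee (- (x \<bullet> fst \<eta>))) * window_char (snd \<eta>)" if "k \<in> K" for k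
  proof -
    have "(LBINT z. E k z) = (LBINT x. U k (- x) * ee (x \<bullet> fst \<eta>)) * (LBINT y. indicator {-a..a} (- y) *\<^sub>R ee (y * snd \<eta>))"
      unfolding E_def by (rule integral_fst_snd(2)[OF iu[OF that] iv])
    also have "(LBINT x. U k (- x) * ee (x \<bullet> fst \<eta>)) = (LBINT x. U k x * ee (- (x \<bullet> fst \<eta>)))"
      using integral_lborel_shift(4)[of "\<lambda>x. U k x * ee (- (x \<bullet> fst \<eta>))" 0] by simp
    also have "(LBINT y. indicator {-a..a} (- y) *\<^sub>R ee (y * snd \<eta>)) = window_char (snd \<eta>)"
      unfolding window_char_def using integral_lborel_shift(4)[of "\<lambda>y. indicator {-a..a} y *\<^sub>R ee (- (y * snd \<eta>))" 0] by simp
    finally show ?thesis .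
  qed
  have nE: "(LBINT z. norm (E k z)) = 2 * a * (LBINT x. norm (U k x))" if k: "k \<in> K" for k
  proof -
    have i1: "integrable lborel (\<lambda>x. complex_of_real (norm (U k (- x))))"
      using integrable_lborel_shift(4)[of "U k" 0] iU[OF k] by auto
    have i2: "integrable lborel (\<lambda>y. complex_of_real (indicator {-a..a} (- y)))"
      using integrable_lborel_shift(4)[of "indicator {-a..a} :: real \<Rightarrow> real" 0] window_indicator_integrable by auto
    have "complex_of_real (LBINT z. norm (E k z)) = (LBINT z. complex_of_real (norm (U k (- fst z))) * complex_of_real (indicator {-a..a} (- snd z)))"
      unfolding integral_complex_of_real[symmetric] E_def by (intro Bochner_Integration.integral_cong) (auto simp: norm_mult)
    also have "\<dots> = (LBINT x. complex_of_real (norm (U k (- x)))) * (LBINT y. complex_of_real (indicator {-a..a} (- y)))"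
      by (rule integral_fst_snd(2)[OF i1 i2])
    also have "\<dots> = of_real ((LBINT x. norm (U k (- x))) * (LBINT y. indicator {-a..a} (- y)))"
      by (simp only: integral_complex_of_real of_real_mult)
    also have "(LBINT x. norm (U k (- x))) = (LBINT x. norm (U k x))"
      using integral_lborel_shift(4)[of "\<lambda>x. norm (U k x)" 0] by simp
    also have "(LBINT y. indicator {-a..a} (- y)) = 2 * a"
      using integral_lborel_shift(4)[of "indicator {-a..a} :: real \<Rightarrow> real" 0] G.a by simp
    finally show ?thesis by (simp only: of_real_eq_iff mult.commute)
  qed
  \<comment> \<open>For \<eta> in the dual lattice the character does not see \<gamma>, so it may be
    evaluated at \<open>z - \<gamma>\<close>.\<close>
  have eq: "summand f1 f2 z (k, \<gamma>) * ee (z \<bullet> \<eta>) = E k (z - \<gamma>)" if "\<gamma> \<in> \<Gamma>" for z k \<gamma>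
    unfolding G.dual_ee[OF that \<eta>, symmetric, of z]
    by (simp add: summand_def E_def U_def inner_prod_def ee_add)
  define F where "F = (\<lambda>(k, \<gamma>) z. indicator G.cell z *\<^sub>R E k (z - \<gamma>))"
  have Fi: "integrable lborel (F i)" if "i \<in> K \<times> \<Gamma>" for i
    using that G.integral_unfold_cell(4)[OF iE] by (auto simp: F_def)
  \<comment> \<open>Unfolding bounds the lattice sum for one \<open>k\<close> by the L1 norm of
    \<open>E k\<close>, which is \<open>2 * a\<close> times that of \<open>U k\<close>; the latter
    is controlled by squared correlations and hence summable over \<open>K\<close>.\<close>
  have Fs: "(\<lambda>i. \<integral>z. norm (F i z) \<partial>lborel) summable_on K \<times> \<Gamma>"
  proof (rule nonneg_bdd_above_summable_on)
    show "bdd_above (sum (\<lambda>i. \<integral>z. norm (F i z) \<partial>lborel) ` {A. A \<subseteq> K \<times> \<Gamma> \<and> finite A})"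
    proof (rule bdd_aboveI2)
      fix A assume A: "A \<in> {A. A \<subseteq> K \<times> \<Gamma> \<and> finite A}"
      have "(\<Sum>i\<in>A. \<integral>z. norm (F i z) \<partial>lborel) \<le> (\<Sum>i\<in>fst ` A \<times> snd ` A. \<integral>z. norm (F i z) \<partial>lborel)"
        using A by (intro sum_mono2 subset_fst_snd) auto
      also have "\<dots> = (\<Sum>k\<in>fst ` A. \<Sum>\<gamma>\<in>snd ` A. \<integral>z. norm (indicator G.cell z *\<^sub>R E k (z - \<gamma>)) \<partial>lborel)"
        by (simp add: sum.cartesian_product F_def case_prod_unfold)
      also have "\<dots> \<le> (\<Sum>k\<in>fst ` A. 2 * a * (LBINT x. norm (U k x)))"
      proof (rule sum_mono)
        fix k assume "k \<in> fst ` A"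
        then have k: "k \<in> K" using A by auto
        have "(\<Sum>\<gamma>\<in>snd ` A. \<integral>z. norm (indicator G.cell z *\<^sub>R E k (z - \<gamma>)) \<partial>lborel)
           \<le> (\<Sum>\<^sub>\<infinity>\<gamma>\<in>\<Gamma>. \<integral>z. norm (indicator G.cell z *\<^sub>R E k (z - \<gamma>)) \<partial>lborel)"
          using A by (intro finite_sum_le_infsum G.integral_unfold_cell(2)[OF iE[OF k]]) auto
        also have "\<dots> \<le> (LBINT z. norm (E k z))" by (rule G.integral_unfold_cell(3)[OF iE[OF k]])
        finally show "(\<Sum>\<gamma>\<in>snd ` A. \<integral>z. norm (indicator G.cell z *\<^sub>R E k (z - \<gamma>)) \<partial>lborel) \<le> 2 * a * (LBINT x. norm (U k x))"
          by (simp only: nE[OF k])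
      qed
      also have "\<dots> = 2 * a * (\<Sum>k\<in>fst ` A. \<integral>x. norm (U k x) \<partial>lborel)" by (simp add: sum_distrib_left)
      also have "\<dots> \<le> 2 * a * (\<Sum>\<^sub>\<infinity>k\<in>K. \<integral>x. norm (U k x) \<partial>lborel)"
        using A G.a by (intro mult_left_mono finite_sum_le_infsum sU) auto
      finally show "(\<Sum>i\<in>A. \<integral>z. norm (F i z) \<partial>lborel) \<le> 2 * a * (\<Sum>\<^sub>\<infinity>k\<in>K. \<integral>x. norm (U k x) \<partial>lborel)" .
    qed
  qed auto
  have infF: "(\<Sum>\<^sub>\<infinity>i\<in>K \<times> \<Gamma>. F i z) = indicator G.cell z *\<^sub>R hull_form f1 f2 z * ee (z \<bullet> \<eta>)" for z
  proof -
    have "(\<Sum>\<^sub>\<infinity>i\<in>K \<times> \<Gamma>. F i z) = (\<Sum>\<^sub>\<infinity>i\<in>K \<times> \<Gamma>. summand f1 f2 z i * (indicator G.cell z *\<^sub>R ee (z \<bullet> \<eta>)))"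
      by (rule infsum_cong) (auto simp: F_def eq[symmetric])
    also have "\<dots> = hull_form f1 f2 z * (indicator G.cell z *\<^sub>R ee (z \<bullet> \<eta>))"
      unfolding hull_form_def by (rule infsum_cmult_left')
    finally show ?thesis by simp
  qed
  have cI: "countable (K \<times> \<Gamma>)" using K G.lattice_countable by simp
  note II = infsum_integral[OF cI Fi Fs]
  show "integrable lborel (\<lambda>z. indicator G.cell z *\<^sub>R hull_form f1 f2 z * ee (z \<bullet> \<eta>))"
    using II(2) by (simp only: infF)
  have "((\<lambda>i. \<integral>z. F i z \<partial>lborel) has_sum (LBINT z. indicator G.cell z *\<^sub>R hull_form f1 f2 z * ee (z \<bullet> \<eta>))) (K \<times> \<Gamma>)"
    using II(3) by (simp only: infF)
  moreover have "((\<lambda>\<gamma>. \<integral>z. F (k, \<gamma>) z \<partial>lborel) has_sum ((LBINT x. U k x * ee (- (x \<bullet> fst \<eta>))) * window_char (snd \<eta>))) \<Gamma>"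
    if "k \<in> K" for k
    using G.integral_unfold_cell(1)[OF iE[OF that]] intE[OF that] by (simp add: F_def)
  ultimately have "((\<lambda>k. (LBINT x. U k x * ee (- (x \<bullet> fst \<eta>))) * window_char (snd \<eta>))
      has_sum (LBINT z. indicator G.cell z *\<^sub>R hull_form f1 f2 z * ee (z \<bullet> \<eta>))) K"
    by (rule has_sum_SigmaD)
  then show "((\<lambda>k. (LBINT x. corr f1 (g k) x * cnj (corr f2 (h k) x) * ee (- (x \<bullet> fst \<eta>))) * window_char (snd \<eta>))
      has_sum (LBINT z. indicator G.cell z *\<^sub>R hull_form f1 f2 z * ee (z \<bullet> \<eta>))) K"
    by (simp only: U_def)
qed

definition symbol :: "(real^'m) \<Rightarrow> real^'m \<Rightarrow> complex" where
  "symbol p t = (\<Sum>\<^sub>\<infinity>k\<in>K. cnj (fourier (g k) t) * fourier (h k) (t - p))"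

text \<open>Termwise in \<open>k\<close> this is \<open>corr_spectral\<close>. Plancherel carries
  the summable bounds for squared correlations to the frequency side, so the sum over
  \<open>K\<close> may also be taken under the frequency integral, where it becomes the
  symbol.\<close>

lemma coefficient_symbol:
  assumes n: "mollified f1" "mollified f2" and \<eta>: "\<eta> \<in> dual_lattice \<Gamma>"
  shows "(LBINT z. indicator G.cell z *\<^sub>R hull_form f1 f2 z * ee (z \<bullet> \<eta>))
      = (LBINT \<omega>. fourier f1 \<omega> * cnj (fourier f2 (\<omega> - fst \<eta>)) * symbol (fst \<eta>) \<omega>) * window_char (snd \<eta>)"
    and "integrable lborel (\<lambda>\<omega>. fourier f1 \<omega> * cnj (fourier f2 (\<omega> - fst \<eta>)) * symbol (fst \<eta>) \<omega>)"
proof -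
  let ?p = "fst \<eta>"
  obtain M where f1: "integrable lborel f1" "\<And>x. norm (f1 x) \<le> M" "f1 \<in> borel_measurable borel" using mollified_props[OF n(1)] by metis
  obtain N where f2: "integrable lborel f2" "\<And>x. norm (f2 x) \<le> N" "f2 \<in> borel_measurable borel" using mollified_props[OF n(2)] by metis
  note [measurable] = f1(3) f2(3)
  define A where "A k \<omega> = fourier f1 \<omega> * cnj (fourier f2 (\<omega> - ?p)) * (cnj (fourier (g k) \<omega>) * fourier (h k) (\<omega> - ?p))" for k \<omega>
  have Ai: "integrable lborel (A k)" and An: "(LBINT \<omega>. norm (A k \<omega>)) \<le> (LBINT x. (norm (corr f1 (g k) x))\<^sup>2) + (LBINT x. (norm (corr f2 (h k) x))\<^sup>2)" if k: "k \<in> K" for k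
  proof -
    note [measurable] = G.gm[OF k] H.gm[OF k]
    have b1: "norm (corr f1 (g k) x) \<le> M * (LBINT t. norm (g k t))" for x
      by (rule corr_bounded_left[OF G.g1[OF k] f1(3,2)])
    have b2: "norm (corr f2 (h k) x) \<le> N * (LBINT t. norm (h k t))" for x
      by (rule corr_bounded_left[OF H.g1[OF k] f2(3,2)])
    note c1 = corr_integrable[OF f1(1) G.g1[OF k]] and c2 = corr_integrable[OF f2(1) H.g1[OF k]]
    have i1: "integrable lborel (\<lambda>\<omega>. (norm (fourier (corr f1 (g k)) \<omega>))\<^sup>2)" by (rule fourier_L2[OF c1 b1])
    have i2: "integrable lborel (\<lambda>\<omega>. (norm (fourier (corr f2 (h k)) (\<omega> - ?p)))\<^sup>2)"
      using integrable_lborel_shift(2)[of "\<lambda>\<omega>. (norm (fourier (corr f2 (h k)) \<omega>))\<^sup>2" ?p] fourier_L2[OF c2 b2] by simp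
    have A: "A k \<omega> = fourier (corr f1 (g k)) \<omega> * cnj (fourier (corr f2 (h k)) (\<omega> - ?p))" for \<omega>
      by (simp add: A_def fourier_corr[OF f1(1) G.g1[OF k]] fourier_corr[OF f2(1) H.g1[OF k]] mult_ac)
    have le: "norm (A k \<omega>) \<le> (norm (fourier (corr f1 (g k)) \<omega>))\<^sup>2 + (norm (fourier (corr f2 (h k)) (\<omega> - ?p)))\<^sup>2" for \<omega>
      unfolding A by (rule norm_mult_le_sum_power2)
    show Ai: "integrable lborel (A k)"
      by (rule Bochner_Integration.integrable_bound[OF Bochner_Integration.integrable_add[OF i1 i2]])
        (use le in \<open>auto intro!: AE_I2 order_trans[OF le] simp: A_def[abs_def]\<close>)
    have "(LBINT \<omega>. norm (A k \<omega>)) \<le> (LBINT \<omega>. (norm (fourier (corr f1 (g k)) \<omega>))\<^sup>2 + (norm (fourier (corr f2 (h k)) (\<omega> - ?p)))\<^sup>2)"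
      using Ai i1 i2 le by (intro integral_mono) auto
    also have "\<dots> = (LBINT \<omega>. (norm (fourier (corr f1 (g k)) \<omega>))\<^sup>2) + (LBINT \<omega>. (norm (fourier (corr f2 (h k)) (\<omega> - ?p)))\<^sup>2)"
      by (rule Bochner_Integration.integral_add[OF i1 i2])
    also have "(LBINT \<omega>. (norm (fourier (corr f2 (h k)) (\<omega> - ?p)))\<^sup>2) = (LBINT \<omega>. (norm (fourier (corr f2 (h k)) \<omega>))\<^sup>2)"
      by (rule integral_lborel_shift)
    finally show "(LBINT \<omega>. norm (A k \<omega>)) \<le> (LBINT x. (norm (corr f1 (g k) x))\<^sup>2) + (LBINT x. (norm (corr f2 (h k) x))\<^sup>2)"
      by (simp only: plancherel_norm[OF c1 b1] plancherel_norm[OF c2 b2])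
  qed
  have As: "(\<lambda>k. \<integral>\<omega>. norm (A k \<omega>) \<partial>lborel) summable_on K"
    by (rule summable_on_comparison_test[OF summable_on_add[OF mollified_corr_square(2)[OF n(1)] mollified_corr_square(4)[OF n(2)]]])
      (use An in auto)
  have infA: "(\<Sum>\<^sub>\<infinity>k\<in>K. A k \<omega>) = fourier f1 \<omega> * cnj (fourier f2 (\<omega> - ?p)) * symbol ?p \<omega>" for \<omega>
    unfolding A_def symbol_def by (rule infsum_cmult_right')
  note II = infsum_integral[OF K Ai As]
  show "integrable lborel (\<lambda>\<omega>. fourier f1 \<omega> * cnj (fourier f2 (\<omega> - ?p)) * symbol ?p \<omega>)"
    using II(2) by (simp only: infA)
  have "((\<lambda>k. (LBINT \<omega>. A k \<omega>) * window_char (snd \<eta>)) has_sum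
      (LBINT \<omega>. fourier f1 \<omega> * cnj (fourier f2 (\<omega> - ?p)) * symbol ?p \<omega>) * window_char (snd \<eta>)) K"
    using has_sum_cmult_left[OF II(3), of "window_char (snd \<eta>)"] by (simp only: infA)
  moreover have "((\<lambda>k. (LBINT \<omega>. A k \<omega>) * window_char (snd \<eta>)) has_sum
      (LBINT z. indicator G.cell z *\<^sub>R hull_form f1 f2 z * ee (z \<bullet> \<eta>))) K"
    using coefficient_correlation(1)[OF n \<eta>]
    by (rule has_sum_cong[THEN iffD1, rotated]) (simp add: A_def corr_spectral[OF f1(1,2) f2(1,2) G.g1 H.g1])
  ultimately show "(LBINT z. indicator G.cell z *\<^sub>R hull_form f1 f2 z * ee (z \<bullet> \<eta>))
      = (LBINT \<omega>. fourier f1 \<omega> * cnj (fourier f2 (\<omega> - fst \<eta>)) * symbol (fst \<eta>) \<omega>) * window_char (snd \<eta>)"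
    by (rule has_sum_unique[rotated])
qed

end

section \<open>Density of mollified functions and extension of the form to L2\<close>

definition square_integrable :: "('a::euclidean_space \<Rightarrow> complex) \<Rightarrow> bool" where
  "square_integrable f \<longleftrightarrow> f \<in> borel_measurable borel \<and> integrable lborel (\<lambda>x. (norm (f x))\<^sup>2)"

lemma norm_add_power2_le: "(norm (x + y))\<^sup>2 \<le> 2 * (norm x)\<^sup>2 + 2 * (norm y)\<^sup>2"
  for x y :: "'b::real_normed_vector"
proof -
  have "(norm (x + y))\<^sup>2 \<le> (norm x + norm y)\<^sup>2" by (intro power_mono norm_triangle_ineq) auto
  also have "\<dots> \<le> 2 * (norm x)\<^sup>2 + 2 * (norm y)\<^sup>2"
    using zero_le_power2[of "norm x - norm y"] by (simp add: power2_sum power2_diff)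
  finally show ?thesis .
qed

lemma square_integrable_add:
  assumes "square_integrable u" "square_integrable v"
  shows "square_integrable (\<lambda>x. u x + v x)"
proof -
  have [measurable]: "u \<in> borel_measurable borel" "v \<in> borel_measurable borel" using assms by (auto simp: square_integrable_def)
  have "integrable lborel (\<lambda>x. (norm (u x + v x))\<^sup>2)"
  proof (rule Bochner_Integration.integrable_bound)
    show "integrable lborel (\<lambda>x. 2 * (norm (u x))\<^sup>2 + 2 * (norm (v x))\<^sup>2)" using assms by (auto simp: square_integrable_def)
    show "AE x in lborel. norm ((norm (u x + v x))\<^sup>2) \<le> norm (2 * (norm (u x))\<^sup>2 + 2 * (norm (v x))\<^sup>2)"
      by (intro AE_I2) (simp add: norm_add_power2_le)
  qed measurable
  then show ?thesis by (simp add: square_integrable_def)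
qed

lemma square_integrable_cmult: "square_integrable u \<Longrightarrow> square_integrable (\<lambda>x. c * u x)"
  by (auto simp: square_integrable_def norm_mult power_mult_distrib)

lemma square_integrable_diff: "square_integrable u \<Longrightarrow> square_integrable v \<Longrightarrow> square_integrable (\<lambda>x. u x - v x)"
  using square_integrable_add[of u "\<lambda>x. (-1) * v x"] square_integrable_cmult[of v "-1"] by simp

lemma square_integrable_shift: "square_integrable u \<Longrightarrow> square_integrable (\<lambda>x. u (x - s))"
  using integrable_lborel_shift(2)[of "\<lambda>x. (norm (u x))\<^sup>2" s] by (auto simp: square_integrable_def)

lemma square_integrable_mult:
  assumes "square_integrable u" "square_integrable v"
  shows "integrable lborel (\<lambda>x. u x * cnj (v x))"
  using assms by (intro L2_mult_integrable) (auto simp: square_integrable_def)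

lemma corr_add_left:
  assumes "square_integrable u" "square_integrable v" "square_integrable g"
  shows "corr (\<lambda>t. u t + v t) g x = corr u g x + corr v g x"
  unfolding corr_def distrib_right
  by (intro Bochner_Integration.integral_add square_integrable_mult square_integrable_shift assms)

lemma corr_cmult_left: "corr (\<lambda>t. c * u t) g x = c * corr u g x"
  unfolding corr_def mult.assoc by simp

text \<open>Large arguments and large values are cut off together, so the approximant is both
  bounded and integrable; dominated convergence gives the L2 distance.\<close>

lemma truncation_approx:
  assumes f: "square_integrable f" and "0 < e"
  obtains f0 M where "integrable lborel f0" "\<And>x. norm (f0 x) \<le> M" "(LBINT x. (norm (f x - f0 x))\<^sup>2) < e"
proof -
  have [measurable]: "f \<in> borel_measurable borel" and i: "integrable lborel (\<lambda>x. (norm (f x))\<^sup>2)"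
    using f by (auto simp: square_integrable_def)
  have [measurable]: "ball 0 x \<in> sets (borel :: 'a measure)" for x by simp
  define T where "T n x = (if norm (f x) \<le> n then indicator (ball 0 n) x *\<^sub>R f x else 0)" for n :: real and x
  have Tm [measurable]: "T n \<in> borel_measurable borel" for n unfolding T_def[abs_def] by measurable
  have "(\<lambda>n. \<integral>x. (norm (f x - T (real n) x))\<^sup>2 \<partial>lborel) \<longlonglongrightarrow> (\<integral>x. 0 \<partial>(lborel :: 'a measure))"
  proof (rule integral_dominated_convergence[where w="\<lambda>x. (norm (f x))\<^sup>2"])
    show "AE x in lborel. (\<lambda>n. (norm (f x - T (real n) x))\<^sup>2) \<longlonglongrightarrow> 0"
    proof (rule AE_I2)
      fix x
      obtain N :: nat where N: "norm x + norm (f x) < N" using reals_Archimedean2 by blast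
      show "(\<lambda>n. (norm (f x - T (real n) x))\<^sup>2) \<longlonglongrightarrow> 0"
      proof (rule tendsto_eventually, rule eventually_mono[OF eventually_ge_at_top[of N]])
        fix n assume "N \<le> n"
        then have "norm x < n" "norm (f x) \<le> n" using N norm_ge_zero[of x] norm_ge_zero[of "f x"] by linarith+
        then show "(norm (f x - T (real n) x))\<^sup>2 = 0" by (simp add: T_def)
      qed
    qed
    show "AE x in lborel. norm ((norm (f x - T (real n) x))\<^sup>2) \<le> (norm (f x))\<^sup>2" for n
      by (intro AE_I2) (auto simp: T_def indicator_def)
  qed (use i in auto)
  then have "\<forall>\<^sub>F n in sequentially. (LBINT x. (norm (f x - T (real n) x))\<^sup>2) < e"
    using \<open>0 < e\<close> by (intro order_tendstoD) auto
  then obtain n :: nat where n: "(LBINT x. (norm (f x - T (real n) x))\<^sup>2) < e"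
    by (auto simp: eventually_sequentially)
  show thesis
  proof (rule that[OF _ _ n])
    show "norm (T (real n) x) \<le> real n" for x by (auto simp: T_def indicator_def)
    show "integrable lborel (T (real n))"
    proof (rule Bochner_Integration.integrable_bound)
      show "integrable lborel (\<lambda>x::'a. real n * indicator (ball 0 (real n)) x)"
        by (intro integrable_mult_right ball_indicator_integrable)
      show "AE x in lborel. norm (T (real n) x) \<le> norm (real n * indicator (ball 0 (real n)) x)"
        by (intro AE_I2) (auto simp: T_def indicator_def)
    qed measurable
  qed
qed

text \<open>Continuity of translation is available in L1 only. Since both functions are bounded by
  \<open>M'\<close>, the squared difference is at most \<open>2 * M'\<close> times the difference,
  and L1 closeness becomes L2 closeness.\<close>

lemma mollify_approx:
  fixes f0 :: "'a::euclidean_space \<Rightarrow> complex"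
  assumes f0: "integrable lborel f0" "\<And>x. norm (f0 x) \<le> M" and "0 < e"
  obtains r where "0 < r" "(LBINT x. (norm (f0 x - mollify r f0 x))\<^sup>2) \<le> e"
proof -
  have f0m: "f0 \<in> borel_measurable borel" using f0 by auto
  \<comment> \<open>Strictly positive even if \<open>M\<close> is 0, so that
    \<open>e / (2 * M')\<close> is an admissible tolerance.\<close>
  define M' where "M' = M + 1"
  have M': "0 < M'" "\<And>x. norm (f0 x) \<le> M'"
    using order_trans[OF norm_ge_zero f0(2)] f0(2) by (auto simp: M'_def intro: order_trans[OF f0(2)])
  obtain d where d: "0 < d" "\<And>s. norm s < d \<Longrightarrow> (LBINT t. norm (f0 (t - s) - f0 t)) < e / (2 * M')"
    using L1_translation_small[OF f0(1), of "e / (2 * M')"] \<open>0 < e\<close> M' by auto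
  have si: "integrable lborel (mollify d f0)" by (rule mollify_integrable[OF f0(1) d(1)])
  have sb: "norm (mollify d f0 x) \<le> M'" for x by (rule mollify_bounded[OF d(1) f0m M'(2)])
  have l1: "(LBINT x. norm (mollify d f0 x - f0 x)) \<le> e / (2 * M')"
    unfolding mollify_def
    by (rule L1_dist_average_le(2)[OF f0(1) average_kernel(1-3)[OF d(1)]]) (use d(2) average_kernel(4)[OF d(1)] in \<open>auto intro: less_imp_le\<close>)
  have le: "(norm (f0 x - mollify d f0 x))\<^sup>2 \<le> 2 * M' * norm (mollify d f0 x - f0 x)" for x
  proof -
    have "norm (f0 x - mollify d f0 x) \<le> 2 * M'"
      using norm_triangle_ineq4[of "f0 x" "mollify d f0 x"] M'(2)[of x] sb[of x] by linarith
    then show ?thesis unfolding power2_eq_square norm_minus_commute[of "f0 x"] by (intro mult_right_mono) auto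
  qed
  have "(LBINT x. (norm (f0 x - mollify d f0 x))\<^sup>2) \<le> (LBINT x. 2 * M' * norm (mollify d f0 x - f0 x))"
    using si f0 le M'(1) by (intro integral_mono') auto
  also have "\<dots> \<le> 2 * M' * (e / (2 * M'))"
    using l1 M' by (subst integral_mult_right_zero) (intro mult_left_mono, auto)
  also have "\<dots> = e" using M' by simp
  finally show thesis by (rule that[OF d(1)])
qed

context bessel_pair
begin

lemma mollified_square_integrable: "mollified f \<Longrightarrow> square_integrable f"
  by (erule mollified_props) (simp add: square_integrable_def)

lemma mollified_dense:
  assumes f: "square_integrable f" and "0 < e"
  obtains f' where "mollified f'" "(LBINT x. (norm (f x - f' x))\<^sup>2) \<le> e"
proof -
  obtain f0 M where f0: "integrable lborel f0" "\<And>x. norm (f0 x) \<le> M" "(LBINT x. (norm (f x - f0 x))\<^sup>2) < e / 4"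
    using truncation_approx[OF f, of "e / 4"] \<open>0 < e\<close> by auto
  obtain r where r: "0 < r" "(LBINT x. (norm (f0 x - mollify r f0 x))\<^sup>2) \<le> e / 4"
    using mollify_approx[OF f0(1,2), of "e / 4"] \<open>0 < e\<close> by auto
  have n: "mollified (mollify r f0)" unfolding mollified_def using f0(1,2) r(1) by blast
  have s0: "square_integrable f0" using f0(1) bounded_integrable_L2[OF f0(1,2)] by (auto simp: square_integrable_def)
  have i1: "integrable lborel (\<lambda>x. (norm (f x - f0 x))\<^sup>2)"
    using square_integrable_diff[OF f s0] by (simp add: square_integrable_def)
  have i2: "integrable lborel (\<lambda>x. (norm (f0 x - mollify r f0 x))\<^sup>2)"
    using square_integrable_diff[OF s0 mollified_square_integrable[OF n]] by (simp add: square_integrable_def)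
  have "(LBINT x. (norm (f x - mollify r f0 x))\<^sup>2) \<le> (LBINT x. 2 * (norm (f x - f0 x))\<^sup>2 + 2 * (norm (f0 x - mollify r f0 x))\<^sup>2)"
  proof (rule integral_mono')
    show "(norm (f x - mollify r f0 x))\<^sup>2 \<le> 2 * (norm (f x - f0 x))\<^sup>2 + 2 * (norm (f0 x - mollify r f0 x))\<^sup>2" for x
      using norm_add_power2_le[of "f x - f0 x" "f0 x - mollify r f0 x"] by simp
  qed (use i1 i2 in auto)
  also have "\<dots> \<le> e" using i1 i2 f0(3) r(2) by simp
  finally show thesis by (rule that[OF n])
qed

lemma generators_square_integrable: "k \<in> K \<Longrightarrow> square_integrable (g k)" "k \<in> K \<Longrightarrow> square_integrable (h k)"
  using G.gm G.g2 H.gm H.g2 by (auto simp: square_integrable_def)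

abbreviation "\<Lambda> \<equiv> model_set \<Gamma> {-a..a}"

text \<open>The free weight \<open>s\<close> plays the part of Cauchy-Schwarz: it can be chosen to
  favour whichever of the two functions is small.\<close>

lemma frame_sum_le:
  assumes u: "square_integrable u" and v: "square_integrable v" and s: "0 < s"
    and F: "finite F" "F \<subseteq> K \<times> \<Lambda>"
  shows "(\<Sum>(k, l)\<in>F. norm (corr u (g k) l * cnj (corr v (h k) l)))
     \<le> C * (LBINT x. (norm (u x))\<^sup>2) / s + s * (C' * (LBINT x. (norm (v x))\<^sup>2))"
proof -
  have le: "norm (x * cnj y) \<le> (norm x)\<^sup>2 / s + s * (norm y)\<^sup>2" for x y :: complex
  proof -
    have "norm x * norm y = (norm x / sqrt s) * (sqrt s * norm y)" using s by simp
    also have "\<dots> \<le> (norm x / sqrt s)\<^sup>2 + (sqrt s * norm y)\<^sup>2" by (rule mult_le_sum_power2)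
    also have "\<dots> = (norm x)\<^sup>2 / s + s * (norm y)\<^sup>2" using s by (simp add: power_divide power_mult_distrib)
    finally show ?thesis by (simp add: norm_mult)
  qed
  have "(\<Sum>(k, l)\<in>F. norm (corr u (g k) l * cnj (corr v (h k) l)))
    \<le> (\<Sum>(k, l)\<in>F. (norm (corr u (g k) l))\<^sup>2 / s + s * (norm (corr v (h k) l))\<^sup>2)"
    by (intro sum_mono) (auto intro: le)
  also have "\<dots> = (\<Sum>(k, l)\<in>F. (norm (corr u (g k) l))\<^sup>2) / s + s * (\<Sum>(k, l)\<in>F. (norm (corr v (h k) l))\<^sup>2)"
    by (simp add: sum.distrib sum_divide_distrib sum_distrib_left case_prod_unfold)
  also have "\<dots> \<le> C * (LBINT x. (norm (u x))\<^sup>2) / s + s * (C' * (LBINT x. (norm (v x))\<^sup>2))"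
    using u v s F by (intro add_mono divide_right_mono mult_left_mono G.bessel H.bessel) (auto simp: square_integrable_def)
  finally show ?thesis .
qed

lemma frame_norms_summable:
  assumes "square_integrable u" "square_integrable v"
  shows "(\<lambda>(k, l). norm (corr u (g k) l * cnj (corr v (h k) l))) summable_on K \<times> \<Lambda>"
proof (rule nonneg_bdd_above_summable_on)
  show "bdd_above (sum (\<lambda>(k, l). norm (corr u (g k) l * cnj (corr v (h k) l))) ` {F. F \<subseteq> K \<times> \<Lambda> \<and> finite F})"
    by (rule bdd_aboveI2) (use frame_sum_le[OF assms, of 1] in auto)
qed auto

lemma frame_form_le:
  assumes "square_integrable u" "square_integrable v" "0 < s"
  shows "norm (frame_form u v) \<le> C * (LBINT x. (norm (u x))\<^sup>2) / s + s * (C' * (LBINT x. (norm (v x))\<^sup>2))"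
proof -
  have "norm (frame_form u v) \<le> (\<Sum>\<^sub>\<infinity>(k, l)\<in>K \<times> \<Lambda>. norm (corr u (g k) l * cnj (corr v (h k) l)))"
    unfolding frame_form_def using norm_infsum_bound[of "\<lambda>(k, l). corr u (g k) l * cnj (corr v (h k) l)" "K \<times> \<Lambda>"]
      frame_norms_summable[OF assms(1,2)] by (simp add: case_prod_unfold)
  also have "\<dots> \<le> C * (LBINT x. (norm (u x))\<^sup>2) / s + s * (C' * (LBINT x. (norm (v x))\<^sup>2))"
    by (rule infsum_le_finite_sums[OF frame_norms_summable[OF assms(1,2)]]) (rule frame_sum_le[OF assms])
  finally show ?thesis .
qed

lemma frame_terms_summable:
  assumes "square_integrable u" "square_integrable v"
  shows "(\<lambda>(k, l). corr u (g k) l * cnj (corr v (h k) l)) summable_on K \<times> \<Lambda>"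
  by (rule abs_summable_summable) (use frame_norms_summable[OF assms] in \<open>simp add: case_prod_unfold\<close>)

lemma frame_form_add_left:
  assumes "square_integrable u" "square_integrable u'" "square_integrable v"
  shows "frame_form (\<lambda>t. u t + u' t) v = frame_form u v + frame_form u' v"
proof -
  have "frame_form (\<lambda>t. u t + u' t) v = (\<Sum>\<^sub>\<infinity>i\<in>K \<times> \<Lambda>. (case i of (k, l) \<Rightarrow> corr u (g k) l * cnj (corr v (h k) l)) + (case i of (k, l) \<Rightarrow> corr u' (g k) l * cnj (corr v (h k) l)))"
    unfolding frame_form_def by (rule infsum_cong) (auto simp: corr_add_left[OF assms(1,2) generators_square_integrable(1)] distrib_right)
  also have "\<dots> = frame_form u v + frame_form u' v"
    unfolding frame_form_def by (rule infsum_add) (intro frame_terms_summable assms)+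
  finally show ?thesis .
qed

lemma frame_form_add_right:
  assumes "square_integrable u" "square_integrable v" "square_integrable v'"
  shows "frame_form u (\<lambda>t. v t + v' t) = frame_form u v + frame_form u v'"
proof -
  have "frame_form u (\<lambda>t. v t + v' t) = (\<Sum>\<^sub>\<infinity>i\<in>K \<times> \<Lambda>. (case i of (k, l) \<Rightarrow> corr u (g k) l * cnj (corr v (h k) l)) + (case i of (k, l) \<Rightarrow> corr u (g k) l * cnj (corr v' (h k) l)))"
    unfolding frame_form_def by (rule infsum_cong) (auto simp: corr_add_left[OF assms(2,3) generators_square_integrable(2)] distrib_left)
  also have "\<dots> = frame_form u v + frame_form u v'"
    unfolding frame_form_def by (rule infsum_add) (intro frame_terms_summable assms)+
  finally show ?thesis .
qed

lemma frame_form_cmult: "frame_form (\<lambda>t. c * u t) v = c * frame_form u v"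
  "frame_form u (\<lambda>t. c * v t) = cnj c * frame_form u v"
  unfolding frame_form_def infsum_cmult_right'[symmetric]
  by (intro infsum_cong; auto simp: corr_cmult_left)+

text \<open>The reproducing formula says that this sesquilinear form vanishes on the
  diagonal.\<close>

definition defect :: "(real^'m \<Rightarrow> complex) \<Rightarrow> (real^'m \<Rightarrow> complex) \<Rightarrow> complex" where
  "defect u v = frame_form u v - (LBINT t. u t * cnj (v t))"

lemma defect_add_left:
  assumes "square_integrable u" "square_integrable u'" "square_integrable v"
  shows "defect (\<lambda>t. u t + u' t) v = defect u v + defect u' v"
  unfolding defect_def frame_form_add_left[OF assms] distrib_right
  by (subst Bochner_Integration.integral_add) (intro square_integrable_mult assms, intro square_integrable_mult assms, simp)

lemma defect_add_right:
  assumes "square_integrable u" "square_integrable v" "square_integrable v'"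
  shows "defect u (\<lambda>t. v t + v' t) = defect u v + defect u v'"
  unfolding defect_def frame_form_add_right[OF assms] complex_cnj_add distrib_left
  by (subst Bochner_Integration.integral_add) (intro square_integrable_mult assms, intro square_integrable_mult assms, simp)

lemma defect_cmult: "defect (\<lambda>t. c * u t) v = c * defect u v" "defect u (\<lambda>t. c * v t) = cnj c * defect u v"
proof -
  have "(LBINT t. u t * cnj (c * v t)) = cnj c * (LBINT t. u t * cnj (v t))"
    unfolding integral_mult_right_zero[symmetric] by (intro Bochner_Integration.integral_cong) (auto simp: mult_ac)
  then show "defect (\<lambda>t. c * u t) v = c * defect u v" "defect u (\<lambda>t. c * v t) = cnj c * defect u v"
    by (simp_all add: defect_def frame_form_cmult mult.assoc right_diff_distrib)
qed

text \<open>Expanding the diagonal value at \<open>u + w\<close> shows that the form is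
  antisymmetric; taking \<open>w = v\<close> and \<open>w = \<i> * v\<close> gives two relations
  that leave only 0.\<close>

lemma defect_polarization:
  assumes 0: "\<And>f. square_integrable f \<Longrightarrow> defect f f = 0" and u: "square_integrable u" and v: "square_integrable v"
  shows "defect u v = 0"
proof -
  have s: "defect u w + defect w u = 0" if w: "square_integrable w" for w
    using 0[OF square_integrable_add[OF u w]] 0[OF u] 0[OF w]
    by (simp add: defect_add_left[OF u w square_integrable_add[OF u w]] defect_add_right[OF u u w] defect_add_right[OF w u w])
  have "- \<i> * defect u v + \<i> * defect v u = 0"
    using s[OF square_integrable_cmult[OF v, of \<i>]] by (simp add: defect_cmult)
  then have "\<i> * (defect v u - defect u v) = 0" by (simp add: algebra_simps)
  then have "defect v u = defect u v" by simp
  with s[OF v] have "2 * defect u v = 0" by simp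
  then show ?thesis by simp
qed

lemma defect_le:
  assumes u: "square_integrable u" and v: "square_integrable v" and s: "0 < s"
  shows "norm (defect u v) \<le> (\<bar>C\<bar> + \<bar>C'\<bar> + 1) * ((LBINT x. (norm (u x))\<^sup>2) / s + s * (LBINT x. (norm (v x))\<^sup>2))"
proof -
  let ?U = "\<integral>x. (norm (u x))\<^sup>2 \<partial>lborel" and ?V = "\<integral>x. (norm (v x))\<^sup>2 \<partial>lborel"
  have UV: "0 \<le> ?U / s" "0 \<le> s * ?V" using s by auto
  have iu: "integrable lborel (\<lambda>x. (norm (u x))\<^sup>2)" and iv: "integrable lborel (\<lambda>x. (norm (v x))\<^sup>2)"
    using u v by (auto simp: square_integrable_def)
  have "norm (LBINT t. u t * cnj (v t)) \<le> (LBINT t. norm (u t * cnj (v t)))" by (rule integral_norm_bound)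
  also have "\<dots> \<le> (LBINT t. (norm (u t))\<^sup>2 / s + s * (norm (v t))\<^sup>2)"
  proof (rule integral_mono)
    fix t
    have "norm (u t) * norm (v t) = (norm (u t) / sqrt s) * (sqrt s * norm (v t))" using s by simp
    also have "\<dots> \<le> (norm (u t) / sqrt s)\<^sup>2 + (sqrt s * norm (v t))\<^sup>2" by (rule mult_le_sum_power2)
    also have "\<dots> = (norm (u t))\<^sup>2 / s + s * (norm (v t))\<^sup>2" using s by (simp add: power_divide power_mult_distrib)
    finally show "norm (u t * cnj (v t)) \<le> (norm (u t))\<^sup>2 / s + s * (norm (v t))\<^sup>2" by (simp add: norm_mult)
  qed (use square_integrable_mult[OF u v] iu iv in auto)
  also have "\<dots> = ?U / s + s * ?V" using iu iv by simp
  finally have 1: "norm (LBINT t. u t * cnj (v t)) \<le> ?U / s + s * ?V" .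
  have "C * (?U / s) \<le> (\<bar>C\<bar> + \<bar>C'\<bar>) * (?U / s)" "C' * (s * ?V) \<le> (\<bar>C\<bar> + \<bar>C'\<bar>) * (s * ?V)"
    using UV by (auto intro!: mult_right_mono simp del: times_divide_eq_right)
  then have 2: "norm (frame_form u v) \<le> (\<bar>C\<bar> + \<bar>C'\<bar>) * (?U / s + s * ?V)"
    using frame_form_le[OF u v s] by (simp add: distrib_left mult_ac)
  have "norm (defect u v) \<le> norm (frame_form u v) + norm (LBINT t. u t * cnj (v t))"
    unfolding defect_def by (rule norm_triangle_ineq4)
  then show ?thesis using 1 2 by (simp add: distrib_right)
qed

text \<open>Splitting \<open>f\<close> as \<open>f' + d\<close> with \<open>f'\<close> mollified
  leaves only terms containing the small \<open>d\<close>; these tend to 0 by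
  \<open>defect_le\<close> with a weight tied to the quality of the approximation.\<close>

lemma defect_zero_of_mollified:
  assumes zero_mollified: "\<And>f. mollified f \<Longrightarrow> defect f f = 0" and f: "square_integrable f"
  shows "defect f f = 0"
proof -
  define c where "c = \<bar>C\<bar> + \<bar>C'\<bar> + 1"
  have c: "0 < c" by (simp add: c_def)
  let ?N = "\<integral>x. (norm (f x))\<^sup>2 \<partial>lborel"
  have main: "norm (defect f f) \<le> c * (2 * s + s * (3 * ?N + 2))" if s: "0 < s" "s \<le> 1" for s
  proof -
    obtain f' where f': "mollified f'" "(LBINT x. (norm (f x - f' x))\<^sup>2) \<le> s\<^sup>2"
      using mollified_dense[OF f, of "s\<^sup>2"] s by auto
    define d where "d x = f x - f' x" for x
    let ?D = "\<integral>x. (norm (d x))\<^sup>2 \<partial>lborel" and ?N' = "\<integral>x. (norm (f' x))\<^sup>2 \<partial>lborel"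
    have sf': "square_integrable f'" by (rule mollified_square_integrable[OF f'(1)])
    have sd: "square_integrable d" unfolding d_def by (rule square_integrable_diff[OF f sf'])
    have D: "?D \<le> s\<^sup>2" using f'(2) by (simp add: d_def)
    have D1: "?D \<le> 1" using D s power_le_one[of s 2] by linarith
    have "?N' \<le> (LBINT x. 2 * (norm (f x))\<^sup>2 + 2 * (norm (d x))\<^sup>2)"
    proof (rule integral_mono')
      fix x show "(norm (f' x))\<^sup>2 \<le> 2 * (norm (f x))\<^sup>2 + 2 * (norm (d x))\<^sup>2"
        using norm_add_power2_le[of "f x" "- d x"] unfolding norm_minus_cancel by (simp add: d_def)
    qed (use f sd in \<open>auto simp: square_integrable_def\<close>)
    also have "\<dots> = 2 * ?N + 2 * ?D" using f sd by (simp add: square_integrable_def)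
    finally have N': "?N' \<le> 2 * ?N + 2" using D1 by simp
    have eq: "f = (\<lambda>x. f' x + d x)" by (auto simp: d_def)
    have "defect f f = defect d f + defect f' d"
    proof -
      have "defect f f = defect (\<lambda>x. f' x + d x) f" using eq by simp
      also have "\<dots> = defect f' f + defect d f" by (rule defect_add_left[OF sf' sd f])
      also have "defect f' f = defect f' (\<lambda>x. f' x + d x)" using eq by simp
      also have "\<dots> = defect f' f' + defect f' d" by (rule defect_add_right[OF sf' sf' sd])
      finally show ?thesis using zero_mollified[OF f'(1)] by simp
    qed
    then have "norm (defect f f) \<le> norm (defect d f) + norm (defect f' d)" by (simp add: norm_triangle_ineq)
    \<comment> \<open>Weight \<open>s\<close> where \<open>d\<close> stands on the left and
      \<open>1 / s\<close> where it stands on the right. In both cases \<open>?D\<close>, of order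
      \<open>s\<close> squared, is divided by \<open>s\<close>, and the fixed norms are multiplied
      by \<open>s\<close>.\<close>
    also have "\<dots> \<le> c * (?D / s + s * ?N) + c * (?N' / (1 / s) + (1 / s) * ?D)"
      unfolding c_def using s by (intro add_mono defect_le f sd sf') auto
    also have "\<dots> = c * (2 * (?D / s) + s * (?N + ?N'))" using s by (simp add: field_simps)
    also have "\<dots> \<le> c * (2 * s + s * (3 * ?N + 2))"
    proof -
      have "?D / s \<le> s" using D s by (simp add: power2_eq_square divide_le_eq)
      moreover have "s * (?N + ?N') \<le> s * (3 * ?N + 2)" using N' s by (intro mult_left_mono) auto
      ultimately have "2 * (?D / s) + s * (?N + ?N') \<le> 2 * s + s * (3 * ?N + 2)" by linarith
      then show ?thesis using c by (rule mult_left_mono[OF _ less_imp_le])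
    qed
    finally show ?thesis .
  qed
  have "(\<lambda>n. c * (2 * (1 / Suc n) + (1 / Suc n) * (3 * ?N + 2))) \<longlonglongrightarrow> c * (2 * 0 + 0 * (3 * ?N + 2))"
    by (intro tendsto_intros LIMSEQ_Suc[OF lim_1_over_n])
  then have "norm (defect f f) \<le> c * (2 * 0 + 0 * (3 * ?N + 2))"
    by (rule LIMSEQ_le_const) (intro exI[of _ 0] allI impI main; simp)
  then show ?thesis by simp
qed

end

text \<open>On a small ball the character is within \<open>1/2\<close> of 1, so its average cannot
  vanish. The admissible radius depends on the frequency.\<close>

lemma fourier_average_kernel_nonzero:
  fixes \<omega> :: "'a::euclidean_space"
  obtains d where "0 < d" "\<And>r. 0 < r \<Longrightarrow> r < d \<Longrightarrow> fourier (\<lambda>x. of_real (average_kernel r x)) \<omega> \<noteq> 0"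
proof -
  have "isCont (\<lambda>t. ee (- (t \<bullet> \<omega>))) 0"
    by (rule isCont_o2[where g=ee]) (auto intro!: continuous_intros simp: continuous_ee[unfolded continuous_on_eq_continuous_at[OF open_UNIV], rule_format])
  then obtain d where d: "0 < d" "\<And>t. norm t < d \<Longrightarrow> norm (ee (- (t \<bullet> \<omega>)) - 1) < 1/2"
    unfolding continuous_at_eps_delta by (auto simp: dist_norm dest!: spec[of _ "1/2"])
  have "fourier (\<lambda>x. of_real (average_kernel r x)) \<omega> \<noteq> 0" if r: "0 < r" "r < d" for r
  proof
    assume 0: "fourier (\<lambda>x. of_real (average_kernel r x)) \<omega> = 0"
    note [measurable] = average_kernel(5)[OF r(1)]
    have i: "integrable lborel (\<lambda>x::'a. complex_of_real (average_kernel r x))" using average_kernel(1)[OF r(1)] by (rule integrable_of_real)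
    have ie: "integrable lborel (\<lambda>x::'a. complex_of_real (average_kernel r x) * ee (- (x \<bullet> \<omega>)))" by (rule integrable_mult_ee[OF i]) measurable
    have "(\<integral>x. complex_of_real (average_kernel r x) \<partial>(lborel :: 'a measure)) = 1"
      unfolding integral_complex_of_real average_kernel(3)[OF r(1)] by simp
    then have "(LBINT x. complex_of_real (average_kernel r x) * ee (- (x \<bullet> \<omega>)) - complex_of_real (average_kernel r x)) = -1"
      using 0 i ie by (simp add: fourier_lborel)
    then have "1 = norm (LBINT x. complex_of_real (average_kernel r x) * (ee (- (x \<bullet> \<omega>)) - 1))"
      by (simp add: right_diff_distrib)
    also have "\<dots> \<le> (LBINT x. norm (complex_of_real (average_kernel r x) * (ee (- (x \<bullet> \<omega>)) - 1)))"
      by (rule integral_norm_bound)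
    also have "\<dots> \<le> (LBINT x. average_kernel r (x::'a) * (1/2))"
    proof (rule integral_mono)
      show "integrable lborel (\<lambda>x. norm (complex_of_real (average_kernel r x) * (ee (- (x \<bullet> \<omega>)) - 1)))"
        using Bochner_Integration.integrable_diff[OF ie i] by (intro integrable_norm) (simp add: right_diff_distrib)
      show "integrable lborel (\<lambda>x::'a. average_kernel r x * (1/2))" by (intro integrable_mult_left average_kernel(1)[OF r(1)])
      show "norm (complex_of_real (average_kernel r x) * (ee (- (x \<bullet> \<omega>)) - 1)) \<le> average_kernel r x * (1/2)" for x
      proof (cases "average_kernel r x = 0")
        case False
        then have "norm x < d" using average_kernel(4)[OF r(1)] r(2) by force
        then show ?thesis
          using mult_left_mono[OF less_imp_le[OF d(2)] average_kernel(2)[OF r(1)], of x x] average_kernel(2)[OF r(1), of x]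
          by (simp add: norm_mult)
      qed simp
    qed
    also have "\<dots> = 1/2" using average_kernel(3)[OF r(1), where 'a='a] by simp
    finally show False by simp
  qed
  with d(1) show thesis by (rule that)
qed

text \<open>The ball kernel is even and real, so mollifying is a correlation with it.\<close>

lemma fourier_mollify:
  fixes f :: "'a::euclidean_space \<Rightarrow> complex"
  assumes f: "integrable lborel f" and r: "0 < r"
  shows "fourier (mollify r f) \<omega> = fourier f \<omega> * cnj (fourier (\<lambda>x. of_real (average_kernel r x)) \<omega>)"
proof -
  have i: "integrable lborel (\<lambda>x::'a. complex_of_real (average_kernel r x))" using average_kernel(1)[OF r] by (rule integrable_of_real)
  have sym: "average_kernel r (- s) = average_kernel r s" for s :: 'a by (simp add: average_kernel_def indicator_def)
  have "mollify r f x = corr f (\<lambda>x. of_real (average_kernel r x)) x" for x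
  proof -
    have "corr f (\<lambda>x. of_real (average_kernel r x)) x = (LBINT s. f (x - s) * cnj (of_real (average_kernel r (x - s - x))))"
      unfolding corr_def using integral_lborel_shift(4)[of "\<lambda>t. f t * cnj (of_real (average_kernel r (t - x)))" x] by simp
    then show ?thesis by (simp add: mollify_def sym mult.commute)
  qed
  then have "mollify r f = corr f (\<lambda>x. of_real (average_kernel r x))" by blast
  then show ?thesis by (simp add: fourier_corr[OF f i])
qed

lemma fourier_shift:
  assumes "integrable lborel f"
  shows "fourier (\<lambda>t. f (t - s)) \<omega> = ee (- (s \<bullet> \<omega>)) * fourier f \<omega>"
proof -
  have [measurable]: "f \<in> borel_measurable borel" using assms by auto
  have "fourier (\<lambda>t. f (t - s)) \<omega> = (LBINT t. f (t - s) * ee (- (t \<bullet> \<omega>)))" by (rule fourier_lborel) measurable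
  also have "\<dots> = (LBINT t. f t * ee (- ((t + s) \<bullet> \<omega>)))"
    using integral_lborel_shift(2)[of "\<lambda>t. f t * ee (- ((t + s) \<bullet> \<omega>))" s] by simp
  also have "\<dots> = (LBINT t. ee (- (s \<bullet> \<omega>)) * (f t * ee (- (t \<bullet> \<omega>))))"
    by (intro Bochner_Integration.integral_cong refl) (simp only: inner_add_left ee_minus ee_add complex_cnj_mult mult_ac)
  also have "\<dots> = ee (- (s \<bullet> \<omega>)) * fourier f \<omega>" by (simp add: fourier_lborel)
  finally show ?thesis .
qed

section \<open>The two implications between the reproducing formula and the symbols\<close>

context bessel_pair
begin

lemma mollified_shift:
  assumes "mollified f"
  shows "mollified (\<lambda>t. f (t - s))"
proof -
  obtain r f0 M where f: "0 < r" "integrable lborel f0" "\<And>x. norm (f0 x) \<le> M" "f = mollify r f0"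
    using assms by (auto simp: mollified_def)
  have "(\<lambda>t. f (t - s)) = mollify r (\<lambda>t. f0 (t - s))"
    unfolding f(4) mollify_def by (simp add: algebra_simps)
  moreover have "integrable lborel (\<lambda>t. f0 (t - s))" using f(2) by (simp add: integrable_lborel_shift)
  ultimately show ?thesis unfolding mollified_def using f(1,3) by blast
qed

text \<open>Every point at a level \<open>snd \<gamma>\<close> is congruent modulo the lattice to a
  point of the leaf through the origin, where the form equals the inner product of two translates.
  Such levels are dense, and continuity at the generic \<open>z0\<close> transfers the
  value.\<close>

lemma hull_form_const:
  assumes 0: "\<And>u v. square_integrable u \<Longrightarrow> square_integrable v \<Longrightarrow> defect u v = 0"
    and n: "mollified f1" "mollified f2" and z0: "generic_level (snd z0)"
  shows "hull_form f1 f2 z0 = (LBINT t. f1 t * cnj (f2 t))"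
proof (rule ccontr)
  let ?c = "\<integral>t. f1 t * cnj (f2 t) \<partial>lborel"
  assume "hull_form f1 f2 z0 \<noteq> ?c"
  then have e: "0 < norm (hull_form f1 f2 z0 - ?c)" by simp
  have level: "hull_form f1 f2 (x, snd \<gamma>) = ?c" if "\<gamma> \<in> \<Gamma>" for x \<gamma>
  proof -
    have "hull_form f1 f2 (x, snd \<gamma>) = hull_form f1 f2 ((x - fst \<gamma>, 0) + \<gamma>)"
      by (cases \<gamma>) simp
    also have "\<dots> = frame_form (\<lambda>t. f1 (t - (x - fst \<gamma>))) (\<lambda>t. f2 (t - (x - fst \<gamma>)))"
      unfolding hull_form_periodic[OF that] by (rule hull_form_leaf)
    also have "\<dots> = (LBINT t. f1 (t - (x - fst \<gamma>)) * cnj (f2 (t - (x - fst \<gamma>))))"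
      using 0[OF square_integrable_shift[OF mollified_square_integrable[OF n(1)]] square_integrable_shift[OF mollified_square_integrable[OF n(2)]]]
      by (simp add: defect_def)
    also have "\<dots> = ?c" by (rule integral_lborel_shift(2)[of "\<lambda>t. f1 t * cnj (f2 t)"])
    finally show ?thesis .
  qed
  obtain d where d: "0 < d" "\<And>z. dist z z0 < d \<Longrightarrow> dist (hull_form f1 f2 z) (hull_form f1 f2 z0) < norm (hull_form f1 f2 z0 - ?c)"
    using hull_form_isCont[OF n z0] e unfolding continuous_at_eps_delta by blast
  obtain \<gamma> where \<gamma>: "\<gamma> \<in> \<Gamma>" "snd z0 - d < snd \<gamma>" "snd \<gamma> < snd z0 + d"
    using G.lattice_between[of "snd z0 - d" "snd z0 + d"] d(1) by auto
  have "dist (fst z0, snd \<gamma>) z0 < d"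
    using \<gamma> by (cases z0) (auto simp: dist_Pair_Pair dist_real_def abs_less_iff)
  from d(2)[OF this] show False unfolding level[OF \<gamma>(1)] by (simp add: dist_norm norm_minus_commute)
qed

lemma AE_generic_level: "AE z in (lborel :: ((real^'m) \<times> real) measure). generic_level (snd z)"
proof -
  let ?N = "(\<lambda>\<gamma>. snd \<gamma> - a) ` \<Gamma> \<union> (\<lambda>\<gamma>. snd \<gamma> + a) ` \<Gamma>"
  have c: "countable ?N" using G.lattice_countable by auto
  have [measurable]: "?N \<in> sets borel" using c by (rule sets.countable[rotated]) auto
  have "AE z in (lborel :: (real^'m) measure) \<Otimes>\<^sub>M (lborel :: real measure). snd z \<notin> ?N"
  proof (rule lborel_pair.AE_pair_measure)
    show "{z \<in> space ((lborel :: (real^'m) measure) \<Otimes>\<^sub>M (lborel :: real measure)). snd z \<notin> ?N} \<in> sets (lborel \<Otimes>\<^sub>M lborel)"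
      by measurable
    show "AE x in (lborel :: (real^'m) measure). AE y in (lborel :: real measure). snd (x, y) \<notin> ?N"
      by (rule AE_I2) (simp only: snd_conv AE_not_in[OF countable_imp_null_set_lborel[OF c]])
  qed
  then have "AE z in (lborel :: ((real^'m) \<times> real) measure). snd z \<notin> ?N" by (simp only: lborel_prod)
  then show ?thesis by eventually_elim (force simp: generic_level_def)
qed

text \<open>A constant function has only its zeroth Fourier coefficient, given by orthogonality of
  characters on the cell. Comparison with \<open>coefficient_symbol\<close> shows that the symbol
  minus its expected value is orthogonal to all products \<open>A f1 f2\<close>.\<close>

lemma symbol_of_reproducing:
  assumes 0: "\<And>u v. square_integrable u \<Longrightarrow> square_integrable v \<Longrightarrow> defect u v = 0"
    and \<eta>: "\<eta> \<in> dual_lattice \<Gamma>"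
  shows "AE t in lborel. window_char (snd \<eta>) * symbol (fst \<eta>) t = (if \<eta> = 0 then of_real G.covol else 0)"
proof -
  let ?p = "fst \<eta>"
  define \<kappa> where "\<kappa> = (if \<eta> = 0 then complex_of_real G.covol else 0)"
  define A where "A f1 f2 \<omega> = fourier f1 \<omega> * cnj (fourier f2 (\<omega> - ?p))" for f1 f2 and \<omega> :: "real^'m"
  have Ai: "integrable lborel (A f1 f2)" if n: "mollified f1" "mollified f2" for f1 f2
  proof -
    obtain M where f1: "integrable lborel f1" "\<And>x. norm (f1 x) \<le> M" "f1 \<in> borel_measurable borel" using mollified_props[OF n(1)] by metis
    obtain N where f2: "integrable lborel f2" "\<And>x. norm (f2 x) \<le> N" "f2 \<in> borel_measurable borel" using mollified_props[OF n(2)] by metis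
    note [measurable] = f1(3) f2(3)
    show ?thesis unfolding A_def[abs_def]
      using fourier_L2[OF f1(1,2)] fourier_L2[OF f2(1,2)] integrable_lborel_shift(2)[of "\<lambda>\<omega>. (norm (fourier f2 \<omega>))\<^sup>2" ?p]
      by (intro L2_mult_integrable) auto
  qed
  have ASi: "integrable lborel (\<lambda>\<omega>. A f1 f2 \<omega> * symbol ?p \<omega>)" if n: "mollified f1" "mollified f2" for f1 f2
    using coefficient_symbol(2)[OF n \<eta>] by (simp add: A_def)
  have main: "(LBINT \<omega>. A f1 f2 \<omega> * (window_char (snd \<eta>) * symbol ?p \<omega> - \<kappa>)) = 0" if n: "mollified f1" "mollified f2" for f1 f2
  proof -
    obtain M where f1: "integrable lborel f1" "\<And>x. norm (f1 x) \<le> M" using mollified_props[OF n(1)] by metis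
    obtain N where f2: "integrable lborel f2" "\<And>x. norm (f2 x) \<le> N" using mollified_props[OF n(2)] by metis
    let ?c = "\<integral>t. f1 t * cnj (f2 t) \<partial>lborel"
    have "(LBINT z. indicator G.cell z *\<^sub>R hull_form f1 f2 z * ee (z \<bullet> \<eta>)) = (LBINT z. ?c * (indicator G.cell z *\<^sub>R ee (z \<bullet> \<eta>)))"
    proof (rule integral_cong_AE)
      show "AE z in lborel. indicator G.cell z *\<^sub>R hull_form f1 f2 z * ee (z \<bullet> \<eta>) = ?c * (indicator G.cell z *\<^sub>R ee (z \<bullet> \<eta>))"
        using AE_generic_level by eventually_elim (simp add: hull_form_const[OF 0 n])
      show "(\<lambda>z. indicator G.cell z *\<^sub>R hull_form f1 f2 z * ee (z \<bullet> \<eta>)) \<in> borel_measurable lborel"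
        using coefficient_correlation(2)[OF n \<eta>] by (rule borel_measurable_integrable)
    qed measurable
    also have "\<dots> = ?c * \<kappa>"
      unfolding integral_mult_right_zero G.integral_cell_character[OF \<eta>] \<kappa>_def ..
    also have "\<dots> = (LBINT \<omega>. A f1 f2 \<omega>) * \<kappa>"
      using plancherel[OF f1 f2] by (cases "\<eta> = 0") (auto simp: A_def \<kappa>_def)
    finally have "(LBINT \<omega>. A f1 f2 \<omega> * symbol ?p \<omega>) * window_char (snd \<eta>) = (LBINT \<omega>. A f1 f2 \<omega>) * \<kappa>"
      unfolding coefficient_symbol(1)[OF n \<eta>] A_def .
    moreover have "(LBINT \<omega>. A f1 f2 \<omega> * (window_char (snd \<eta>) * symbol ?p \<omega> - \<kappa>))
       = (LBINT \<omega>. A f1 f2 \<omega> * symbol ?p \<omega> * window_char (snd \<eta>) - A f1 f2 \<omega> * \<kappa>)"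
      by (intro Bochner_Integration.integral_cong) (auto simp: algebra_simps)
    moreover have "\<dots> = (LBINT \<omega>. A f1 f2 \<omega> * symbol ?p \<omega>) * window_char (snd \<eta>) - (LBINT \<omega>. A f1 f2 \<omega>) * \<kappa>"
      using Ai[OF n] ASi[OF n] by (subst Bochner_Integration.integral_diff) auto
    ultimately show ?thesis by simp
  qed
  \<comment> \<open>Translating the first \<open>f\<close> by \<open>s\<close> multiplies
    \<open>A f f\<close> by the character of frequency \<open>s\<close>. The identity
    \<open>main\<close> for all translates says that an integrable function has vanishing Fourier
    transform.\<close>
  have AE0: "AE \<omega> in lborel. A f f \<omega> * (window_char (snd \<eta>) * symbol ?p \<omega> - \<kappa>) = 0" if n: "mollified f" for f
  proof (rule fourier_unique)
    have "integrable lborel (\<lambda>\<omega>. window_char (snd \<eta>) * (A f f \<omega> * symbol ?p \<omega>) - A f f \<omega> * \<kappa>)"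
      using Ai[OF n n] ASi[OF n n] by auto
    then show i: "integrable lborel (\<lambda>\<omega>. A f f \<omega> * (window_char (snd \<eta>) * symbol ?p \<omega> - \<kappa>))"
      by (simp add: algebra_simps)
    fix s
    have fi: "integrable lborel f" using mollified_props[OF n] by metis
    have "fourier (\<lambda>\<omega>. A f f \<omega> * (window_char (snd \<eta>) * symbol ?p \<omega> - \<kappa>)) s
      = (LBINT \<omega>. A f f \<omega> * (window_char (snd \<eta>) * symbol ?p \<omega> - \<kappa>) * ee (- (\<omega> \<bullet> s)))"
      by (rule fourier_lborel) (use i in auto)
    also have "\<dots> = (LBINT \<omega>. A (\<lambda>t. f (t - s)) f \<omega> * (window_char (snd \<eta>) * symbol ?p \<omega> - \<kappa>))"
      by (intro Bochner_Integration.integral_cong) (auto simp: A_def fourier_shift[OF fi] inner_commute[of s])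
    also have "\<dots> = 0" by (rule main[OF mollified_shift[OF n] n])
    finally show "fourier (\<lambda>\<omega>. A f f \<omega> * (window_char (snd \<eta>) * symbol ?p \<omega> - \<kappa>)) s = 0" .
  qed
  define k where "k r = (\<lambda>x::real^'m. complex_of_real (average_kernel r x))" for r
  have ki: "integrable lborel (k r)" if "0 < r" for r
    unfolding k_def using average_kernel(1)[OF that] by (rule integrable_of_real)
  have Fs: "fourier (mollify r (k r)) w = fourier (k r) w * cnj (fourier (k r) w)" if "0 < r" for r w
    using fourier_mollify[OF ki[OF that] that] by (simp add: k_def)
  have nk: "mollified (mollify r (k r))" if "0 < r" for r
    unfolding mollified_def
  proof (intro exI conjI allI)
    show "norm (k r x) \<le> 1 / measure lborel (ball (0::real^'m) r)" for x
      by (auto simp: k_def average_kernel_def indicator_def norm_divide)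
  qed (use that ki in auto)
  \<comment> \<open>It remains to divide by \<open>A f f\<close>. Countably many radii keep the
    exceptional set null, and at each frequency a small enough radius makes both factors of the
    product nonzero.\<close>
  have "AE \<omega> in lborel. \<forall>n. A (mollify (1 / Suc n) (k (1 / Suc n))) (mollify (1 / Suc n) (k (1 / Suc n))) \<omega> * (window_char (snd \<eta>) * symbol ?p \<omega> - \<kappa>) = 0"
    unfolding AE_all_countable by (intro allI AE0 nk) simp
  then show ?thesis unfolding \<kappa>_def[symmetric]
  proof eventually_elim
    case (elim \<omega>)
    obtain d1 where d1: "0 < d1" "\<And>r. 0 < r \<Longrightarrow> r < d1 \<Longrightarrow> fourier (k r) \<omega> \<noteq> 0"
      using fourier_average_kernel_nonzero[of \<omega>] unfolding k_def by blast
    obtain d2 where d2: "0 < d2" "\<And>r. 0 < r \<Longrightarrow> r < d2 \<Longrightarrow> fourier (k r) (\<omega> - ?p) \<noteq> 0"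
      using fourier_average_kernel_nonzero[of "\<omega> - ?p"] unfolding k_def by blast
    obtain n where n: "1 / real (Suc n) < min d1 d2"
      using reals_Archimedean[of "min d1 d2"] d1(1) d2(1) by (auto simp: inverse_eq_divide)
    let ?r = "1 / real (Suc n)"
    have r: "0 < ?r" by simp
    have "fourier (k ?r) \<omega> \<noteq> 0" "fourier (k ?r) (\<omega> - ?p) \<noteq> 0" using d1(2)[OF r] d2(2)[OF r] n by auto
    then have "A (mollify ?r (k ?r)) (mollify ?r (k ?r)) \<omega> \<noteq> 0"
      unfolding A_def Fs[OF r] by (simp del: of_nat_Suc)
    with elim[rule_format, of n] show ?case by simp
  qed
qed

text \<open>The symbol conditions say that the hull function and the constant \<open>?c\<close> have
  the same Fourier coefficients. Level 0 is generic, so the origin is a point of continuity, and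
  there the hull function is the frame form itself.\<close>

lemma reproducing_of_symbol:
  assumes g0: "generic_level 0"
    and sym: "\<And>\<eta>. \<eta> \<in> dual_lattice \<Gamma> \<Longrightarrow> AE t in lborel. window_char (snd \<eta>) * symbol (fst \<eta>) t = (if \<eta> = 0 then of_real G.covol else 0)"
    and n: "mollified f"
  shows "defect f f = 0"
proof -
  obtain M where f: "integrable lborel f" "\<And>x. norm (f x) \<le> M" "f \<in> borel_measurable borel" using mollified_props[OF n] by metis
  note [measurable] = f(3)
  let ?c = "\<integral>t. f t * cnj (f t) \<partial>lborel"
  define F where "F z = hull_form f f z - ?c" for z
  obtain T where T: "\<And>z. norm (hull_form f f z) \<le> T" using hull_form_bounded[OF n n] by blast
  have ich: "integrable lborel (\<lambda>z. indicator G.cell z *\<^sub>R ee (z \<bullet> \<eta>))" for \<eta>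
    by (rule G.cell_indicator_integrable[where M=1]) auto
  have ihf: "integrable lborel (\<lambda>z. indicator G.cell z *\<^sub>R hull_form f f z * ee (z \<bullet> \<eta>))" if "\<eta> \<in> dual_lattice \<Gamma>" for \<eta>
    by (rule coefficient_correlation(2)[OF n n that])
  have eq: "indicator G.cell z *\<^sub>R F z * ee (z \<bullet> \<eta>) = indicator G.cell z *\<^sub>R hull_form f f z * ee (z \<bullet> \<eta>) - ?c * (indicator G.cell z *\<^sub>R ee (z \<bullet> \<eta>))" for z \<eta>
    by (simp add: F_def scaleR_conv_of_real algebra_simps)
  have "F 0 = 0"
  proof (rule G.fourier_coefficients_zero)
    have "integrable lborel (\<lambda>z. indicator G.cell z *\<^sub>R F z * ee (z \<bullet> 0))"
      unfolding eq by (intro Bochner_Integration.integrable_diff integrable_mult_right ihf G.dual_0 ich)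
    then show "integrable lborel (\<lambda>z. indicator G.cell z *\<^sub>R F z)" by simp
    show "norm (F z) \<le> T + norm ?c" for z
      unfolding F_def using norm_triangle_ineq4[of "hull_form f f z" ?c] T[of z] by linarith
    have "isCont (hull_form f f) 0" by (rule hull_form_isCont[OF n n]) (simp add: g0)
    then show "isCont F 0" unfolding F_def[abs_def] by (intro continuous_intros)
    fix \<eta> assume \<eta>: "\<eta> \<in> dual_lattice \<Gamma>"
    define \<kappa> where "\<kappa> = (if \<eta> = 0 then complex_of_real G.covol else 0)"
    have "(LBINT \<omega>. fourier f \<omega> * cnj (fourier f (\<omega> - fst \<eta>)) * symbol (fst \<eta>) \<omega>) * window_char (snd \<eta>)
       = (LBINT \<omega>. fourier f \<omega> * cnj (fourier f (\<omega> - fst \<eta>)) * symbol (fst \<eta>) \<omega> * window_char (snd \<eta>))"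
      by simp
    also have "\<dots> = (LBINT \<omega>. fourier f \<omega> * cnj (fourier f (\<omega> - fst \<eta>)) * \<kappa>)"
    proof (rule integral_cong_AE)
      show "AE \<omega> in lborel. fourier f \<omega> * cnj (fourier f (\<omega> - fst \<eta>)) * symbol (fst \<eta>) \<omega> * window_char (snd \<eta>) = fourier f \<omega> * cnj (fourier f (\<omega> - fst \<eta>)) * \<kappa>"
        using sym[OF \<eta>] unfolding \<kappa>_def[symmetric] by eventually_elim (simp add: mult_ac)
      show "(\<lambda>\<omega>. fourier f \<omega> * cnj (fourier f (\<omega> - fst \<eta>)) * symbol (fst \<eta>) \<omega> * window_char (snd \<eta>)) \<in> borel_measurable lborel"
        using coefficient_symbol(2)[OF n n \<eta>] by (intro borel_measurable_integrable integrable_mult_left)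
    qed measurable
    also have "\<dots> = ?c * \<kappa>"
      using plancherel[OF f(1,2) f(1,2)] by (cases "\<eta> = 0") (auto simp: \<kappa>_def)
    finally have hf: "(LBINT z. indicator G.cell z *\<^sub>R hull_form f f z * ee (z \<bullet> \<eta>)) = ?c * \<kappa>"
      by (simp only: coefficient_symbol(1)[OF n n \<eta>])
    show "(LBINT z. indicator G.cell z *\<^sub>R F z * ee (z \<bullet> \<eta>)) = 0"
      unfolding eq Bochner_Integration.integral_diff[OF ihf[OF \<eta>] integrable_mult_right[OF ich]]
        integral_mult_right_zero hf G.integral_cell_character[OF \<eta>] \<kappa>_def by simp
  qed
  moreover have "hull_form f f 0 = frame_form f f"
    using hull_form_leaf[of f f 0] by (simp add: zero_prod_def)
  ultimately show ?thesis by (simp add: F_def defect_def)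
qed

text \<open>Polarization supplies the two-function form required in one direction, density of
  mollified functions the passage to all of L2 in the other.\<close>

theorem reproducing_iff_symbol:
  assumes g0: "generic_level 0"
  shows "(\<forall>f. square_integrable f \<longrightarrow> frame_form f f = of_real (LBINT x. (norm (f x))\<^sup>2))
    \<longleftrightarrow> (\<forall>\<eta>\<in>dual_lattice \<Gamma>. AE t in lborel. window_char (snd \<eta>) * symbol (fst \<eta>) t = (if \<eta> = 0 then of_real G.covol else 0))"
proof -
  have norm: "(LBINT t. f t * cnj (f t)) = complex_of_real (LBINT x. (norm (f x))\<^sup>2)" for f :: "real^'m \<Rightarrow> complex"
    unfolding complex_norm_square[symmetric] of_real_power[symmetric] integral_complex_of_real ..
  have iff: "frame_form f f = of_real (LBINT x. (norm (f x))\<^sup>2) \<longleftrightarrow> defect f f = 0" for f :: "real^'m \<Rightarrow> complex"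
    by (simp add: defect_def norm)
  show ?thesis unfolding iff
  proof safe
    fix \<eta>1 \<eta>2 assume "\<forall>f. square_integrable f \<longrightarrow> defect f f = 0" and \<eta>: "(\<eta>1, \<eta>2) \<in> dual_lattice \<Gamma>"
    then have "\<And>u v. square_integrable u \<Longrightarrow> square_integrable v \<Longrightarrow> defect u v = 0"
      using defect_polarization by blast
    from symbol_of_reproducing[OF this \<eta>]
    show "AE t in lborel. window_char (snd (\<eta>1, \<eta>2)) * symbol (fst (\<eta>1, \<eta>2)) t = (if (\<eta>1, \<eta>2) = 0 then of_real G.covol else 0)"
      by simp
  next
    fix f :: "real^'m \<Rightarrow> complex"
    assume "\<forall>\<eta>\<in>dual_lattice \<Gamma>. AE t in lborel. window_char (snd \<eta>) * symbol (fst \<eta>) t = (if \<eta> = 0 then complex_of_real G.covol else 0)"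
      and f: "square_integrable f"
    then show "defect f f = 0"
      by (intro defect_zero_of_mollified[OF reproducing_of_symbol[OF g0] f]) auto
  qed
qed

end

subsection \<open>From Lebesgue to Borel measurability\<close>

lemma lebesgue_borel_version:
  fixes f :: "'a::euclidean_space \<Rightarrow> complex"
  assumes f: "f \<in> borel_measurable lebesgue"
  obtains f' where "f' \<in> borel_measurable borel" "AE x in lborel. f x = f' x"
proof -
  have "(\<lambda>x. Re (f x)) \<in> borel_measurable lebesgue" "(\<lambda>x. Im (f x)) \<in> borel_measurable lebesgue"
    using f by (auto intro: borel_measurable_Re borel_measurable_Im)
  then obtain u v where u: "u \<in> borel_measurable lborel" "AE x in lborel. Re (f x) = u x"
    and v: "v \<in> borel_measurable lborel" "AE x in lborel. Im (f x) = v x"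
    using completion_ex_borel_measurable_real by metis
  show thesis
  proof (rule that)
    show "(\<lambda>x. Complex (u x) (v x)) \<in> borel_measurable borel"
      unfolding Complex_eq by (intro borel_measurable_add borel_measurable_times borel_measurable_of_real borel_measurable_const)
        (use u(1) v(1) in auto)
    show "AE x in lborel. f x = Complex (u x) (v x)"
      using u(2) v(2) by eventually_elim (simp add: complex_eq_iff)
  qed
qed

text \<open>Null sets are translation invariant: the indicator of a null set has integral 0 after
  any shift.\<close>

lemma AE_lborel_shift:
  fixes P :: "'a::euclidean_space \<Rightarrow> bool"
  assumes "AE x in lborel. P x"
  shows "AE x in lborel. P (x - l)"
proof -
  obtain N where N: "{x \<in> space lborel. \<not> P x} \<subseteq> N" "emeasure lborel N = 0" "N \<in> sets lborel"
    using AE_E[OF assms] by blast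
  have i: "integrable lborel (indicator N :: 'a \<Rightarrow> real)" using N by (intro integrable_real_indicator) auto
  have "(LBINT x. indicator N (x - l)) = (\<integral>x. indicator N x \<partial>(lborel :: 'a measure) :: real)" by (rule integral_lborel_shift)
  also have "\<dots> = 0" using N by (simp add: measure_def)
  finally have "AE x in lborel. indicator N (x - l) = (0::real)"
    using i by (subst (asm) integral_nonneg_eq_0_iff_AE) (auto simp: integrable_lborel_shift)
  then show ?thesis
  proof eventually_elim
    case (elim x)
    then show ?case using N(1) by (auto simp: indicator_def split: if_splits)
  qed
qed

lemma AE_translate:
  assumes "AE x in lborel. g x = g' x"
  shows "AE x in lborel. translate l g x = g' (x - l)"
  using AE_lborel_shift[OF assms, of l] by (simp add: translate_def)

lemma integral_lebesgue_borel_version: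
  fixes f f' :: "'a::euclidean_space \<Rightarrow> 'b::{banach, second_countable_topology}"
  assumes "f \<in> borel_measurable lebesgue" "f' \<in> borel_measurable borel" "AE x in lborel. f x = f' x"
  shows "(\<integral>x. f x \<partial>lebesgue) = (LBINT x. f' x)"
    and "integrable lebesgue f \<longleftrightarrow> integrable lborel f'"
proof -
  have m: "f' \<in> borel_measurable lebesgue" using assms(2) by (auto intro: measurable_completion)
  have AE: "AE x in lebesgue. f x = f' x" using assms(3) by (simp add: AE_completion_iff)
  show "(\<integral>x. f x \<partial>lebesgue) = (LBINT x. f' x)"
    using integral_cong_AE[OF assms(1) m AE] assms(2) by (simp add: integral_completion)
  show "integrable lebesgue f \<longleftrightarrow> integrable lborel f'"
    using integrable_cong_AE[OF assms(1) m AE] assms(2) by (simp add: integrable_completion)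
qed

lemma L2_inner_borel_version:
  assumes f: "f \<in> borel_measurable lebesgue" "f' \<in> borel_measurable borel" "AE x in lborel. f x = f' x"
    and g: "translate l g \<in> borel_measurable lebesgue" "g' \<in> borel_measurable borel" "AE x in lborel. g x = g' x"
  shows "L2_inner f (translate l g) = corr f' g' l"
  unfolding L2_inner_def corr_def
proof (rule integral_lebesgue_borel_version)
  note [measurable] = f(1,2) g(1,2)
  show "(\<lambda>t. f t * cnj (translate l g t)) \<in> borel_measurable lebesgue" by measurable
  show "(\<lambda>t. f' t * cnj (g' (t - l))) \<in> borel_measurable borel" by measurable
  show "AE x in lborel. f x * cnj (translate l g x) = f' x * cnj (g' (x - l))"
    using f(3) AE_translate[OF g(3), of l] by eventually_elim simp
qed

lemma L2_space_borel_version: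
  assumes "f \<in> borel_measurable lebesgue" "f' \<in> borel_measurable borel" "AE x in lborel. f x = f' x"
  shows "f \<in> L2_space \<longleftrightarrow> square_integrable f'" and "(L2_norm f)\<^sup>2 = (LBINT x. (norm (f' x))\<^sup>2)"
proof -
  note [measurable] = assms(1,2)
  have AE: "AE x in lborel. (norm (f x))\<^sup>2 = (norm (f' x))\<^sup>2" using assms(3) by eventually_elim simp
  have m: "(\<lambda>x. (norm (f x))\<^sup>2) \<in> borel_measurable lebesgue" "(\<lambda>x. (norm (f' x))\<^sup>2) \<in> borel_measurable borel" by measurable
  show "f \<in> L2_space \<longleftrightarrow> square_integrable f'"
    using integral_lebesgue_borel_version(2)[OF m AE] assms by (simp add: L2_space_def square_integrable_def)
  show "(L2_norm f)\<^sup>2 = (LBINT x. (norm (f' x))\<^sup>2)"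
    unfolding L2_norm_def integral_lebesgue_borel_version(1)[OF m AE] by simp
qed

text \<open>The integral sees only the almost everywhere class, so the transforms agree at every
  frequency and the symbols do not change at all.\<close>

lemma fourier_borel_version:
  fixes f f' :: "'a::euclidean_space \<Rightarrow> complex"
  assumes "f \<in> borel_measurable lebesgue" "f' \<in> borel_measurable borel" "AE x in lborel. f x = f' x"
  shows "fourier f = fourier f'"
proof
  fix \<omega>
  note [measurable] = assms(1,2)
  have "(\<lambda>t::'a. exp (- 2 * of_real pi * \<i> * of_real (t \<bullet> \<omega>))) \<in> borel_measurable borel" by measurable
  then have E: "(\<lambda>t::'a. exp (- 2 * of_real pi * \<i> * of_real (t \<bullet> \<omega>))) \<in> borel_measurable lebesgue"
    by (auto intro: measurable_completion)
  have "AE x in lebesgue. f x = f' x" using assms(3) by (simp add: AE_completion_iff)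
  moreover have "f' \<in> borel_measurable lebesgue" using assms(2) by (auto intro: measurable_completion)
  ultimately show "fourier f \<omega> = fourier f' \<omega>"
    unfolding fourier_def
    by (intro integral_cong_AE borel_measurable_times E assms(1)) (auto elim: eventually_mono)
qed

lemma unit_cube_at_measure: "unit_cube_at k \<in> lmeasurable" "measure lebesgue (unit_cube_at k) = 1"
proof -
  have eq: "unit_cube_at k = cbox (\<chi> i. of_int (k $ i)) (\<chi> i. of_int (k $ i) + 1)"
    by (auto simp: unit_cube_at_def mem_box_cart)
  show "unit_cube_at k \<in> lmeasurable" unfolding eq by simp
  have "cbox (\<chi> i. real_of_int (k $ i)) (\<chi> i. real_of_int (k $ i) + 1) \<noteq> {}" by (simp add: interval_ne_empty_cart)
  then show "measure lebesgue (unit_cube_at k) = 1" unfolding eq by (simp add: content_cbox_cart)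
qed

lemma unit_cubes_cover: "\<exists>k. x \<in> unit_cube_at k"
  by (rule exI[of _ "\<chi> i. \<lfloor>x $ i\<rfloor>"]) (auto simp: unit_cube_at_def less_imp_le)

text \<open>On a cube of volume 1 the L1 norm is at most the L2 norm, and the L2 norms are summable
  over the cubes.\<close>

lemma wiener_amalgam_integrable:
  fixes f :: "real^'m \<Rightarrow> complex"
  assumes "f \<in> wiener_amalgam 2 1"
  shows "f \<in> borel_measurable lebesgue" "integrable lebesgue f"
proof -
  show fm [measurable]: "f \<in> borel_measurable lebesgue" using assms by (simp add: wiener_amalgam_def)
  have cube [measurable]: "unit_cube_at k \<in> sets lebesgue" for k :: "int^'m" using unit_cube_at_measure(1) by blast
  define J where "J k = (LINT x:unit_cube_at k|lebesgue. cmod (f x) powr 2)" for k :: "int^'m"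
  have i2: "integrable lebesgue (\<lambda>x. indicator (unit_cube_at k) x * (norm (f x))\<^sup>2)" for k
    using assms by (simp add: wiener_amalgam_def set_integrable_def powr_numeral)
  have Jeq: "J k = (\<integral>x. indicator (unit_cube_at k) x * (norm (f x))\<^sup>2 \<partial>lebesgue)" for k
    by (simp add: J_def set_lebesgue_integral_def powr_numeral)
  have Jnn: "0 \<le> J k" for k unfolding Jeq by (intro integral_nonneg_AE) auto
  have s: "(\<lambda>k. sqrt (J k)) summable_on UNIV"
  proof -
    have "(\<lambda>k. (J k powr (1 / 2)) powr 1) summable_on UNIV"
      using assms unfolding wiener_amalgam_def J_def by blast
    then show ?thesis by (simp add: powr_half_sqrt[OF Jnn] Jnn)
  qed
  have i1: "integrable lebesgue (\<lambda>x. indicator (unit_cube_at k) x :: real)" for k :: "int^'m"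
    using unit_cube_at_measure(1)[of k] by (simp add: lmeasurable_iff_integrable)
  have m1: "(\<integral>x. indicator (unit_cube_at k) x \<partial>lebesgue) = (1::real)" for k :: "int^'m"
    using unit_cube_at_measure(2)[of k] by simp
  define F where "F k x = complex_of_real (indicator (unit_cube_at k) x * norm (f x))" for k x
  \<comment> \<open>Cauchy-Schwarz in weighted form. The best weight \<open>t\<close> is the L2 norm
    \<open>sqrt (J k)\<close> on the cube; when that is 0, arbitrarily small weights are used
    instead.\<close>
  have Fle: "norm (F k x) \<le> (indicator (unit_cube_at k) x * (norm (f x))\<^sup>2 / t + t * indicator (unit_cube_at k) x) / 2" if "0 < t" for k x t
  proof -
    have "2 * norm (f x) \<le> (norm (f x))\<^sup>2 / t + t"
      using zero_le_power2[of "norm (f x) - t"] that by (simp add: power2_diff field_simps power2_eq_square)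
    then show ?thesis by (auto simp: F_def indicator_def)
  qed
  have iF: "integrable lebesgue (F k)" for k
  proof (rule Bochner_Integration.integrable_bound)
    show "integrable lebesgue (\<lambda>x. (indicator (unit_cube_at k) x * (norm (f x))\<^sup>2 / 1 + 1 * indicator (unit_cube_at k) x) / 2)"
      using i1 i2 by auto
    show "F k \<in> borel_measurable lebesgue" unfolding F_def[abs_def] by measurable
    show "AE x in lebesgue. norm (F k x) \<le> norm ((indicator (unit_cube_at k) x * (norm (f x))\<^sup>2 / 1 + 1 * indicator (unit_cube_at k) x) / 2)"
      by (intro AE_I2 order_trans[OF Fle[of 1]]) auto
  qed
  have nF: "(\<integral>x. norm (F k x) \<partial>lebesgue) \<le> (J k / t + t) / 2" if "0 < t" for k t
  proof -
    have "(\<integral>x. norm (F k x) \<partial>lebesgue) \<le> (\<integral>x. (indicator (unit_cube_at k) x * (norm (f x))\<^sup>2 / t + t * indicator (unit_cube_at k) x) / 2 \<partial>lebesgue)"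
      using i1 i2 iF Fle[OF that] by (intro integral_mono) auto
    also have "\<dots> = (J k / t + t) / 2" using i1[of k] i2[of k] m1[of k] by (simp add: Jeq)
    finally show ?thesis .
  qed
  have "(\<integral>x. norm (F k x) \<partial>lebesgue) \<le> sqrt (J k)" for k
  proof (cases "J k = 0")
    case True
    have "(\<integral>x. norm (F k x) \<partial>lebesgue) \<le> e" if "0 < e" for e
      using nF[OF that, of k] True that by simp
    then show ?thesis using True field_le_epsilon[of "\<integral>x. norm (F k x) \<partial>lebesgue" 0] by simp
  next
    case False
    then have "0 < sqrt (J k)" using Jnn[of k] by simp
    from nF[OF this, of k] Jnn[of k] show ?thesis by (simp add: real_div_sqrt)
  qed
  then have sF: "(\<lambda>k. \<integral>x. norm (F k x) \<partial>lebesgue) summable_on UNIV"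
    by (intro summable_on_comparison_test[OF s]) auto
  note II = infsum_integral[OF countableI_type iF sF]
  show "integrable lebesgue f"
  proof (rule Bochner_Integration.integrable_bound[OF II(2) fm])
    show "AE x in lebesgue. norm (f x) \<le> norm (\<Sum>\<^sub>\<infinity>k. F k x)"
      using II(1)
    proof eventually_elim
      case (elim x)
      \<comment> \<open>The closed cubes share faces, so the pieces may add up to more than
        \<open>norm (f x)\<close>; one cube containing \<open>x\<close> is enough for
        domination.\<close>
      obtain k where k: "x \<in> unit_cube_at k" using unit_cubes_cover by blast
      have F: "F k x = of_real (norm (F k x))" for k unfolding F_def norm_of_real by simp
      have "norm (f x) = (\<Sum>k\<in>{k}. norm (F k x))" using k by (simp add: F_def)
      also have "\<dots> \<le> (\<Sum>\<^sub>\<infinity>k. norm (F k x))" by (rule finite_sum_le_infsum[OF elim]) auto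
      also have "\<dots> = norm (complex_of_real (\<Sum>\<^sub>\<infinity>k. norm (F k x)))" by (simp add: infsum_nonneg)
      also have "complex_of_real (\<Sum>\<^sub>\<infinity>k. norm (F k x)) = (\<Sum>\<^sub>\<infinity>k. F k x)"
      proof -
        have "((\<lambda>k. complex_of_real (norm (F k x))) has_sum of_real (\<Sum>\<^sub>\<infinity>k. norm (F k x))) UNIV"
          using has_sum_bounded_linear[OF bounded_linear_of_real has_sum_infsum[OF elim]] .
        then show ?thesis unfolding F[symmetric] by (rule infsumI[symmetric])
      qed
      finally show ?case .
    qed
  qed
qed

section \<open>Symmetric windows and reduction of the stated theorem to the abstract one\<close>

lemma symmetric_window:
  assumes "window W" "uminus ` W = W"
  obtains a where "0 < a" "W = {-a..a}"
proof -
  obtain c d where W: "W = {c..d}"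
    using assms(1) unfolding window_def by (metis is_interval_compact box_real(2))
  have cd: "c < d" using assms(1) by (auto simp: window_def W)
  have "{-d..-c} = {c..d}" using assms(2) by (simp add: W)
  then have "c = - d" using cd by (simp add: Icc_eq_Icc)
  then show thesis using that[of d] W cd by auto
qed

lemma Phi_window_char:
  assumes a: "0 < a" and \<epsilon>: "0 < \<epsilon>" "\<epsilon> < 1"
  shows "Phi {-a..a} \<epsilon> (- t) = (LBINT y. indicator {-a..a} y *\<^sub>R ee (- (y * t))) / of_real (2 * a)"
proof -
  have "(LBINT s. indicator {-a..a} s *\<^sub>R ee (- (s * (- t)))) = (LBINT y. indicator {-a..a} (0 - y) *\<^sub>R ee (- ((0 - y) * (- t))))"
    by (rule integral_lborel_shift(4)[symmetric])
  also have "\<dots> = (LBINT y. indicator {-a..a} y *\<^sub>R ee (- (y * t)))"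
    by (intro Bochner_Integration.integral_cong) (auto simp: indicator_def)
  finally show ?thesis by (simp add: Phi_eq[OF a refl \<epsilon>])
qed

lemma bessel_system_of_bessel_sequence:
  fixes \<Gamma> :: "((real^'m) \<times> real) set" and g g' :: "'k \<Rightarrow> real^'m \<Rightarrow> complex"
  assumes cp: "cut_project \<Gamma> B \<beta>" and a: "0 < a"
    and w: "\<And>k. k \<in> K \<Longrightarrow> g k \<in> wiener_amalgam 2 1"
    and bs: "bessel_sequence (K \<times> model_set \<Gamma> {-a..a}) (\<lambda>(k, l). translate l (g k)) C"
    and g': "\<And>k. k \<in> K \<Longrightarrow> g' k \<in> borel_measurable borel" "\<And>k. k \<in> K \<Longrightarrow> AE x in lborel. g k x = g' k x"
  shows "bessel_system \<Gamma> B \<beta> a K g' C"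
    and "\<And>k l. k \<in> K \<Longrightarrow> l \<in> model_set \<Gamma> {-a..a} \<Longrightarrow> translate l (g k) \<in> borel_measurable lebesgue"
proof -
  interpret cut_project \<Gamma> B \<beta> by (fact cp)
  have L2: "translate l (g k) \<in> L2_space" if "k \<in> K" "l \<in> model_set \<Gamma> {-a..a}" for k l
    using bs that by (auto simp: bessel_sequence_def)
  then show tm: "\<And>k l. k \<in> K \<Longrightarrow> l \<in> model_set \<Gamma> {-a..a} \<Longrightarrow> translate l (g k) \<in> borel_measurable lebesgue"
    by (auto simp: L2_space_def)
  have gm: "g k \<in> borel_measurable lebesgue" if "k \<in> K" for k using wiener_amalgam_integrable[OF w[OF that]] by simp
  \<comment> \<open>The Bessel hypothesis puts the translates in L2; the translate by 0, a point of
    the model set since \<open>a\<close> is positive, gives this for the generator itself.\<close>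
  have "(0, 0) \<in> \<Gamma>" using lattice_0 by (simp add: zero_prod_def)
  then have 0: "0 \<in> model_set \<Gamma> {-a..a}" using a by (force simp: model_set_def image_iff)
  show "bessel_system \<Gamma> B \<beta> a K g' C"
  proof (unfold_locales)
    show "integrable lborel (g' k)" if "k \<in> K" for k
      using integral_lebesgue_borel_version(2)[OF gm[OF that] g'[OF that]] wiener_amalgam_integrable[OF w[OF that]] by simp
    show "integrable lborel (\<lambda>x. (norm (g' k x))\<^sup>2)" if "k \<in> K" for k
      using L2_space_borel_version(1)[OF gm[OF that] g'[OF that]] L2[OF that 0] by (simp add: translate_def square_integrable_def)
    fix f :: "real^'m \<Rightarrow> complex" and F assume f: "f \<in> borel_measurable borel" "integrable lborel (\<lambda>x. (norm (f x :: complex))\<^sup>2)"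
      and F: "finite F" "F \<subseteq> K \<times> model_set \<Gamma> {-a..a}"
    have fl: "f \<in> borel_measurable lebesgue" using f(1) by (auto intro: measurable_completion)
    have fL: "f \<in> L2_space" "(L2_norm f)\<^sup>2 = (LBINT x. (norm (f x))\<^sup>2)"
      using L2_space_borel_version[OF fl f(1)] f by (auto simp: square_integrable_def)
    let ?s = "\<lambda>j. (cmod (L2_inner f (case j of (k, l) \<Rightarrow> translate l (g k))))\<^sup>2"
    have s: "?s summable_on (K \<times> model_set \<Gamma> {-a..a})" "infsum ?s (K \<times> model_set \<Gamma> {-a..a}) \<le> C * (L2_norm f)\<^sup>2"
      using bs fL(1) unfolding bessel_sequence_def by blast+
    have "(\<Sum>(k, l)\<in>F. (norm (corr f (g' k) l))\<^sup>2) = sum ?s F"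
    proof (rule sum.cong[OF refl])
      fix j assume "j \<in> F"
      then obtain k l where j: "j = (k, l)" "k \<in> K" "l \<in> model_set \<Gamma> {-a..a}" using F by auto
      have "L2_inner f (translate l (g k)) = corr f (g' k) l"
        by (rule L2_inner_borel_version[OF fl f(1) _ tm[OF j(2,3)] g'[OF j(2)]]) simp
      then show "(case j of (k, l) \<Rightarrow> (norm (corr f (g' k) l))\<^sup>2) = ?s j" by (simp add: j(1))
    qed
    also have "\<dots> \<le> infsum ?s (K \<times> model_set \<Gamma> {-a..a})"
      by (rule finite_sum_le_infsum[OF s(1) F]) auto
    also have "\<dots> \<le> C * (LBINT x. (norm (f x))\<^sup>2)" using s(2) by (simp add: fL(2))
    finally show "(\<Sum>(k, l)\<in>F. (norm (corr f (g' k) l))\<^sup>2) \<le> C * (LBINT x. (norm (f x))\<^sup>2)" .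
  qed (fact a)
qed

theorem theorem4p9:
  fixes \<Gamma> :: "((real^'m) \<times> real) set"
    and \<Omega> :: "real set"
    and \<epsilon> :: real
    and K :: "'k set"
    and g h :: "'k \<Rightarrow> real^'m \<Rightarrow> complex"
    and Bg Bh :: real
  assumes "model_lattice \<Gamma>"
    and "window \<Omega>"
    and "generic \<Gamma> \<Omega>"
    and "snd ` dual_lattice \<Gamma> \<inter> frontier \<Omega> = {}"
    and "uminus ` \<Omega> = \<Omega>"
    and "0 < \<epsilon>" and "\<epsilon> < 1"
    and "countable K"
    and "\<And>k. k \<in> K \<Longrightarrow> g k \<in> wiener_amalgam 2 1"
    and "\<And>k. k \<in> K \<Longrightarrow> h k \<in> wiener_amalgam 2 1"
    and "bessel_sequence (K \<times> model_set \<Gamma> \<Omega>) (\<lambda>(k, l). translate l (g k)) Bg"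
    and "bessel_sequence (K \<times> model_set \<Gamma> \<Omega>) (\<lambda>(k, l). translate l (h k)) Bh"
  shows "(\<forall>f\<in>L2_space.
            (\<Sum>\<^sub>\<infinity>k\<in>K. \<Sum>\<^sub>\<infinity>l\<in>model_set \<Gamma> \<Omega>.
                L2_inner f (translate l (g k)) * L2_inner (translate l (h k)) f)
              = of_real ((L2_norm f)\<^sup>2))
     \<longleftrightarrow>
         (\<forall>\<eta>\<in>dual_lattice \<Gamma>. AE t in lebesgue.
            of_real (point_density (model_set \<Gamma> \<Omega>)) * Phi \<Omega> \<epsilon> (- snd \<eta>) *
              (\<Sum>\<^sub>\<infinity>k\<in>K. cnj (fourier (g k) t) * fourier (h k) (t - fst \<eta>))
              = (if \<eta> = 0 then 1 else 0))"
proof -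
  obtain a where a: "0 < a" and \<Omega>: "\<Omega> = {-a..a}" using symmetric_window[OF assms(2,5)] .
  obtain B \<beta> where lb: "lattice_basis \<Gamma> B \<beta>" using assms(1) lattice_basis_exists unfolding model_lattice_def by blast
  have cp: "cut_project \<Gamma> B \<beta>"
    using assms(1) by (intro cut_project.intro lb) (auto simp: cut_project_axioms_def model_lattice_def)
  have "\<exists>g'. g' \<in> borel_measurable borel \<and> (AE x in lborel. g k x = g' x)" if "k \<in> K" for k
    using lebesgue_borel_version[OF wiener_amalgam_integrable(1)[OF assms(9)[OF that]]] by metis
  then obtain g' where g': "\<And>k. k \<in> K \<Longrightarrow> g' k \<in> borel_measurable borel" "\<And>k. k \<in> K \<Longrightarrow> AE x in lborel. g k x = g' k x"
    by metis
  have "\<exists>h'. h' \<in> borel_measurable borel \<and> (AE x in lborel. h k x = h' x)" if "k \<in> K" for k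
    using lebesgue_borel_version[OF wiener_amalgam_integrable(1)[OF assms(10)[OF that]]] by metis
  then obtain h' where h': "\<And>k. k \<in> K \<Longrightarrow> h' k \<in> borel_measurable borel" "\<And>k. k \<in> K \<Longrightarrow> AE x in lborel. h k x = h' k x"
    by metis
  have bg: "bessel_system \<Gamma> B \<beta> a K g' Bg" "\<And>k l. k \<in> K \<Longrightarrow> l \<in> model_set \<Gamma> {-a..a} \<Longrightarrow> translate l (g k) \<in> borel_measurable lebesgue"
    using bessel_system_of_bessel_sequence[OF cp a assms(9) assms(11)[unfolded \<Omega>] g'] by blast+
  have bh: "bessel_system \<Gamma> B \<beta> a K h' Bh" "\<And>k l. k \<in> K \<Longrightarrow> l \<in> model_set \<Gamma> {-a..a} \<Longrightarrow> translate l (h k) \<in> borel_measurable lebesgue"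
    using bessel_system_of_bessel_sequence[OF cp a assms(10) assms(12)[unfolded \<Omega>] h'] by blast+
  interpret bessel_pair \<Gamma> B \<beta> a K g' h' Bg Bh
    by (intro bessel_pair.intro bg(1) bh(1)) (rule bessel_pair_axioms.intro[OF assms(8)])
  have gF: "fourier (g k) = fourier (g' k)" if "k \<in> K" for k
    using fourier_borel_version[OF wiener_amalgam_integrable(1)[OF assms(9)[OF that]] g'[OF that]] .
  have hF: "fourier (h k) = fourier (h' k)" if "k \<in> K" for k
    using fourier_borel_version[OF wiener_amalgam_integrable(1)[OF assms(10)[OF that]] h'[OF that]] .
  \<comment> \<open>Genericity of the model set is exactly genericity of level 0 of the
    torus.\<close>
  have g0: "generic_level 0"
  proof -
    have "frontier {-a..a} = {-a, a}" using a by (auto simp: frontier_def)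
    then have "snd \<gamma> \<notin> {-a, a}" if "\<gamma> \<in> \<Gamma>" for \<gamma> using assms(3) that unfolding generic_def \<Omega> by blast
    then show ?thesis by (auto simp: generic_level_def)
  qed
  have form: "(\<Sum>\<^sub>\<infinity>k\<in>K. \<Sum>\<^sub>\<infinity>l\<in>\<Lambda>. L2_inner f (translate l (g k)) * L2_inner (translate l (h k)) f) = frame_form f' f'"
    if f: "f \<in> borel_measurable lebesgue" "f' \<in> borel_measurable borel" "AE x in lborel. f x = f' x" and sq: "square_integrable f'" for f f'
  proof -
    have "L2_inner f (translate l (g k)) * L2_inner (translate l (h k)) f = corr f' (g' k) l * cnj (corr f' (h' k) l)"
      if k: "k \<in> K" and l: "l \<in> \<Lambda>" for k l
    proof -
      have "L2_inner (translate l (h k)) f = cnj (L2_inner f (translate l (h k)))"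
        unfolding L2_inner_def Bochner_Integration.integral_cnj[symmetric] by (simp add: mult.commute)
      then show ?thesis
        by (simp add: L2_inner_borel_version[OF f bg(2)[OF k l] g'[OF k]] L2_inner_borel_version[OF f bh(2)[OF k l] h'[OF k]])
    qed
    then have "(\<Sum>\<^sub>\<infinity>k\<in>K. \<Sum>\<^sub>\<infinity>l\<in>\<Lambda>. L2_inner f (translate l (g k)) * L2_inner (translate l (h k)) f)
      = (\<Sum>\<^sub>\<infinity>k\<in>K. \<Sum>\<^sub>\<infinity>l\<in>\<Lambda>. corr f' (g' k) l * cnj (corr f' (h' k) l))"
      by (intro infsum_cong) auto
    also have "\<dots> = frame_form f' f'"
      \<comment> \<open>The two Bessel bounds make the double family absolutely summable, so the
        iterated sum agrees with the unordered sum over pairs.\<close>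
      unfolding frame_form_def by (rule infsum_Sigma'_banach[OF frame_terms_summable[OF sq sq]])
    finally show ?thesis .
  qed
  have left: "(\<forall>f\<in>L2_space. (\<Sum>\<^sub>\<infinity>k\<in>K. \<Sum>\<^sub>\<infinity>l\<in>\<Lambda>. L2_inner f (translate l (g k)) * L2_inner (translate l (h k)) f) = of_real ((L2_norm f)\<^sup>2))
    \<longleftrightarrow> (\<forall>f. square_integrable f \<longrightarrow> frame_form f f = of_real (LBINT x. (norm (f x))\<^sup>2))"
  proof (intro iffI allI impI ballI)
    fix f :: "real^'m \<Rightarrow> complex"
    assume L: "\<forall>f\<in>L2_space. (\<Sum>\<^sub>\<infinity>k\<in>K. \<Sum>\<^sub>\<infinity>l\<in>\<Lambda>. L2_inner f (translate l (g k)) * L2_inner (translate l (h k)) f) = of_real ((L2_norm f)\<^sup>2)"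
      and f: "square_integrable f"
    then have fb: "f \<in> borel_measurable borel" by (simp add: square_integrable_def)
    then have fl: "f \<in> borel_measurable lebesgue" by (auto intro: measurable_completion)
    have AE: "AE x in lborel. f x = f x" by simp
    show "frame_form f f = of_real (LBINT x. (norm (f x))\<^sup>2)"
      using L[rule_format, of f] L2_space_borel_version[OF fl fb AE] form[OF fl fb AE f] f by simp
  next
    fix f :: "real^'m \<Rightarrow> complex"
    assume R: "\<forall>f. square_integrable f \<longrightarrow> frame_form f f = of_real (LBINT x. (norm (f x))\<^sup>2)"
      and f: "f \<in> L2_space"
    then have fl: "f \<in> borel_measurable lebesgue" by (simp add: L2_space_def)
    obtain f' where f': "f' \<in> borel_measurable borel" "AE x in lborel. f x = f' x" using lebesgue_borel_version[OF fl] .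
    have sq: "square_integrable f'" using L2_space_borel_version(1)[OF fl f'] f by simp
    show "(\<Sum>\<^sub>\<infinity>k\<in>K. \<Sum>\<^sub>\<infinity>l\<in>\<Lambda>. L2_inner f (translate l (g k)) * L2_inner (translate l (h k)) f) = of_real ((L2_norm f)\<^sup>2)"
      using R[rule_format, OF sq] L2_space_borel_version(2)[OF fl f'] form[OF fl f' sq] by simp
  qed
  have right: "(AE t in lebesgue. of_real (point_density \<Lambda>) * Phi {-a..a} \<epsilon> (- snd \<eta>) *
        (\<Sum>\<^sub>\<infinity>k\<in>K. cnj (fourier (g k) t) * fourier (h k) (t - fst \<eta>)) = (if \<eta> = 0 then 1 else 0))
    \<longleftrightarrow> (AE t in lborel. window_char (snd \<eta>) * symbol (fst \<eta>) t = (if \<eta> = 0 then of_real G.covol else 0))" for \<eta>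
  proof -
    have sym: "(\<Sum>\<^sub>\<infinity>k\<in>K. cnj (fourier (g k) t) * fourier (h k) (t - fst \<eta>)) = symbol (fst \<eta>) t" for t
      unfolding symbol_def by (rule infsum_cong) (simp add: gF hF)
    \<comment> \<open>The factor \<open>2 * a\<close> of the density cancels the one in the
      denominator of \<Phi>, and only the covolume remains.\<close>
    have D: "of_real (point_density \<Lambda>) * Phi {-a..a} \<epsilon> (- snd \<eta>) = window_char (snd \<eta>) / of_real G.covol"
      unfolding G.point_density_model_set[OF a] Phi_window_char[OF a assms(6,7)] window_char_def using a by simp
    have "w / of_real G.covol * s = (if \<eta> = 0 then 1 else 0) \<longleftrightarrow> w * s = (if \<eta> = 0 then of_real G.covol else 0)" for w s :: complex
      using G.covol_pos by (cases "\<eta> = 0") (auto simp: field_simps)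
    then show ?thesis unfolding sym D AE_completion_iff by simp
  qed
  show ?thesis
    unfolding \<Omega> left right by (rule reproducing_iff_symbol[OF g0])
qed

end
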